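(* Let $\mathcal C$ be a finite tensor category over $k$ with distinguished invertible object $D$. There is an isomorphism $$\mathcal C_{A_2}\big(\mathbf 1,(A_2(D),\mu_2(D))\big)\;\cong\;\mathcal C^{Z_4}\big((Z_4(D^\vee),\Delta^4(D^\vee)),\mathbf 1\big)$$ between the space of right monadic cointegrals of $\mathcal C$ and the space of categorical cointegrals of $\mathcal C$.
   Context: Fix an algebraically closed field $k$. A finite tensor category is a $k$-linear abelian rigid monoidal category with finite-dimensional Hom-spaces, all objects of finite length, finitely many isomorphism classes of simple objects, enough projectives, $k$-bilinear tensor product and simple unit $\mathbf 1$. Coherence isomorphisms are suppressed. Left duals: $\mathrm{ev}^l_X:X^\vee\otimes X\to\mathbf 1$, $\mathrm{coev}^l_X:\mathbf 1\to X\otimes X^\vee$. $\gamma_{V,W}:V^\vee\otimes W^\vee\to(W\otimes V)^\vee$ is the canonical isomorphism. $D$ is the socle of the projective cover of $\mathbf 1$ (an invertible object). $A_2(V)=\int^XX^\vee\otimes(V\otimes X)$ with universal dinatural transformation $\iota_2(V)_X$ is a Hopf monad: $\mu_2(V)\circ\iota_2(A_2V)_Y\circ(\mathrm{id}_{Y^\vee}\otimes\iota_2(V)_X\otimes\mathrm{id}_Y)=\iota_2(V)_{X\otimes Y}\circ(\gamma_{Y,X}\otimes\mathrm{id})$; unit $\iota_2(V)_{\mathbf 1}$; counit $\epsilon_2\circ\iota_2(\mathbf 1)_X=\mathrm{ev}^l_X$. $\mathcal C_{A_2}$ is the category of $A_2$-modules, $\mathbf 1$ being an $A_2$-module via $\epsilon_2$.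 A right monadic cointegral is an $A_2$-module morphism from $\mathbf 1$ to the free module $(A_2(D),\mu_2(D))$. $Z_4(V)=\int_X(X\otimes V)\otimes X^\vee$ with universal dinatural transformation $\pi_4(V)_X:Z_4(V)\to(X\otimes V)\otimes X^\vee$ is a Hopf comonad: comultiplication $\Delta^4(V):Z_4(V)\to Z_4Z_4(V)$ with $(\mathrm{id}_X\otimes\pi_4(V)_Y\otimes\mathrm{id}_{X^\vee})\circ\pi_4(Z_4V)_X\circ\Delta^4(V)=(\mathrm{id}\otimes\gamma_{Y,X}^{-1})\circ\pi_4(V)_{X\otimes Y}$; counit $\pi_4(V)_{\mathbf 1}$; unit $u^4:\mathbf 1\to Z_4(\mathbf 1)$ with $\pi_4(\mathbf 1)_X\circ u^4=\mathrm{coev}^l_X$. $\mathcal C^{Z_4}$ is the category of $Z_4$-comodules, $\mathbf 1$ being a comodule via $u^4$. A categorical cointegral is a $Z_4$-comodule morphism from the cofree comodule $(Z_4(D^\vee),\Delta^4(D^\vee))$ to $\mathbf 1$. *)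

theory Defs
  imports
    "HOL-Algebra.Algebraic_Closure"
    "Jordan_Normal_Form.Missing_VectorSpace"
begin

text \<open>Otherwise the name \<open>X\<close> would denote the polynomial variable of HOL-Algebra.\<close>

no_notation Polynomials.var (\<open>X\<index>\<close>)

section \<open>Linear and abelian categories\<close>

text \<open>
  The hom-spaces are HOL-Algebra modules; the ring multiplication and ring unit that the record type
  \<open>module\<close> carries along are never used. Composition is written in the usual order,
  \<open>g \<cdot> f\<close> meaning \<open>f\<close> first.
\<close>

record ('k, 'o, 'm) lin_cat =
  Obj :: "'o set"
  Hom :: "'o \<Rightarrow> 'o \<Rightarrow> ('k, 'm) module"
  Dom :: "'m \<Rightarrow> 'o"
  Cod :: "'m \<Rightarrow> 'o"
  Ide :: "'o \<Rightarrow> 'm" (\<open>\<i>\<d>\<index>\<close>)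
  Comp :: "'m \<Rightarrow> 'm \<Rightarrow> 'm" (infixr \<open>\<cdot>\<index>\<close> 55)

abbreviation homset :: "('k, 'o, 'm, 'c) lin_cat_scheme \<Rightarrow> 'o \<Rightarrow> 'o \<Rightarrow> 'm set" where
  "homset C X Y \<equiv> carrier (Hom C X Y)"

locale linear_category =
  fixes K :: "('k, 'r) ring_scheme" and C :: "('k, 'o, 'm, 'c) lin_cat_scheme" (structure)
  assumes field: "field K"
    and hom_vectorspace: "\<lbrakk>X \<in> Obj C; Y \<in> Obj C\<rbrakk> \<Longrightarrow> vectorspace K (Hom C X Y)"
    and dom_cod: "\<lbrakk>X \<in> Obj C; Y \<in> Obj C; f \<in> homset C X Y\<rbrakk> \<Longrightarrow> Dom C f = X \<and> Cod C f = Y"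
    and ide_closed: "X \<in> Obj C \<Longrightarrow> Ide C X \<in> homset C X X"
    and comp_closed: "\<lbrakk>X \<in> Obj C; Y \<in> Obj C; Z \<in> Obj C; f \<in> homset C X Y; g \<in> homset C Y Z\<rbrakk>
      \<Longrightarrow> g \<cdot> f \<in> homset C X Z"
    and comp_assoc: "\<lbrakk>W \<in> Obj C; X \<in> Obj C; Y \<in> Obj C; Z \<in> Obj C;
      f \<in> homset C W X; g \<in> homset C X Y; h \<in> homset C Y Z\<rbrakk> \<Longrightarrow> (h \<cdot> g) \<cdot> f = h \<cdot> (g \<cdot> f)"
    and comp_ide_left: "\<lbrakk>X \<in> Obj C; Y \<in> Obj C; f \<in> homset C X Y\<rbrakk> \<Longrightarrow> Ide C Y \<cdot> f = f"
    and comp_ide_right: "\<lbrakk>X \<in> Obj C; Y \<in> Obj C; f \<in> homset C X Y\<rbrakk> \<Longrightarrow> f \<cdot> Ide C X = f"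
    and comp_add_left: "\<lbrakk>X \<in> Obj C; Y \<in> Obj C; Z \<in> Obj C;
      f \<in> homset C X Y; g \<in> homset C Y Z; h \<in> homset C Y Z\<rbrakk>
      \<Longrightarrow> (g \<oplus>\<^bsub>Hom C Y Z\<^esub> h) \<cdot> f = (g \<cdot> f) \<oplus>\<^bsub>Hom C X Z\<^esub> (h \<cdot> f)"
    and comp_add_right: "\<lbrakk>X \<in> Obj C; Y \<in> Obj C; Z \<in> Obj C;
      f \<in> homset C X Y; g \<in> homset C X Y; h \<in> homset C Y Z\<rbrakk>
      \<Longrightarrow> h \<cdot> (f \<oplus>\<^bsub>Hom C X Y\<^esub> g) = (h \<cdot> f) \<oplus>\<^bsub>Hom C X Z\<^esub> (h \<cdot> g)"
    and comp_smult_left: "\<lbrakk>X \<in> Obj C; Y \<in> Obj C; Z \<in> Obj C; a \<in> carrier K;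
      f \<in> homset C X Y; g \<in> homset C Y Z\<rbrakk>
      \<Longrightarrow> (a \<odot>\<^bsub>Hom C Y Z\<^esub> g) \<cdot> f = a \<odot>\<^bsub>Hom C X Z\<^esub> (g \<cdot> f)"
    and comp_smult_right: "\<lbrakk>X \<in> Obj C; Y \<in> Obj C; Z \<in> Obj C; a \<in> carrier K;
      f \<in> homset C X Y; g \<in> homset C Y Z\<rbrakk>
      \<Longrightarrow> g \<cdot> (a \<odot>\<^bsub>Hom C X Y\<^esub> f) = a \<odot>\<^bsub>Hom C X Z\<^esub> (g \<cdot> f)"

context
  fixes C :: "('k, 'o, 'm, 'c) lin_cat_scheme" (structure)
begin

definition iso_arr :: "'o \<Rightarrow> 'o \<Rightarrow> 'm \<Rightarrow> bool" where
  "iso_arr X Y f \<longleftrightarrow> f \<in> homset C X Y \<and>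
     (\<exists>g\<in>homset C Y X. g \<cdot> f = Ide C X \<and> f \<cdot> g = Ide C Y)"

definition isomorphic :: "'o \<Rightarrow> 'o \<Rightarrow> bool" where
  "isomorphic X Y \<longleftrightarrow> (\<exists>f. iso_arr X Y f)"

definition inverse_arr :: "'m \<Rightarrow> 'm" where
  "inverse_arr f = (THE g. g \<in> homset C (Cod C f) (Dom C f) \<and>
     g \<cdot> f = Ide C (Dom C f) \<and> f \<cdot> g = Ide C (Cod C f))"

definition monic :: "'o \<Rightarrow> 'o \<Rightarrow> 'm \<Rightarrow> bool" where
  "monic X Y f \<longleftrightarrow> f \<in> homset C X Y \<and>
     (\<forall>W\<in>Obj C. \<forall>g\<in>homset C W X. \<forall>h\<in>homset C W X. f \<cdot> g = f \<cdot> h \<longrightarrow> g = h)"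

definition epic :: "'o \<Rightarrow> 'o \<Rightarrow> 'm \<Rightarrow> bool" where
  "epic X Y f \<longleftrightarrow> f \<in> homset C X Y \<and>
     (\<forall>Z\<in>Obj C. \<forall>g\<in>homset C Y Z. \<forall>h\<in>homset C Y Z. g \<cdot> f = h \<cdot> f \<longrightarrow> g = h)"

definition zero_object :: "'o \<Rightarrow> bool" where
  "zero_object Z \<longleftrightarrow> Z \<in> Obj C \<and>
     (\<forall>X\<in>Obj C. (\<exists>!f. f \<in> homset C X Z) \<and> (\<exists>!f. f \<in> homset C Z X))"

definition is_biproduct :: "'o \<Rightarrow> 'o \<Rightarrow> 'o \<Rightarrow> 'm \<Rightarrow> 'm \<Rightarrow> 'm \<Rightarrow> 'm \<Rightarrow> bool" where
  "is_biproduct X Y B i j p q \<longleftrightarrow> B \<in> Obj C \<and>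
     i \<in> homset C X B \<and> j \<in> homset C Y B \<and> p \<in> homset C B X \<and> q \<in> homset C B Y \<and>
     p \<cdot> i = Ide C X \<and> q \<cdot> j = Ide C Y \<and>
     q \<cdot> i = \<zero>\<^bsub>Hom C X Y\<^esub> \<and> p \<cdot> j = \<zero>\<^bsub>Hom C Y X\<^esub> \<and>
     (i \<cdot> p) \<oplus>\<^bsub>Hom C B B\<^esub> (j \<cdot> q) = Ide C B"

definition is_kernel :: "'o \<Rightarrow> 'o \<Rightarrow> 'm \<Rightarrow> 'o \<Rightarrow> 'm \<Rightarrow> bool" where
  "is_kernel X Y f N n \<longleftrightarrow> f \<in> homset C X Y \<and> N \<in> Obj C \<and> n \<in> homset C N X \<and>
     f \<cdot> n = \<zero>\<^bsub>Hom C N Y\<^esub> \<and>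
     (\<forall>W\<in>Obj C. \<forall>g\<in>homset C W X. f \<cdot> g = \<zero>\<^bsub>Hom C W Y\<^esub> \<longrightarrow>
        (\<exists>!h. h \<in> homset C W N \<and> n \<cdot> h = g))"

definition is_cokernel :: "'o \<Rightarrow> 'o \<Rightarrow> 'm \<Rightarrow> 'o \<Rightarrow> 'm \<Rightarrow> bool" where
  "is_cokernel X Y f Q q \<longleftrightarrow> f \<in> homset C X Y \<and> Q \<in> Obj C \<and> q \<in> homset C Y Q \<and>
     q \<cdot> f = \<zero>\<^bsub>Hom C X Q\<^esub> \<and>
     (\<forall>W\<in>Obj C. \<forall>g\<in>homset C Y W. g \<cdot> f = \<zero>\<^bsub>Hom C X W\<^esub> \<longrightarrow>
        (\<exists>!h. h \<in> homset C Q W \<and> h \<cdot> q = g))"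

definition simple_object :: "'o \<Rightarrow> bool" where
  "simple_object S \<longleftrightarrow> S \<in> Obj C \<and> \<not> zero_object S \<and>
     (\<forall>Y\<in>Obj C. \<forall>m. monic Y S m \<longrightarrow> zero_object Y \<or> iso_arr Y S m)"

text \<open>Existence of a composition series: finitely many extensions by simple quotients, starting
  from a zero object.\<close>

inductive finite_length :: "'o \<Rightarrow> bool" where
  zero: "zero_object Z \<Longrightarrow> finite_length Z"
| extend: "\<lbrakk>finite_length Y; X \<in> Obj C; monic Y X i; is_cokernel Y X i S q; simple_object S\<rbrakk>
    \<Longrightarrow> finite_length X"

text \<open>Finite direct sums of simple objects.\<close>

inductive semisimple :: "'o \<Rightarrow> bool" where
  zero: "zero_object Z \<Longrightarrow> semisimple Z"
| sum: "\<lbrakk>semisimple X; simple_object S; is_biproduct X S B i j p q\<rbrakk> \<Longrightarrow> semisimple B"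

definition is_socle :: "'o \<Rightarrow> 'o \<Rightarrow> 'm \<Rightarrow> bool" where
  "is_socle P D s \<longleftrightarrow> semisimple D \<and> monic D P s \<and>
     (\<forall>T t. semisimple T \<and> monic T P t \<longrightarrow> (\<exists>u\<in>homset C T D. s \<cdot> u = t))"

definition projective :: "'o \<Rightarrow> bool" where
  "projective P \<longleftrightarrow> P \<in> Obj C \<and>
     (\<forall>X\<in>Obj C. \<forall>Y\<in>Obj C. \<forall>e f. epic X Y e \<and> f \<in> homset C P Y \<longrightarrow>
        (\<exists>g\<in>homset C P X. e \<cdot> g = f))"

text \<open>A projective object with an essential epimorphism onto \<open>X\<close>.\<close>

definition is_projective_cover :: "'o \<Rightarrow> 'o \<Rightarrow> 'm \<Rightarrow> bool" where
  "is_projective_cover X P p \<longleftrightarrow> projective P \<and> epic P X p \<and>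
     (\<forall>Z\<in>Obj C. \<forall>g\<in>homset C Z P. epic Z X (p \<cdot> g) \<longrightarrow> epic Z P g)"

text \<open>
  For a functor \<open>F : C\<^sup>o\<^sup>p \<times> C \<rightarrow> C\<close> with object part \<open>Fo\<close> and morphism part \<open>Fm\<close>
  (contravariant argument first), \<open>i\<close> is a dinatural transformation from \<open>F\<close> to the constant
  functor \<open>T\<close>, respectively from the constant functor \<open>T\<close> to \<open>F\<close>.
\<close>

definition dinatural_to :: "('o \<Rightarrow> 'o \<Rightarrow> 'o) \<Rightarrow> ('m \<Rightarrow> 'm \<Rightarrow> 'm) \<Rightarrow> 'o \<Rightarrow> ('o \<Rightarrow> 'm) \<Rightarrow> bool" where
  "dinatural_to Fo Fm T i \<longleftrightarrow> (\<forall>X\<in>Obj C. i X \<in> homset C (Fo X X) T) \<and>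
     (\<forall>X\<in>Obj C. \<forall>Y\<in>Obj C. \<forall>f\<in>homset C X Y.
        i X \<cdot> Fm f (Ide C X) = i Y \<cdot> Fm (Ide C Y) f)"

definition dinatural_from :: "('o \<Rightarrow> 'o \<Rightarrow> 'o) \<Rightarrow> ('m \<Rightarrow> 'm \<Rightarrow> 'm) \<Rightarrow> 'o \<Rightarrow> ('o \<Rightarrow> 'm) \<Rightarrow> bool" where
  "dinatural_from Fo Fm T i \<longleftrightarrow> (\<forall>X\<in>Obj C. i X \<in> homset C T (Fo X X)) \<and>
     (\<forall>X\<in>Obj C. \<forall>Y\<in>Obj C. \<forall>f\<in>homset C X Y.
        Fm (Ide C X) f \<cdot> i X = Fm f (Ide C Y) \<cdot> i Y)"

definition is_coend :: "('o \<Rightarrow> 'o \<Rightarrow> 'o) \<Rightarrow> ('m \<Rightarrow> 'm \<Rightarrow> 'm) \<Rightarrow> 'o \<Rightarrow> ('o \<Rightarrow> 'm) \<Rightarrow> bool" where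
  "is_coend Fo Fm T i \<longleftrightarrow> T \<in> Obj C \<and> dinatural_to Fo Fm T i \<and>
     (\<forall>S\<in>Obj C. \<forall>j. dinatural_to Fo Fm S j \<longrightarrow>
        (\<exists>!h. h \<in> homset C T S \<and> (\<forall>X\<in>Obj C. h \<cdot> i X = j X)))"

definition is_end :: "('o \<Rightarrow> 'o \<Rightarrow> 'o) \<Rightarrow> ('m \<Rightarrow> 'm \<Rightarrow> 'm) \<Rightarrow> 'o \<Rightarrow> ('o \<Rightarrow> 'm) \<Rightarrow> bool" where
  "is_end Fo Fm T p \<longleftrightarrow> T \<in> Obj C \<and> dinatural_from Fo Fm T p \<and>
     (\<forall>S\<in>Obj C. \<forall>j. dinatural_from Fo Fm S j \<longrightarrow>
        (\<exists>!h. h \<in> homset C S T \<and> (\<forall>X\<in>Obj C. p X \<cdot> h = j X)))"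

text \<open>
  Morphism spaces in the category of modules over a monad, respectively comodules over a comonad,
  whose underlying functor acts on morphisms by \<open>T\<close>. An object is given by its
  underlying object of \<open>C\<close> together with its (co)action.
\<close>

fun monad_module_Hom :: "('m \<Rightarrow> 'm) \<Rightarrow> 'o \<times> 'm \<Rightarrow> 'o \<times> 'm \<Rightarrow> ('k, 'm) module" where
  "monad_module_Hom T (M, r) (N, s) =
     (Hom C M N)\<lparr>carrier := {f \<in> homset C M N. f \<cdot> r = s \<cdot> T f}\<rparr>"

fun comonad_comodule_Hom :: "('m \<Rightarrow> 'm) \<Rightarrow> 'o \<times> 'm \<Rightarrow> 'o \<times> 'm \<Rightarrow> ('k, 'm) module" where
  "comonad_comodule_Hom T (M, r) (N, s) =
     (Hom C M N)\<lparr>carrier := {f \<in> homset C M N. s \<cdot> f = T f \<cdot> r}\<rparr>"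

end

locale abelian_category = linear_category +
  assumes zero_object_exists: "\<exists>Z. zero_object C Z"
    and biproduct_exists: "\<lbrakk>X \<in> Obj C; Y \<in> Obj C\<rbrakk> \<Longrightarrow> \<exists>B i j p q. is_biproduct C X Y B i j p q"
    and kernel_exists: "\<lbrakk>X \<in> Obj C; Y \<in> Obj C; f \<in> homset C X Y\<rbrakk> \<Longrightarrow> \<exists>N n. is_kernel C X Y f N n"
    and cokernel_exists: "\<lbrakk>X \<in> Obj C; Y \<in> Obj C; f \<in> homset C X Y\<rbrakk> \<Longrightarrow> \<exists>Q q. is_cokernel C X Y f Q q"
    and monic_is_kernel: "\<lbrakk>X \<in> Obj C; Y \<in> Obj C; monic C X Y m\<rbrakk>
      \<Longrightarrow> \<exists>Z\<in>Obj C. \<exists>f. is_kernel C Y Z f X m"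
    and epic_is_cokernel: "\<lbrakk>X \<in> Obj C; Y \<in> Obj C; epic C X Y e\<rbrakk>
      \<Longrightarrow> \<exists>Z\<in>Obj C. \<exists>f. is_cokernel C Z X f Y e"


section \<open>Finite tensor categories\<close>

text \<open>
  The monoidal structure is not assumed strict. Chosen left duals
  \<open>Ev X : X\<^sup>\<or> \<otimes> X \<rightarrow> \<one>\<close>, \<open>Coev X : \<one> \<rightarrow> X \<otimes> X\<^sup>\<or>\<close> are part of the data.
\<close>

record ('k, 'o, 'm) tensor_cat = "('k, 'o, 'm) lin_cat" +
  TObj :: "'o \<Rightarrow> 'o \<Rightarrow> 'o" (infixr \<open>\<otimes>\<^sub>o\<index>\<close> 70)
  TMor :: "'m \<Rightarrow> 'm \<Rightarrow> 'm" (infixr \<open>\<otimes>\<^sub>m\<index>\<close> 70)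
  UnitObj :: "'o" (\<open>\<one>\<^sub>o\<index>\<close>)
  Assoc :: "'o \<Rightarrow> 'o \<Rightarrow> 'o \<Rightarrow> 'm"
  LUnit :: "'o \<Rightarrow> 'm"
  RUnit :: "'o \<Rightarrow> 'm"
  LDual :: "'o \<Rightarrow> 'o" (\<open>_\<^sup>\<or>\<index>\<close> [1000] 999)
  Ev :: "'o \<Rightarrow> 'm"
  Coev :: "'o \<Rightarrow> 'm"

context
  fixes C :: "('k, 'o, 'm, 'c) tensor_cat_scheme" (structure)
begin

definition is_left_dual :: "'o \<Rightarrow> 'o \<Rightarrow> 'm \<Rightarrow> 'm \<Rightarrow> bool" where
  "is_left_dual X' X e c \<longleftrightarrow>
     e \<in> homset C (X' \<otimes>\<^sub>o X) \<one>\<^sub>o \<and> c \<in> homset C \<one>\<^sub>o (X \<otimes>\<^sub>o X') \<and>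
     RUnit C X \<cdot> (\<i>\<d> X \<otimes>\<^sub>m e) \<cdot> Assoc C X X' X \<cdot> (c \<otimes>\<^sub>m \<i>\<d> X) = LUnit C X \<and>
     LUnit C X' \<cdot> (e \<otimes>\<^sub>m \<i>\<d> X') \<cdot> inverse_arr C (Assoc C X' X X') \<cdot> (\<i>\<d> X' \<otimes>\<^sub>m c) = RUnit C X'"

end

locale finite_tensor_category =
  abelian_category K C + algebraically_closed K
  for K :: "('k, 'r) ring_scheme" and C :: "('k, 'o, 'm, 'c) tensor_cat_scheme" (structure) +
  assumes tensor_obj_closed: "\<lbrakk>X \<in> Obj C; Y \<in> Obj C\<rbrakk> \<Longrightarrow> X \<otimes>\<^sub>o Y \<in> Obj C"
    and unit_closed: "\<one>\<^sub>o \<in> Obj C"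
    and tensor_mor_closed: "\<lbrakk>X \<in> Obj C; Y \<in> Obj C; X' \<in> Obj C; Y' \<in> Obj C;
      f \<in> homset C X Y; g \<in> homset C X' Y'\<rbrakk> \<Longrightarrow> f \<otimes>\<^sub>m g \<in> homset C (X \<otimes>\<^sub>o X') (Y \<otimes>\<^sub>o Y')"
    and tensor_ide: "\<lbrakk>X \<in> Obj C; Y \<in> Obj C\<rbrakk> \<Longrightarrow> \<i>\<d> X \<otimes>\<^sub>m \<i>\<d> Y = \<i>\<d> (X \<otimes>\<^sub>o Y)"
    and tensor_comp: "\<lbrakk>X \<in> Obj C; Y \<in> Obj C; Z \<in> Obj C; X' \<in> Obj C; Y' \<in> Obj C; Z' \<in> Obj C;
      f \<in> homset C X Y; g \<in> homset C Y Z; f' \<in> homset C X' Y'; g' \<in> homset C Y' Z'\<rbrakk>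
      \<Longrightarrow> (g \<cdot> f) \<otimes>\<^sub>m (g' \<cdot> f') = (g \<otimes>\<^sub>m g') \<cdot> (f \<otimes>\<^sub>m f')"
    and tensor_add_left: "\<lbrakk>X \<in> Obj C; Y \<in> Obj C; X' \<in> Obj C; Y' \<in> Obj C;
      f \<in> homset C X Y; g \<in> homset C X Y; h \<in> homset C X' Y'\<rbrakk> \<Longrightarrow>
      (f \<oplus>\<^bsub>Hom C X Y\<^esub> g) \<otimes>\<^sub>m h =
        (f \<otimes>\<^sub>m h) \<oplus>\<^bsub>Hom C (X \<otimes>\<^sub>o X') (Y \<otimes>\<^sub>o Y')\<^esub> (g \<otimes>\<^sub>m h)"
    and tensor_add_right: "\<lbrakk>X \<in> Obj C; Y \<in> Obj C; X' \<in> Obj C; Y' \<in> Obj C;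
      f \<in> homset C X Y; g \<in> homset C X' Y'; h \<in> homset C X' Y'\<rbrakk> \<Longrightarrow>
      f \<otimes>\<^sub>m (g \<oplus>\<^bsub>Hom C X' Y'\<^esub> h) =
        (f \<otimes>\<^sub>m g) \<oplus>\<^bsub>Hom C (X \<otimes>\<^sub>o X') (Y \<otimes>\<^sub>o Y')\<^esub> (f \<otimes>\<^sub>m h)"
    and tensor_smult_left: "\<lbrakk>X \<in> Obj C; Y \<in> Obj C; X' \<in> Obj C; Y' \<in> Obj C; a \<in> carrier K;
      f \<in> homset C X Y; g \<in> homset C X' Y'\<rbrakk> \<Longrightarrow>
      (a \<odot>\<^bsub>Hom C X Y\<^esub> f) \<otimes>\<^sub>m g = a \<odot>\<^bsub>Hom C (X \<otimes>\<^sub>o X') (Y \<otimes>\<^sub>o Y')\<^esub> (f \<otimes>\<^sub>m g)"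
    and tensor_smult_right: "\<lbrakk>X \<in> Obj C; Y \<in> Obj C; X' \<in> Obj C; Y' \<in> Obj C; a \<in> carrier K;
      f \<in> homset C X Y; g \<in> homset C X' Y'\<rbrakk> \<Longrightarrow>
      f \<otimes>\<^sub>m (a \<odot>\<^bsub>Hom C X' Y'\<^esub> g) = a \<odot>\<^bsub>Hom C (X \<otimes>\<^sub>o X') (Y \<otimes>\<^sub>o Y')\<^esub> (f \<otimes>\<^sub>m g)"
    and assoc_iso: "\<lbrakk>X \<in> Obj C; Y \<in> Obj C; Z \<in> Obj C\<rbrakk> \<Longrightarrow>
      iso_arr C ((X \<otimes>\<^sub>o Y) \<otimes>\<^sub>o Z) (X \<otimes>\<^sub>o (Y \<otimes>\<^sub>o Z)) (Assoc C X Y Z)"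
    and assoc_natural: "\<lbrakk>X \<in> Obj C; Y \<in> Obj C; Z \<in> Obj C; X' \<in> Obj C; Y' \<in> Obj C; Z' \<in> Obj C;
      f \<in> homset C X X'; g \<in> homset C Y Y'; h \<in> homset C Z Z'\<rbrakk> \<Longrightarrow>
      Assoc C X' Y' Z' \<cdot> ((f \<otimes>\<^sub>m g) \<otimes>\<^sub>m h) = (f \<otimes>\<^sub>m (g \<otimes>\<^sub>m h)) \<cdot> Assoc C X Y Z"
    and lunit_iso: "X \<in> Obj C \<Longrightarrow> iso_arr C (\<one>\<^sub>o \<otimes>\<^sub>o X) X (LUnit C X)"
    and lunit_natural: "\<lbrakk>X \<in> Obj C; Y \<in> Obj C; f \<in> homset C X Y\<rbrakk> \<Longrightarrow>
      LUnit C Y \<cdot> (\<i>\<d> \<one>\<^sub>o \<otimes>\<^sub>m f) = f \<cdot> LUnit C X"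
    and runit_iso: "X \<in> Obj C \<Longrightarrow> iso_arr C (X \<otimes>\<^sub>o \<one>\<^sub>o) X (RUnit C X)"
    and runit_natural: "\<lbrakk>X \<in> Obj C; Y \<in> Obj C; f \<in> homset C X Y\<rbrakk> \<Longrightarrow>
      RUnit C Y \<cdot> (f \<otimes>\<^sub>m \<i>\<d> \<one>\<^sub>o) = f \<cdot> RUnit C X"
    and pentagon: "\<lbrakk>W \<in> Obj C; X \<in> Obj C; Y \<in> Obj C; Z \<in> Obj C\<rbrakk> \<Longrightarrow>
      Assoc C W X (Y \<otimes>\<^sub>o Z) \<cdot> Assoc C (W \<otimes>\<^sub>o X) Y Z =
      (\<i>\<d> W \<otimes>\<^sub>m Assoc C X Y Z) \<cdot> Assoc C W (X \<otimes>\<^sub>o Y) Z \<cdot> (Assoc C W X Y \<otimes>\<^sub>m \<i>\<d> Z)"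
    and triangle: "\<lbrakk>X \<in> Obj C; Y \<in> Obj C\<rbrakk> \<Longrightarrow>
      (\<i>\<d> X \<otimes>\<^sub>m LUnit C Y) \<cdot> Assoc C X \<one>\<^sub>o Y = RUnit C X \<otimes>\<^sub>m \<i>\<d> Y"
    and left_dual_closed: "X \<in> Obj C \<Longrightarrow> X\<^sup>\<or> \<in> Obj C"
    and left_dual: "X \<in> Obj C \<Longrightarrow> is_left_dual C (X\<^sup>\<or>) X (Ev C X) (Coev C X)"
    and right_dual: "X \<in> Obj C \<Longrightarrow> \<exists>Y\<in>Obj C. \<exists>e c. is_left_dual C X Y e c"
    and hom_fin_dim: "\<lbrakk>X \<in> Obj C; Y \<in> Obj C\<rbrakk> \<Longrightarrow> vectorspace.fin_dim K (Hom C X Y)"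
    and finite_length: "X \<in> Obj C \<Longrightarrow> finite_length C X"
    and finitely_many_simples:
      "\<exists>\<S>. finite \<S> \<and> \<S> \<subseteq> Obj C \<and> (\<forall>S. simple_object C S \<longrightarrow> (\<exists>S'\<in>\<S>. isomorphic C S S'))"
    and enough_projectives: "X \<in> Obj C \<Longrightarrow> \<exists>P p. projective C P \<and> epic C P X p"
    and unit_simple: "simple_object C \<one>\<^sub>o"

context
  fixes C :: "('k, 'o, 'm, 'c) tensor_cat_scheme" (structure)
begin

definition distinguished_invertible_object :: "'o \<Rightarrow> bool" where
  "distinguished_invertible_object D \<longleftrightarrow>
     (\<exists>P p s. is_projective_cover C \<one>\<^sub>o P p \<and> is_socle C P D s)"

text \<open>The morphism \<open>A \<rightarrow> B\<^sup>\<or>\<close> corresponding to a pairing \<open>e : A \<otimes> B \<rightarrow> \<one>\<close>.\<close>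

definition transpose_pairing :: "'o \<Rightarrow> 'o \<Rightarrow> 'm \<Rightarrow> 'm" where
  "transpose_pairing A B e =
     LUnit C (B\<^sup>\<or>) \<cdot> (e \<otimes>\<^sub>m \<i>\<d> (B\<^sup>\<or>)) \<cdot> inverse_arr C (Assoc C A B (B\<^sup>\<or>)) \<cdot>
     (\<i>\<d> A \<otimes>\<^sub>m Coev C B) \<cdot> inverse_arr C (RUnit C A)"

definition dual_mor :: "'m \<Rightarrow> 'm" where
  "dual_mor f = transpose_pairing ((Cod C f)\<^sup>\<or>) (Dom C f)
     (Ev C (Cod C f) \<cdot> (\<i>\<d> ((Cod C f)\<^sup>\<or>) \<otimes>\<^sub>m f))"

text \<open>\<open>dual_tensor V W : V\<^sup>\<or> \<otimes> W\<^sup>\<or> \<rightarrow> (W \<otimes> V)\<^sup>\<or>\<close> is the canonical isomorphism \<open>\<gamma>\<^bsub>V,W\<^esub>\<close>,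
  obtained from the nested evaluation \<open>V\<^sup>\<or> \<otimes> W\<^sup>\<or> \<otimes> W \<otimes> V \<rightarrow> \<one>\<close>.\<close>

definition dual_tensor :: "'o \<Rightarrow> 'o \<Rightarrow> 'm" where
  "dual_tensor V W = transpose_pairing (V\<^sup>\<or> \<otimes>\<^sub>o W\<^sup>\<or>) (W \<otimes>\<^sub>o V)
     (Ev C V \<cdot>
      (\<i>\<d> (V\<^sup>\<or>) \<otimes>\<^sub>m (LUnit C V \<cdot> (Ev C W \<otimes>\<^sub>m \<i>\<d> V) \<cdot> inverse_arr C (Assoc C (W\<^sup>\<or>) W V))) \<cdot>
      Assoc C (V\<^sup>\<or>) (W\<^sup>\<or>) (W \<otimes>\<^sub>o V))"


section \<open>The monad \<open>A\<^sub>2\<close> and right monadic cointegrals\<close>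

text \<open>\<open>(A V, i V)\<close> is, for every object \<open>V\<close>, a coend of
  \<open>(X, Y) \<mapsto> X\<^sup>\<or> \<otimes> (V \<otimes> Y)\<close>.\<close>

definition is_A2 :: "('o \<Rightarrow> 'o) \<Rightarrow> ('o \<Rightarrow> 'o \<Rightarrow> 'm) \<Rightarrow> bool" where
  "is_A2 A i \<longleftrightarrow> (\<forall>V\<in>Obj C.
     is_coend C (\<lambda>X Y. X\<^sup>\<or> \<otimes>\<^sub>o (V \<otimes>\<^sub>o Y)) (\<lambda>f g. dual_mor f \<otimes>\<^sub>m (\<i>\<d> V \<otimes>\<^sub>m g)) (A V) (i V))"

definition A2_mor :: "('o \<Rightarrow> 'o) \<Rightarrow> ('o \<Rightarrow> 'o \<Rightarrow> 'm) \<Rightarrow> 'm \<Rightarrow> 'm" where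
  "A2_mor A i f = (THE h. h \<in> homset C (A (Dom C f)) (A (Cod C f)) \<and>
     (\<forall>X\<in>Obj C. h \<cdot> i (Dom C f) X = i (Cod C f) X \<cdot> (\<i>\<d> (X\<^sup>\<or>) \<otimes>\<^sub>m (f \<otimes>\<^sub>m \<i>\<d> X))))"

text \<open>The coherence isomorphism
  \<open>Y\<^sup>\<or> \<otimes> ((X\<^sup>\<or> \<otimes> (V \<otimes> X)) \<otimes> Y) \<rightarrow> (Y\<^sup>\<or> \<otimes> X\<^sup>\<or>) \<otimes> (V \<otimes> (X \<otimes> Y))\<close>.\<close>

definition A2_coherence :: "'o \<Rightarrow> 'o \<Rightarrow> 'o \<Rightarrow> 'm" where
  "A2_coherence V X Y =
     inverse_arr C (Assoc C (Y\<^sup>\<or>) (X\<^sup>\<or>) (V \<otimes>\<^sub>o (X \<otimes>\<^sub>o Y))) \<cdot>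
     (\<i>\<d> (Y\<^sup>\<or>) \<otimes>\<^sub>m ((\<i>\<d> (X\<^sup>\<or>) \<otimes>\<^sub>m Assoc C V X Y) \<cdot> Assoc C (X\<^sup>\<or>) (V \<otimes>\<^sub>o X) Y))"

text \<open>The structure morphisms below are the unique ones with the stated composites with the universal
  dinatural transformation. For \<open>A2_mult\<close> this uses that \<open>Y\<^sup>\<or> \<otimes> (- \<otimes> Y)\<close> preserves coends,
  by rigidity; dually for \<open>Z4_comult\<close>.\<close>

definition A2_mult :: "('o \<Rightarrow> 'o) \<Rightarrow> ('o \<Rightarrow> 'o \<Rightarrow> 'm) \<Rightarrow> 'o \<Rightarrow> 'm" where
  "A2_mult A i V = (THE m. m \<in> homset C (A (A V)) (A V) \<and>
     (\<forall>X\<in>Obj C. \<forall>Y\<in>Obj C.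
        m \<cdot> i (A V) Y \<cdot> (\<i>\<d> (Y\<^sup>\<or>) \<otimes>\<^sub>m (i V X \<otimes>\<^sub>m \<i>\<d> Y)) =
        i V (X \<otimes>\<^sub>o Y) \<cdot> (dual_tensor Y X \<otimes>\<^sub>m \<i>\<d> (V \<otimes>\<^sub>o (X \<otimes>\<^sub>o Y))) \<cdot> A2_coherence V X Y))"

definition A2_counit :: "('o \<Rightarrow> 'o) \<Rightarrow> ('o \<Rightarrow> 'o \<Rightarrow> 'm) \<Rightarrow> 'm" where
  "A2_counit A i = (THE e. e \<in> homset C (A \<one>\<^sub>o) \<one>\<^sub>o \<and>
     (\<forall>X\<in>Obj C. e \<cdot> i \<one>\<^sub>o X = Ev C X \<cdot> (\<i>\<d> (X\<^sup>\<or>) \<otimes>\<^sub>m LUnit C X)))"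

definition right_monadic_cointegrals :: "('o \<Rightarrow> 'o) \<Rightarrow> ('o \<Rightarrow> 'o \<Rightarrow> 'm) \<Rightarrow> 'o \<Rightarrow> ('k, 'm) module" where
  "right_monadic_cointegrals A i D =
     monad_module_Hom C (A2_mor A i) (\<one>\<^sub>o, A2_counit A i) (A D, A2_mult A i D)"


section \<open>The comonad \<open>Z\<^sub>4\<close> and categorical cointegrals\<close>

text \<open>\<open>(Z V, p V)\<close> is, for every object \<open>V\<close>, an end of
  \<open>(X, Y) \<mapsto> (Y \<otimes> V) \<otimes> X\<^sup>\<or>\<close>.\<close>

definition is_Z4 :: "('o \<Rightarrow> 'o) \<Rightarrow> ('o \<Rightarrow> 'o \<Rightarrow> 'm) \<Rightarrow> bool" where
  "is_Z4 Z p \<longleftrightarrow> (\<forall>V\<in>Obj C.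
     is_end C (\<lambda>X Y. (Y \<otimes>\<^sub>o V) \<otimes>\<^sub>o X\<^sup>\<or>) (\<lambda>f g. (g \<otimes>\<^sub>m \<i>\<d> V) \<otimes>\<^sub>m dual_mor f) (Z V) (p V))"

definition Z4_mor :: "('o \<Rightarrow> 'o) \<Rightarrow> ('o \<Rightarrow> 'o \<Rightarrow> 'm) \<Rightarrow> 'm \<Rightarrow> 'm" where
  "Z4_mor Z p f = (THE h. h \<in> homset C (Z (Dom C f)) (Z (Cod C f)) \<and>
     (\<forall>X\<in>Obj C. p (Cod C f) X \<cdot> h = ((\<i>\<d> X \<otimes>\<^sub>m f) \<otimes>\<^sub>m \<i>\<d> (X\<^sup>\<or>)) \<cdot> p (Dom C f) X))"

text \<open>The coherence isomorphism
  \<open>((X \<otimes> Y) \<otimes> V) \<otimes> (Y\<^sup>\<or> \<otimes> X\<^sup>\<or>) \<rightarrow> (X \<otimes> ((Y \<otimes> V) \<otimes> Y\<^sup>\<or>)) \<otimes> X\<^sup>\<or>\<close>.\<close>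

definition Z4_coherence :: "'o \<Rightarrow> 'o \<Rightarrow> 'o \<Rightarrow> 'm" where
  "Z4_coherence V X Y =
     ((Assoc C X (Y \<otimes>\<^sub>o V) (Y\<^sup>\<or>) \<cdot> (Assoc C X Y V \<otimes>\<^sub>m \<i>\<d> (Y\<^sup>\<or>))) \<otimes>\<^sub>m \<i>\<d> (X\<^sup>\<or>)) \<cdot>
     inverse_arr C (Assoc C ((X \<otimes>\<^sub>o Y) \<otimes>\<^sub>o V) (Y\<^sup>\<or>) (X\<^sup>\<or>))"

definition Z4_comult :: "('o \<Rightarrow> 'o) \<Rightarrow> ('o \<Rightarrow> 'o \<Rightarrow> 'm) \<Rightarrow> 'o \<Rightarrow> 'm" where
  "Z4_comult Z p V = (THE d. d \<in> homset C (Z V) (Z (Z V)) \<and>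
     (\<forall>X\<in>Obj C. \<forall>Y\<in>Obj C.
        ((\<i>\<d> X \<otimes>\<^sub>m p V Y) \<otimes>\<^sub>m \<i>\<d> (X\<^sup>\<or>)) \<cdot> p (Z V) X \<cdot> d =
        Z4_coherence V X Y \<cdot> (\<i>\<d> ((X \<otimes>\<^sub>o Y) \<otimes>\<^sub>o V) \<otimes>\<^sub>m inverse_arr C (dual_tensor Y X)) \<cdot>
        p V (X \<otimes>\<^sub>o Y)))"

definition Z4_unit :: "('o \<Rightarrow> 'o) \<Rightarrow> ('o \<Rightarrow> 'o \<Rightarrow> 'm) \<Rightarrow> 'm" where
  "Z4_unit Z p = (THE u. u \<in> homset C \<one>\<^sub>o (Z \<one>\<^sub>o) \<and>
     (\<forall>X\<in>Obj C. p \<one>\<^sub>o X \<cdot> u = (inverse_arr C (RUnit C X) \<otimes>\<^sub>m \<i>\<d> (X\<^sup>\<or>)) \<cdot> Coev C X))"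

definition categorical_cointegrals :: "('o \<Rightarrow> 'o) \<Rightarrow> ('o \<Rightarrow> 'o \<Rightarrow> 'm) \<Rightarrow> 'o \<Rightarrow> ('k, 'm) module" where
  "categorical_cointegrals Z p D =
     comonad_comodule_Hom C (Z4_mor Z p) (Z (D\<^sup>\<or>), Z4_comult Z p (D\<^sup>\<or>)) (\<one>\<^sub>o, Z4_unit Z p)"

end

end

theory Submission
  imports Defs
begin

text \<open>For every pairing \<open>q : P \<otimes> Q \<rightarrow> \<one>\<close> there is a pairing \<open>E(q) : Z\<^sub>4(P) \<otimes> A\<^sub>2(Q) \<rightarrow> \<one>\<close>,
  characterised by \<open>E(q) \<circ> (id \<otimes> \<iota>\<^sub>2(Q)\<^sub>X)\<close> being the composite of \<open>\<pi>\<^sub>4(P)\<close> at \<open>X\<^sup>\<or>\<close> with the nested evaluation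
  \<open>(X\<^sup>\<or> \<otimes> P \<otimes> X\<^sup>\<or>\<^sup>\<or>) \<otimes> (X\<^sup>\<or> \<otimes> Q \<otimes> X) \<rightarrow> \<one>\<close> (lemma \<open>Ep_props\<close>). It exists because \<open>Z\<^sub>4(P)\<close> has a right
  dual, so that tensoring with it preserves the coend. If \<open>q\<close> exhibits \<open>P\<close> as a left dual of \<open>Q\<close>, then \<open>E(q)\<close> is
  perfect: it separates morphisms into \<open>Z\<^sub>4(P)\<close> (\<open>Ep_inj\<close>) and
  represents pairings with \<open>A\<^sub>2(Q)\<close> (\<open>Ep_rperf\<close>).
  Indeed, every object is isomorphic to some \<open>X\<^sup>\<or>\<close>, hence both
  \<open>Z\<^sub>4(P)\<close> and \<open>A\<^sub>2(Q)\<^sup>\<or>\<close> are ends of the same family. In other words \<open>A\<^sub>2(D)\<^sup>\<or> \<cong> Z\<^sub>4(D\<^sup>\<or>)\<close>.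

  Let \<open>e = E(ev\<^sub>D)\<close>, let \<open>u : \<one> \<otimes> \<one> \<rightarrow> \<one>\<close> be the unit isomorphism, and send \<open>f : \<one> \<rightarrow> A\<^sub>2(D)\<close> to
  \<open>\<Phi>(f) = e \<circ> (id \<otimes> f) : Z\<^sub>4(D\<^sup>\<or>) \<rightarrow> \<one>\<close>. Perfectness of \<open>e\<close> makes \<open>\<Phi>\<close> a linear
  bijection onto all morphisms. Under the pairings the structure morphisms of the monad and of the comonad correspond:
  \<open>e \<circ> (id \<otimes> \<mu>) = E(e) \<circ> (\<Delta> \<otimes> id)\<close> (\<open>mu_props\<close>), \<open>E(u) \<circ> (u\<^sup>4 \<otimes> id) = u \<circ> (id \<otimes> \<epsilon>)\<close>
  (\<open>Ep_unit\<close>), and \<open>E\<close> is natural (\<open>Ep_nat\<close>). With \<open>g = \<Phi>(f)\<close> one gets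
  \<open>e \<circ> (id \<otimes> f \<epsilon>) = E(u) \<circ> (u\<^sup>4 g \<otimes> id)\<close> and
  \<open>e \<circ> (id \<otimes> \<mu> A\<^sub>2(f)) = E(u) \<circ> (Z\<^sub>4(g) \<Delta> \<otimes> id)\<close>. So \<open>f\<close> is a module morphism if and only if
  \<open>g\<close> is a comodule morphism (\<open>Phi_cointegral\<close>).

  The identity relating \<open>\<mu>\<close> and \<open>\<Delta>\<close> also supplies the existence of \<open>\<mu>\<close>; that of \<open>\<Delta>\<close> follows
  from the adjunction between \<open>X\<^sup>\<or> \<otimes> (- \<otimes> X)\<close> and \<open>(X \<otimes> -) \<otimes> X\<^sup>\<or>\<close>. All associators are
  handled through one operation on pairings, the nesting \<open>p \<diamondop> q : (A \<otimes> B) \<otimes> (B' \<otimes> A') \<rightarrow> \<one>\<close> of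
  \<open>p : A \<otimes> A' \<rightarrow> \<one>\<close> and \<open>q : B \<otimes> B' \<rightarrow> \<one>\<close>, which is natural (\<open>star_pb\<close>) and associative up
  to associators (\<open>star_assoc\<close>).\<close>

section \<open>Arrows with source and target, and coherence\<close>

text \<open>A morphism together with its source and target. Source and target of a composite or of a tensor
  product are then given by unconditional equations, so that typing conditions reduce to rewriting.\<close>

datatype ('o, 'm) arrow = Arr (src: 'o) (raw: 'm) (tgt: 'o)

context finite_tensor_category
begin

text \<open>The arrow is a morphism of the category.\<close>

definition ok :: "('o, 'm) arrow \<Rightarrow> bool" where
  "ok f \<longleftrightarrow> src f \<in> Obj C \<and> tgt f \<in> Obj C \<and> raw f \<in> homset C (src f) (tgt f)"

text \<open>Composition, tensor product, identities and inverses of arrows.\<close>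

definition cmp :: "('o, 'm) arrow \<Rightarrow> ('o, 'm) arrow \<Rightarrow> ('o, 'm) arrow" (infixr \<open>\<bullet>\<close> 55) where
  "g \<bullet> f = Arr (src f) (raw g \<cdot> raw f) (tgt g)"

definition ten :: "('o, 'm) arrow \<Rightarrow> ('o, 'm) arrow \<Rightarrow> ('o, 'm) arrow" (infixr \<open>\<star>\<close> 70) where
  "f \<star> g = Arr (src f \<otimes>\<^sub>o src g) (raw f \<otimes>\<^sub>m raw g) (tgt f \<otimes>\<^sub>o tgt g)"

definition ide :: "'o \<Rightarrow> ('o, 'm) arrow" where
  "ide X = Arr X (\<i>\<d> X) X"

definition inv_of :: "('o, 'm) arrow \<Rightarrow> ('o, 'm) arrow" where
  "inv_of f = Arr (tgt f) (inverse_arr C (raw f)) (src f)"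

text \<open>Associators (\<open>as\<close>, with inverse \<open>sa\<close>) and left and right unit isomorphisms (\<open>lu\<close>, \<open>ru\<close>,
  with inverses \<open>ul\<close>, \<open>ur\<close>).\<close>

definition as :: "'o \<Rightarrow> 'o \<Rightarrow> 'o \<Rightarrow> ('o, 'm) arrow" where
  "as X Y Z = Arr ((X \<otimes>\<^sub>o Y) \<otimes>\<^sub>o Z) (Assoc C X Y Z) (X \<otimes>\<^sub>o (Y \<otimes>\<^sub>o Z))"

definition lu :: "'o \<Rightarrow> ('o, 'm) arrow" where
  "lu X = Arr (\<one>\<^sub>o \<otimes>\<^sub>o X) (LUnit C X) X"

definition ru :: "'o \<Rightarrow> ('o, 'm) arrow" where
  "ru X = Arr (X \<otimes>\<^sub>o \<one>\<^sub>o) (RUnit C X) X"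

definition sa :: "'o \<Rightarrow> 'o \<Rightarrow> 'o \<Rightarrow> ('o, 'm) arrow" where
  "sa X Y Z = inv_of (as X Y Z)"

definition ul :: "'o \<Rightarrow> ('o, 'm) arrow" where
  "ul X = inv_of (lu X)"

definition ur :: "'o \<Rightarrow> ('o, 'm) arrow" where
  "ur X = inv_of (ru X)"

declare tensor_obj_closed [simp] unit_closed [simp] left_dual_closed [simp]

lemma arrow_eqI: "src f = src g \<Longrightarrow> tgt f = tgt g \<Longrightarrow> raw f = raw g \<Longrightarrow> f = g"
  by (cases f; cases g) auto

lemma src_tgt [simp]:
  "src (g \<bullet> f) = src f" "tgt (g \<bullet> f) = tgt g"
  "src (f \<star> g) = src f \<otimes>\<^sub>o src g" "tgt (f \<star> g) = tgt f \<otimes>\<^sub>o tgt g"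
  "src (ide X) = X" "tgt (ide X) = X"
  "src (as X Y Z) = (X \<otimes>\<^sub>o Y) \<otimes>\<^sub>o Z" "tgt (as X Y Z) = X \<otimes>\<^sub>o (Y \<otimes>\<^sub>o Z)"
  "src (sa X Y Z) = X \<otimes>\<^sub>o (Y \<otimes>\<^sub>o Z)" "tgt (sa X Y Z) = (X \<otimes>\<^sub>o Y) \<otimes>\<^sub>o Z"
  "src (lu X) = \<one>\<^sub>o \<otimes>\<^sub>o X" "tgt (lu X) = X"
  "src (ul X) = X" "tgt (ul X) = \<one>\<^sub>o \<otimes>\<^sub>o X"
  "src (ru X) = X \<otimes>\<^sub>o \<one>\<^sub>o" "tgt (ru X) = X"
  "src (ur X) = X" "tgt (ur X) = X \<otimes>\<^sub>o \<one>\<^sub>o"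
  by (simp_all add: cmp_def ten_def ide_def as_def sa_def lu_def ul_def ru_def ur_def inv_of_def)

lemma raw_simps:
  "raw (g \<bullet> f) = raw g \<cdot> raw f"
  "raw (f \<star> g) = raw f \<otimes>\<^sub>m raw g"
  "raw (ide X) = \<i>\<d> X"
  "raw (as X Y Z) = Assoc C X Y Z"
  "raw (sa X Y Z) = inverse_arr C (Assoc C X Y Z)"
  "raw (lu X) = LUnit C X"
  "raw (ul X) = inverse_arr C (LUnit C X)"
  "raw (ru X) = RUnit C X"
  "raw (ur X) = inverse_arr C (RUnit C X)"
  by (simp_all add: cmp_def ten_def ide_def as_def sa_def lu_def ul_def ru_def ur_def inv_of_def)

lemma ok_obj: "ok f \<Longrightarrow> src f \<in> Obj C" "ok f \<Longrightarrow> tgt f \<in> Obj C"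
  by (auto simp: ok_def)

lemma ok_cmp [simp]: "ok g \<Longrightarrow> ok f \<Longrightarrow> tgt f = src g \<Longrightarrow> ok (g \<bullet> f)"
  using comp_closed[of "src f" "src g" "tgt g" "raw f" "raw g"] by (simp add: ok_def cmp_def)

lemma ok_ten [simp]: "ok f \<Longrightarrow> ok g \<Longrightarrow> ok (f \<star> g)"
  using tensor_mor_closed[of "src f" "tgt f" "src g" "tgt g" "raw f" "raw g"] by (simp add: ok_def ten_def)

lemma ok_ide [simp]: "X \<in> Obj C \<Longrightarrow> ok (ide X)"
  using ide_closed[of X] by (simp add: ok_def ide_def)

lemma cmp_assoc [simp]:
  assumes "ok f" "ok g" "ok h" "tgt f = src g" "tgt g = src h"
  shows "(h \<bullet> g) \<bullet> f = h \<bullet> (g \<bullet> f)"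
  using assms comp_assoc[of "src f" "src g" "src h" "tgt h" "raw f" "raw g" "raw h"]
  by (simp add: cmp_def ok_def)

lemma cmp_ide_left [simp]: "ok f \<Longrightarrow> tgt f = Y \<Longrightarrow> ide Y \<bullet> f = f"
  by (auto intro!: arrow_eqI simp: raw_simps ok_def comp_ide_left)

lemma cmp_ide_right [simp]: "ok f \<Longrightarrow> src f = Y \<Longrightarrow> f \<bullet> ide Y = f"
  by (auto intro!: arrow_eqI simp: raw_simps ok_def comp_ide_right)

lemma ten_ide [simp]: "X \<in> Obj C \<Longrightarrow> Y \<in> Obj C \<Longrightarrow> ide X \<star> ide Y = ide (X \<otimes>\<^sub>o Y)"
  by (auto intro!: arrow_eqI simp: raw_simps tensor_ide)

lemma ten_cmp [simp]:
  assumes "ok f" "ok g" "ok f'" "ok g'" "tgt f = src g" "tgt f' = src g'"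
  shows "(g \<star> g') \<bullet> (f \<star> f') = (g \<bullet> f) \<star> (g' \<bullet> f')"
  using assms tensor_comp[of "src f" "src g" "tgt g" "src f'" "src g'" "tgt g'" "raw f" "raw g" "raw f'" "raw g'"]
  by (auto intro!: arrow_eqI simp: raw_simps ok_def)

text \<open>Rewriting the first two factors of a composite that is bracketed to the right.\<close>

lemma cmp_reduce:
  assumes "g \<bullet> f = h" "ok f" "ok g" "ok k" "tgt f = src g" "tgt k = src f"
  shows "g \<bullet> (f \<bullet> k) = h \<bullet> k"
  using assms by (metis cmp_assoc)

lemma ten_cmp_chain [simp]:
  assumes "ok f" "ok g" "ok f'" "ok g'" "tgt f = src g" "tgt f' = src g'" "ok k" "tgt k = src f \<otimes>\<^sub>o src f'"
  shows "(g \<star> g') \<bullet> (f \<star> f') \<bullet> k = ((g \<bullet> f) \<star> (g' \<bullet> f')) \<bullet> k"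
  by (rule cmp_reduce) (use assms in auto)

lemma inverse_arr_props:
  assumes "iso_arr C X Y f" "X \<in> Obj C" "Y \<in> Obj C"
  shows "inverse_arr C f \<in> homset C Y X" "inverse_arr C f \<cdot> f = \<i>\<d> X" "f \<cdot> inverse_arr C f = \<i>\<d> Y"
proof -
  have f: "f \<in> homset C X Y" using assms(1) by (simp add: iso_arr_def)
  obtain g where g: "g \<in> homset C Y X" "g \<cdot> f = \<i>\<d> X" "f \<cdot> g = \<i>\<d> Y"
    using assms(1) by (auto simp: iso_arr_def)
  have dc: "Dom C f = X" "Cod C f = Y" using dom_cod assms f by auto
  have "inverse_arr C f = g"
    unfolding inverse_arr_def dc
  proof (rule the_equality)
    show "g \<in> homset C Y X \<and> g \<cdot> f = \<i>\<d> X \<and> f \<cdot> g = \<i>\<d> Y" using g by simp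
  next
    fix h assume h: "h \<in> homset C Y X \<and> h \<cdot> f = \<i>\<d> X \<and> f \<cdot> h = \<i>\<d> Y"
    have "h = h \<cdot> (f \<cdot> g)" using h g assms comp_ide_right by simp
    also have "\<dots> = (h \<cdot> f) \<cdot> g" using comp_assoc[of Y X Y X g f h] h g f assms by simp
    also have "\<dots> = g" using h g assms comp_ide_left by simp
    finally show "h = g" .
  qed
  with g show "inverse_arr C f \<in> homset C Y X" "inverse_arr C f \<cdot> f = \<i>\<d> X" "f \<cdot> inverse_arr C f = \<i>\<d> Y"
    by auto
qed

lemma ok_struct [simp]:
  "X \<in> Obj C \<Longrightarrow> Y \<in> Obj C \<Longrightarrow> Z \<in> Obj C \<Longrightarrow> ok (as X Y Z)"
  "X \<in> Obj C \<Longrightarrow> Y \<in> Obj C \<Longrightarrow> Z \<in> Obj C \<Longrightarrow> ok (sa X Y Z)"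
  "X \<in> Obj C \<Longrightarrow> ok (lu X)" "X \<in> Obj C \<Longrightarrow> ok (ul X)"
  "X \<in> Obj C \<Longrightarrow> ok (ru X)" "X \<in> Obj C \<Longrightarrow> ok (ur X)"
  using assoc_iso[of X Y Z] lunit_iso[of X] runit_iso[of X]
    inverse_arr_props(1)[OF assoc_iso[of X Y Z]] inverse_arr_props(1)[OF lunit_iso[of X]]
    inverse_arr_props(1)[OF runit_iso[of X]]
  by (auto simp: ok_def raw_simps iso_arr_def)

lemma struct_inv [simp]:
  "X \<in> Obj C \<Longrightarrow> Y \<in> Obj C \<Longrightarrow> Z \<in> Obj C \<Longrightarrow> as X Y Z \<bullet> sa X Y Z = ide (X \<otimes>\<^sub>o (Y \<otimes>\<^sub>o Z))"
  "X \<in> Obj C \<Longrightarrow> Y \<in> Obj C \<Longrightarrow> Z \<in> Obj C \<Longrightarrow> sa X Y Z \<bullet> as X Y Z = ide ((X \<otimes>\<^sub>o Y) \<otimes>\<^sub>o Z)"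
  "X \<in> Obj C \<Longrightarrow> lu X \<bullet> ul X = ide X" "X \<in> Obj C \<Longrightarrow> ul X \<bullet> lu X = ide (\<one>\<^sub>o \<otimes>\<^sub>o X)"
  "X \<in> Obj C \<Longrightarrow> ru X \<bullet> ur X = ide X" "X \<in> Obj C \<Longrightarrow> ur X \<bullet> ru X = ide (X \<otimes>\<^sub>o \<one>\<^sub>o)"
  using inverse_arr_props(2,3)[OF assoc_iso[of X Y Z]] inverse_arr_props(2,3)[OF lunit_iso[of X]]
    inverse_arr_props(2,3)[OF runit_iso[of X]]
  by (auto intro!: arrow_eqI simp: raw_simps)

lemma struct_inv_chain [simp]:
  "X \<in> Obj C \<Longrightarrow> Y \<in> Obj C \<Longrightarrow> Z \<in> Obj C \<Longrightarrow> ok k \<Longrightarrow> tgt k = X \<otimes>\<^sub>o (Y \<otimes>\<^sub>o Z) \<Longrightarrow> as X Y Z \<bullet> sa X Y Z \<bullet> k = k"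
  "X \<in> Obj C \<Longrightarrow> Y \<in> Obj C \<Longrightarrow> Z \<in> Obj C \<Longrightarrow> ok k \<Longrightarrow> tgt k = (X \<otimes>\<^sub>o Y) \<otimes>\<^sub>o Z \<Longrightarrow> sa X Y Z \<bullet> as X Y Z \<bullet> k = k"
  "X \<in> Obj C \<Longrightarrow> ok k \<Longrightarrow> tgt k = X \<Longrightarrow> lu X \<bullet> ul X \<bullet> k = k" "X \<in> Obj C \<Longrightarrow> ok k \<Longrightarrow> tgt k = \<one>\<^sub>o \<otimes>\<^sub>o X \<Longrightarrow> ul X \<bullet> lu X \<bullet> k = k"
  "X \<in> Obj C \<Longrightarrow> ok k \<Longrightarrow> tgt k = X \<Longrightarrow> ru X \<bullet> ur X \<bullet> k = k" "X \<in> Obj C \<Longrightarrow> ok k \<Longrightarrow> tgt k = X \<otimes>\<^sub>o \<one>\<^sub>o \<Longrightarrow> ur X \<bullet> ru X \<bullet> k = k"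
  by (subst cmp_reduce, rule struct_inv, simp_all)+

lemma as_nat:
  assumes "ok f" "ok g" "ok h" "tgt f = X" "tgt g = Y" "tgt h = Z"
  shows "as X Y Z \<bullet> ((f \<star> g) \<star> h) = (f \<star> (g \<star> h)) \<bullet> as (src f) (src g) (src h)"
  using assms assoc_natural[of "src f" "src g" "src h" X Y Z "raw f" "raw g" "raw h"]
  by (auto intro!: arrow_eqI simp: raw_simps ok_def)

lemma lu_nat: "ok f \<Longrightarrow> tgt f = Y \<Longrightarrow> lu Y \<bullet> (ide \<one>\<^sub>o \<star> f) = f \<bullet> lu (src f)"
  using lunit_natural[of "src f" Y "raw f"]
  by (auto intro!: arrow_eqI simp: raw_simps ok_def)

lemma ru_nat: "ok f \<Longrightarrow> tgt f = Y \<Longrightarrow> ru Y \<bullet> (f \<star> ide \<one>\<^sub>o) = f \<bullet> ru (src f)"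
  using runit_natural[of "src f" Y "raw f"]
  by (auto intro!: arrow_eqI simp: raw_simps ok_def)

lemma pentagon_arr:
  assumes "W \<in> Obj C" "X \<in> Obj C" "Y \<in> Obj C" "Z \<in> Obj C"
  shows "as W X (Y \<otimes>\<^sub>o Z) \<bullet> as (W \<otimes>\<^sub>o X) Y Z =
    (ide W \<star> as X Y Z) \<bullet> as W (X \<otimes>\<^sub>o Y) Z \<bullet> (as W X Y \<star> ide Z)"
  using assms pentagon[of W X Y Z]
  by (auto intro!: arrow_eqI simp: raw_simps ok_def)

lemma triangle_arr:
  assumes "X \<in> Obj C" "Y \<in> Obj C"
  shows "(ide X \<star> lu Y) \<bullet> as X \<one>\<^sub>o Y = ru X \<star> ide Y"
  using assms triangle[of X Y]
  by (auto intro!: arrow_eqI simp: raw_simps ok_def)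

text \<open>From here on \<open>ok_def\<close> is used as a simplification rule only without these rules, since together they loop.\<close>

declare ok_obj [simp]

lemma cancel_left:
  assumes "m \<bullet> f = m \<bullet> g" "r \<bullet> m = ide Y" "ok f" "ok g" "ok m" "ok r" "tgt f = Y" "tgt g = Y" "src m = Y" "tgt m = src r"
  shows "f = g"
proof -
  have "f = (r \<bullet> m) \<bullet> f" unfolding assms(2) using assms by simp
  also have "\<dots> = r \<bullet> m \<bullet> f" by (rule cmp_assoc) (use assms in auto)
  also have "\<dots> = r \<bullet> m \<bullet> g" unfolding assms(1) ..
  also have "\<dots> = (r \<bullet> m) \<bullet> g" by (rule cmp_assoc[symmetric]) (use assms in auto)
  also have "\<dots> = g" unfolding assms(2) using assms by simp
  finally show ?thesis .
qed

lemma cancel_right: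
  assumes "f \<bullet> e = g \<bullet> e" "e \<bullet> s = ide Y" "ok f" "ok g" "ok e" "ok s" "src f = Y" "src g = Y" "tgt e = Y" "tgt s = src e"
  shows "f = g"
proof -
  have "f \<bullet> e \<bullet> s = g \<bullet> e \<bullet> s" using assms by (metis cmp_assoc)
  thus ?thesis using assms by simp
qed

lemma sa_nat:
  assumes "ok f" "ok g" "ok h" "tgt f = X" "tgt g = Y" "tgt h = Z"
  shows "sa X Y Z \<bullet> (f \<star> (g \<star> h)) = ((f \<star> g) \<star> h) \<bullet> sa (src f) (src g) (src h)"
  by (rule cancel_left[where m="as X Y Z" and r="sa X Y Z"], rule cancel_right[where e="as (src f) (src g) (src h)" and s="sa (src f) (src g) (src h)"])
    (use assms in \<open>auto simp: as_nat\<close>)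

lemma ul_nat: "ok f \<Longrightarrow> tgt f = Y \<Longrightarrow> ul Y \<bullet> f = (ide \<one>\<^sub>o \<star> f) \<bullet> ul (src f)"
  by (rule cancel_left[where m="lu Y" and r="ul Y"], rule cancel_right[where e="lu (src f)" and s="ul (src f)"])
    (auto simp: lu_nat)

lemma ur_nat: "ok f \<Longrightarrow> tgt f = Y \<Longrightarrow> ur Y \<bullet> f = (f \<star> ide \<one>\<^sub>o) \<bullet> ur (src f)"
  by (rule cancel_left[where m="ru Y" and r="ur Y"], rule cancel_right[where e="ru (src f)" and s="ur (src f)"])
    (auto simp: ru_nat)

lemma ten_unit_faithful_left:
  assumes "ide \<one>\<^sub>o \<star> f = ide \<one>\<^sub>o \<star> g" "ok f" "ok g" "src f = src g" "tgt f = tgt g"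
  shows "f = g"
proof (rule cancel_right[where e="lu (src f)" and s="ul (src f)"])
  show "f \<bullet> lu (src f) = g \<bullet> lu (src f)"
    using lu_nat[of f "tgt f"] lu_nat[of g "tgt f"] assms by simp
qed (use assms in auto)

lemma ten_unit_faithful_right:
  assumes "f \<star> ide \<one>\<^sub>o = g \<star> ide \<one>\<^sub>o" "ok f" "ok g" "src f = src g" "tgt f = tgt g"
  shows "f = g"
proof (rule cancel_right[where e="ru (src f)" and s="ur (src f)"])
  show "f \<bullet> ru (src f) = g \<bullet> ru (src f)"
    using ru_nat[of f "tgt f"] ru_nat[of g "tgt f"] assms by simp
qed (use assms in auto)

text \<open>The compatibilities of the unit isomorphisms with tensor products that follow from the pentagon and the
  triangle.\<close>

lemma lu_ten:
  assumes X: "X \<in> Obj C" and Y: "Y \<in> Obj C"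
  shows "lu (X \<otimes>\<^sub>o Y) \<bullet> as \<one>\<^sub>o X Y = lu X \<star> ide Y"
proof (rule ten_unit_faithful_left)
  let ?I = "\<one>\<^sub>o"
  let ?p = "as ?I (?I \<otimes>\<^sub>o X) Y \<bullet> (as ?I ?I X \<star> ide Y)"
  let ?q = "(sa ?I ?I X \<star> ide Y) \<bullet> sa ?I (?I \<otimes>\<^sub>o X) Y"
  have "(ide ?I \<star> (lu (X \<otimes>\<^sub>o Y) \<bullet> as ?I X Y)) \<bullet> ?p = (ide ?I \<star> lu (X \<otimes>\<^sub>o Y)) \<bullet> (ide ?I \<star> as ?I X Y) \<bullet> ?p"
    using X Y by simp
  also have "\<dots> = (ide ?I \<star> lu (X \<otimes>\<^sub>o Y)) \<bullet> as ?I ?I (X \<otimes>\<^sub>o Y) \<bullet> as (?I \<otimes>\<^sub>o ?I) X Y"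
    by (subst pentagon_arr) (use X Y in auto)
  also have "\<dots> = (ru ?I \<star> (ide X \<star> ide Y)) \<bullet> as (?I \<otimes>\<^sub>o ?I) X Y"
    by (subst cmp_reduce[OF triangle_arr]) (use X Y in auto)
  also have "\<dots> = as ?I X Y \<bullet> ((ru ?I \<star> ide X) \<star> ide Y)"
    by (subst as_nat) (use X Y in auto)
  also have "\<dots> = as ?I X Y \<bullet> ((ide ?I \<star> lu X) \<star> ide Y) \<bullet> (as ?I ?I X \<star> ide Y)"
    by (subst triangle_arr[symmetric]) (use X Y in auto)
  also have "\<dots> = (ide ?I \<star> (lu X \<star> ide Y)) \<bullet> ?p"
    by (subst cmp_reduce[OF as_nat]) (use X Y in auto)
  finally show "ide ?I \<star> (lu (X \<otimes>\<^sub>o Y) \<bullet> as ?I X Y) = ide ?I \<star> (lu X \<star> ide Y)"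
    by (rule cancel_right[where s="?q"]) (use X Y in auto)
qed (use X Y in auto)

lemma ru_ten:
  assumes X: "X \<in> Obj C" and Y: "Y \<in> Obj C"
  shows "(ide X \<star> ru Y) \<bullet> as X Y \<one>\<^sub>o = ru (X \<otimes>\<^sub>o Y)"
proof (rule ten_unit_faithful_right)
  let ?I = "\<one>\<^sub>o"
  have "as X Y ?I \<bullet> (((ide X \<star> ru Y) \<bullet> as X Y ?I) \<star> ide ?I) = as X Y ?I \<bullet> ((ide X \<star> ru Y) \<star> ide ?I) \<bullet> (as X Y ?I \<star> ide ?I)"
    using X Y by simp
  also have "\<dots> = (ide X \<star> (ru Y \<star> ide ?I)) \<bullet> as X (Y \<otimes>\<^sub>o ?I) ?I \<bullet> (as X Y ?I \<star> ide ?I)"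
    by (subst cmp_reduce[OF as_nat]) (use X Y in auto)
  also have "\<dots> = (ide X \<star> (ide Y \<star> lu ?I)) \<bullet> (ide X \<star> as Y ?I ?I) \<bullet> as X (Y \<otimes>\<^sub>o ?I) ?I \<bullet> (as X Y ?I \<star> ide ?I)"
    by (subst triangle_arr[symmetric]) (use X Y in auto)
  also have "\<dots> = (ide X \<star> (ide Y \<star> lu ?I)) \<bullet> as X Y (?I \<otimes>\<^sub>o ?I) \<bullet> as (X \<otimes>\<^sub>o Y) ?I ?I"
    by (subst pentagon_arr) (use X Y in auto)
  also have "\<dots> = as X Y ?I \<bullet> ((ide X \<star> ide Y) \<star> lu ?I) \<bullet> as (X \<otimes>\<^sub>o Y) ?I ?I"
    by (subst cmp_reduce[OF as_nat]) (use X Y in auto)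
  also have "\<dots> = as X Y ?I \<bullet> (ru (X \<otimes>\<^sub>o Y) \<star> ide ?I)"
    using X Y triangle_arr[of "X \<otimes>\<^sub>o Y" ?I] by simp
  finally show "((ide X \<star> ru Y) \<bullet> as X Y ?I) \<star> ide ?I = ru (X \<otimes>\<^sub>o Y) \<star> ide ?I"
    by (rule cancel_left[where r="sa X Y ?I"]) (use X Y in auto)
qed (use X Y in auto)

lemma lu_unit_ten: "X \<in> Obj C \<Longrightarrow> lu (\<one>\<^sub>o \<otimes>\<^sub>o X) = ide \<one>\<^sub>o \<star> lu X"
  by (rule cancel_left[where m="lu X" and r="ul X"]) (auto simp: lu_nat)

lemma lu_one_eq_ru_one: "lu \<one>\<^sub>o = ru \<one>\<^sub>o"
proof (rule ten_unit_faithful_right)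
  show "lu \<one>\<^sub>o \<star> ide \<one>\<^sub>o = ru \<one>\<^sub>o \<star> ide \<one>\<^sub>o"
    using lu_ten[of "\<one>\<^sub>o" "\<one>\<^sub>o"] lu_unit_ten[of "\<one>\<^sub>o"] triangle_arr[of "\<one>\<^sub>o" "\<one>\<^sub>o"] by simp
qed auto

end

section \<open>Pairings and the adjunctions of a dual pair\<close>

text \<open>A pairing \<open>form p : lob p \<otimes> rob p \<rightarrow> \<one>\<close>.\<close>

datatype ('o, 'm) pairing = Pairing (lob: 'o) (rob: 'o) (form: "('o, 'm) arrow")

context finite_tensor_category
begin

definition pr :: "('o, 'm) pairing \<Rightarrow> bool" where
  "pr p \<longleftrightarrow> lob p \<in> Obj C \<and> rob p \<in> Obj C \<and> ok (form p) \<and> src (form p) = lob p \<otimes>\<^sub>o rob p \<and> tgt (form p) = \<one>\<^sub>o"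

lemma pr_simps [simp]:
  "pr p \<Longrightarrow> lob p \<in> Obj C" "pr p \<Longrightarrow> rob p \<in> Obj C" "pr p \<Longrightarrow> ok (form p)"
  "pr p \<Longrightarrow> src (form p) = lob p \<otimes>\<^sub>o rob p" "pr p \<Longrightarrow> tgt (form p) = \<one>\<^sub>o"
  by (simp_all add: pr_def)

text \<open>The pentagon with some of its associators inverted.\<close>

lemma pentagon_inv_a:
  assumes "W \<in> Obj C" "X \<in> Obj C" "Y \<in> Obj C" "Z \<in> Obj C"
  shows "(ide W \<star> sa X Y Z) \<bullet> as W X (Y \<otimes>\<^sub>o Z) =
    as W (X \<otimes>\<^sub>o Y) Z \<bullet> (as W X Y \<star> ide Z) \<bullet> sa (W \<otimes>\<^sub>o X) Y Z"
proof (rule cancel_right[where e="as (W \<otimes>\<^sub>o X) Y Z" and s="sa (W \<otimes>\<^sub>o X) Y Z"])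
  have "((ide W \<star> sa X Y Z) \<bullet> as W X (Y \<otimes>\<^sub>o Z)) \<bullet> as (W \<otimes>\<^sub>o X) Y Z =
    (ide W \<star> sa X Y Z) \<bullet> as W X (Y \<otimes>\<^sub>o Z) \<bullet> as (W \<otimes>\<^sub>o X) Y Z" using assms by simp
  also have "\<dots> = (as W (X \<otimes>\<^sub>o Y) Z \<bullet> (as W X Y \<star> ide Z) \<bullet> sa (W \<otimes>\<^sub>o X) Y Z) \<bullet> as (W \<otimes>\<^sub>o X) Y Z"
    by (subst pentagon_arr) (use assms in auto)
  finally show "((ide W \<star> sa X Y Z) \<bullet> as W X (Y \<otimes>\<^sub>o Z)) \<bullet> as (W \<otimes>\<^sub>o X) Y Z =
   (as W (X \<otimes>\<^sub>o Y) Z \<bullet> (as W X Y \<star> ide Z) \<bullet> sa (W \<otimes>\<^sub>o X) Y Z) \<bullet> as (W \<otimes>\<^sub>o X) Y Z" .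
qed (use assms in auto)

lemma pentagon_inv_b:
  assumes "W \<in> Obj C" "X \<in> Obj C" "Y \<in> Obj C" "Z \<in> Obj C"
  shows "sa W X (Y \<otimes>\<^sub>o Z) \<bullet> (ide W \<star> as X Y Z) =
    as (W \<otimes>\<^sub>o X) Y Z \<bullet> (sa W X Y \<star> ide Z) \<bullet> sa W (X \<otimes>\<^sub>o Y) Z"
proof (rule cancel_left[where m="as W X (Y \<otimes>\<^sub>o Z)" and r="sa W X (Y \<otimes>\<^sub>o Z)"])
  show "as W X (Y \<otimes>\<^sub>o Z) \<bullet> sa W X (Y \<otimes>\<^sub>o Z) \<bullet> (ide W \<star> as X Y Z) =
    as W X (Y \<otimes>\<^sub>o Z) \<bullet> as (W \<otimes>\<^sub>o X) Y Z \<bullet> (sa W X Y \<star> ide Z) \<bullet> sa W (X \<otimes>\<^sub>o Y) Z"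
    by (subst cmp_reduce[OF pentagon_arr]) (use assms in auto)
qed (use assms in auto)

lemma pentagon_inv_c:
  assumes "W \<in> Obj C" "X \<in> Obj C" "Y \<in> Obj C" "Z \<in> Obj C"
  shows "as (W \<otimes>\<^sub>o X) Y Z \<bullet> (sa W X Y \<star> ide Z) =
    sa W X (Y \<otimes>\<^sub>o Z) \<bullet> (ide W \<star> as X Y Z) \<bullet> as W (X \<otimes>\<^sub>o Y) Z"
  by (subst cmp_reduce[OF pentagon_inv_b]) (use assms in auto)

lemma pentagon_inv_d:
  assumes "W \<in> Obj C" "X \<in> Obj C" "Y \<in> Obj C" "Z \<in> Obj C"
  shows "(as W X Y \<star> ide Z) \<bullet> sa (W \<otimes>\<^sub>o X) Y Z =
    sa W (X \<otimes>\<^sub>o Y) Z \<bullet> (ide W \<star> sa X Y Z) \<bullet> as W X (Y \<otimes>\<^sub>o Z)"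
  by (subst pentagon_inv_a) (use assms in auto)

text \<open>The maps \<open>B \<otimes> (B' \<otimes> W) \<rightarrow> W\<close> and \<open>(W \<otimes> B) \<otimes> B' \<rightarrow> W\<close> given by a pairing
  \<open>B \<otimes> B' \<rightarrow> \<one>\<close>, and the maps \<open>W \<rightarrow> B' \<otimes> (B \<otimes> W)\<close> and \<open>W \<rightarrow> (W \<otimes> B') \<otimes> B\<close> given by
  \<open>c : \<one> \<rightarrow> B' \<otimes> B\<close>. For a dual pair they are the counits and units of
  \<open>B \<otimes> - \<turnstile> B' \<otimes> -\<close> and \<open>- \<otimes> B' \<turnstile> - \<otimes> B\<close>.\<close>

definition lact :: "('o, 'm) pairing \<Rightarrow> 'o \<Rightarrow> ('o, 'm) arrow" where
  "lact p W = lu W \<bullet> (form p \<star> ide W) \<bullet> sa (lob p) (rob p) W"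

definition lcoact :: "('o, 'm) pairing \<Rightarrow> ('o, 'm) arrow \<Rightarrow> 'o \<Rightarrow> ('o, 'm) arrow" where
  "lcoact p c W = as (rob p) (lob p) W \<bullet> (c \<star> ide W) \<bullet> ul W"

definition ract :: "('o, 'm) pairing \<Rightarrow> 'o \<Rightarrow> ('o, 'm) arrow" where
  "ract p W = ru W \<bullet> (ide W \<star> form p) \<bullet> as W (lob p) (rob p)"

definition rcoact :: "('o, 'm) pairing \<Rightarrow> ('o, 'm) arrow \<Rightarrow> 'o \<Rightarrow> ('o, 'm) arrow" where
  "rcoact p c W = sa W (rob p) (lob p) \<bullet> (ide W \<star> c) \<bullet> ur W"

lemma act_src_tgt [simp]:
  "src (lact p W) = lob p \<otimes>\<^sub>o (rob p \<otimes>\<^sub>o W)" "tgt (lact p W) = W"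
  "src (lcoact p c W) = W" "tgt (lcoact p c W) = rob p \<otimes>\<^sub>o (lob p \<otimes>\<^sub>o W)"
  "src (ract p W) = (W \<otimes>\<^sub>o lob p) \<otimes>\<^sub>o rob p" "tgt (ract p W) = W"
  "src (rcoact p c W) = W" "tgt (rcoact p c W) = (W \<otimes>\<^sub>o rob p) \<otimes>\<^sub>o lob p"
  by (simp_all add: lact_def ract_def lcoact_def rcoact_def)

lemma act_ok [simp]:
  "pr p \<Longrightarrow> W \<in> Obj C \<Longrightarrow> ok (lact p W)" "pr p \<Longrightarrow> W \<in> Obj C \<Longrightarrow> ok (ract p W)"
  by (simp_all add: lact_def ract_def)

lemma lact_nat:
  assumes "pr p" "ok f" "tgt f = Y"
  shows "lact p Y \<bullet> (ide (lob p) \<star> (ide (rob p) \<star> f)) = f \<bullet> lact p (src f)"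
proof -
  have "lact p Y \<bullet> (ide (lob p) \<star> (ide (rob p) \<star> f)) =
     lu Y \<bullet> (form p \<star> ide Y) \<bullet> sa (lob p) (rob p) Y \<bullet> (ide (lob p) \<star> (ide (rob p) \<star> f))"
    using assms by (auto simp: lact_def)
  also have "\<dots> = lu Y \<bullet> (ide \<one>\<^sub>o \<star> f) \<bullet> (form p \<star> ide (src f)) \<bullet> sa (lob p) (rob p) (src f)"
    by (subst sa_nat) (use assms in auto)
  also have "\<dots> = f \<bullet> lact p (src f)"
    by (subst cmp_reduce[OF lu_nat]) (use assms in \<open>auto simp: lact_def\<close>)
  finally show ?thesis .
qed

lemma ract_nat:
  assumes "pr p" "ok f" "tgt f = Y"
  shows "ract p Y \<bullet> ((f \<star> ide (lob p)) \<star> ide (rob p)) = f \<bullet> ract p (src f)"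
proof -
  have "ract p Y \<bullet> ((f \<star> ide (lob p)) \<star> ide (rob p)) =
     ru Y \<bullet> (ide Y \<star> form p) \<bullet> as Y (lob p) (rob p) \<bullet> ((f \<star> ide (lob p)) \<star> ide (rob p))"
    using assms by (auto simp: ract_def)
  also have "\<dots> = ru Y \<bullet> (f \<star> ide \<one>\<^sub>o) \<bullet> (ide (src f) \<star> form p) \<bullet> as (src f) (lob p) (rob p)"
    by (subst as_nat) (use assms in auto)
  also have "\<dots> = f \<bullet> ract p (src f)"
    by (subst cmp_reduce[OF ru_nat]) (use assms in \<open>auto simp: ract_def\<close>)
  finally show ?thesis .
qed

lemma lact_ract:
  assumes "pr q" "A \<in> Obj C" "A' \<in> Obj C"
  shows "(ide A \<star> lact q A') \<bullet> as A (lob q) (rob q \<otimes>\<^sub>o A') = (ract q A \<star> ide A') \<bullet> sa (A \<otimes>\<^sub>o lob q) (rob q) A'"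
proof -
  let ?B = "lob q" let ?B' = "rob q" let ?b = "form q"
  have "(ide A \<star> lact q A') \<bullet> as A ?B (?B' \<otimes>\<^sub>o A') =
     (ide A \<star> lu A') \<bullet> (ide A \<star> (?b \<star> ide A')) \<bullet> (ide A \<star> sa ?B ?B' A') \<bullet> as A ?B (?B' \<otimes>\<^sub>o A')"
    using assms by (simp add: lact_def)
  also have "\<dots> = (ide A \<star> lu A') \<bullet> (ide A \<star> (?b \<star> ide A')) \<bullet>
     as A (?B \<otimes>\<^sub>o ?B') A' \<bullet> (as A ?B ?B' \<star> ide A') \<bullet> sa (A \<otimes>\<^sub>o ?B) ?B' A'"
    by (subst pentagon_inv_a) (use assms in auto)
  also have "\<dots> = (ide A \<star> lu A') \<bullet> as A \<one>\<^sub>o A' \<bullet>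
     ((ide A \<star> ?b) \<star> ide A') \<bullet> (as A ?B ?B' \<star> ide A') \<bullet> sa (A \<otimes>\<^sub>o ?B) ?B' A'"
    by (subst cmp_reduce[OF as_nat]) (use assms in auto)
  also have "\<dots> = (ru A \<star> ide A') \<bullet> ((ide A \<star> ?b) \<star> ide A') \<bullet> (as A ?B ?B' \<star> ide A') \<bullet> sa (A \<otimes>\<^sub>o ?B) ?B' A'"
    by (subst cmp_reduce[OF triangle_arr]) (use assms in auto)
  also have "\<dots> = (ract q A \<star> ide A') \<bullet> sa (A \<otimes>\<^sub>o ?B) ?B' A'"
    using assms by (simp add: ract_def)
  finally show ?thesis .
qed

lemma ract_one: "pr p \<Longrightarrow> ract p \<one>\<^sub>o = form p \<bullet> (lu (lob p) \<star> ide (rob p))"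
proof -
  assume p: "pr p"
  have "ract p \<one>\<^sub>o = (lu \<one>\<^sub>o \<bullet> (ide \<one>\<^sub>o \<star> form p)) \<bullet> as \<one>\<^sub>o (lob p) (rob p)"
    using p by (simp add: ract_def lu_one_eq_ru_one)
  also have "\<dots> = form p \<bullet> (lu (lob p \<otimes>\<^sub>o rob p) \<bullet> as \<one>\<^sub>o (lob p) (rob p))"
    by (subst lu_nat) (use p in auto)
  finally show ?thesis using p by (simp add: lu_ten)
qed

lemma lact_one: "pr p \<Longrightarrow> lact p \<one>\<^sub>o = form p \<bullet> (ide (lob p) \<star> ru (rob p))"
proof -
  assume p: "pr p"
  have "lact p \<one>\<^sub>o = (ru \<one>\<^sub>o \<bullet> (form p \<star> ide \<one>\<^sub>o)) \<bullet> sa (lob p) (rob p) \<one>\<^sub>o"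
    using p by (simp add: lact_def lu_one_eq_ru_one)
  also have "\<dots> = form p \<bullet> (ru (lob p \<otimes>\<^sub>o rob p) \<bullet> sa (lob p) (rob p) \<one>\<^sub>o)"
    by (subst ru_nat) (use p in auto)
  finally show ?thesis using p by (simp add: ru_ten[symmetric])
qed

text \<open>The pairing exhibits its left object as a left dual of its right object, with coevaluation \<open>c\<close>.\<close>

definition dual :: "('o, 'm) pairing \<Rightarrow> ('o, 'm) arrow \<Rightarrow> bool" where
  "dual p c \<longleftrightarrow> pr p \<and> ok c \<and> src c = \<one>\<^sub>o \<and> tgt c = rob p \<otimes>\<^sub>o lob p \<and>
    ru (rob p) \<bullet> (ide (rob p) \<star> form p) \<bullet> as (rob p) (lob p) (rob p) \<bullet> (c \<star> ide (rob p)) = lu (rob p) \<and>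
    lu (lob p) \<bullet> (form p \<star> ide (lob p)) \<bullet> sa (lob p) (rob p) (lob p) \<bullet> (ide (lob p) \<star> c) = ru (lob p)"

context
  fixes p c assumes d: "dual p c"
begin

lemma dual_simps [simp]: "pr p" "ok c" "src c = \<one>\<^sub>o" "tgt c = rob p \<otimes>\<^sub>o lob p"
  using d by (auto simp: dual_def)

lemma dual_zigzag_rob: "ru (rob p) \<bullet> (ide (rob p) \<star> form p) \<bullet> as (rob p) (lob p) (rob p) \<bullet> (c \<star> ide (rob p)) = lu (rob p)"
  and dual_zigzag_lob: "lu (lob p) \<bullet> (form p \<star> ide (lob p)) \<bullet> sa (lob p) (rob p) (lob p) \<bullet> (ide (lob p) \<star> c) = ru (lob p)"
  using d by (auto simp: dual_def)

lemma coact_ok [simp]: "W \<in> Obj C \<Longrightarrow> ok (lcoact p c W)" "W \<in> Obj C \<Longrightarrow> ok (rcoact p c W)"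
  by (simp_all add: lcoact_def rcoact_def)

lemma lcoact_nat:
  assumes "ok f" "tgt f = Y"
  shows "lcoact p c Y \<bullet> f = (ide (rob p) \<star> (ide (lob p) \<star> f)) \<bullet> lcoact p c (src f)"
proof -
  have "lcoact p c Y \<bullet> f = as (rob p) (lob p) Y \<bullet> (c \<star> ide Y) \<bullet> ul Y \<bullet> f"
    using assms by (auto simp: lcoact_def)
  also have "\<dots> = as (rob p) (lob p) Y \<bullet> ((ide (rob p) \<star> ide (lob p)) \<star> f) \<bullet> (c \<star> ide (src f)) \<bullet> ul (src f)"
    by (subst ul_nat) (use assms in auto)
  also have "\<dots> = (ide (rob p) \<star> (ide (lob p) \<star> f)) \<bullet> lcoact p c (src f)"
    by (subst cmp_reduce[OF as_nat]) (use assms in \<open>auto simp: lcoact_def simp del: ten_ide\<close>)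
  finally show ?thesis .
qed

lemma rcoact_nat:
  assumes "ok f" "tgt f = Y"
  shows "rcoact p c Y \<bullet> f = ((f \<star> ide (rob p)) \<star> ide (lob p)) \<bullet> rcoact p c (src f)"
proof -
  have "rcoact p c Y \<bullet> f = sa Y (rob p) (lob p) \<bullet> (ide Y \<star> c) \<bullet> ur Y \<bullet> f"
    using assms by (auto simp: rcoact_def)
  also have "\<dots> = sa Y (rob p) (lob p) \<bullet> (f \<star> (ide (rob p) \<star> ide (lob p))) \<bullet> (ide (src f) \<star> c) \<bullet> ur (src f)"
    by (subst ur_nat) (use assms in auto)
  also have "\<dots> = ((f \<star> ide (rob p)) \<star> ide (lob p)) \<bullet> rcoact p c (src f)"
    by (subst cmp_reduce[OF sa_nat]) (use assms in \<open>auto simp: rcoact_def simp del: ten_ide\<close>)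
  finally show ?thesis .
qed

text \<open>The triangle identities of the two adjunctions.\<close>

lemma ladj_triangle1:
  assumes W: "W \<in> Obj C"
  shows "(ide (rob p) \<star> lact p W) \<bullet> lcoact p c (rob p \<otimes>\<^sub>o W) = ide (rob p \<otimes>\<^sub>o W)"
proof -
  let ?X = "rob p" let ?X' = "lob p" let ?b = "form p"
  have "(ide ?X \<star> lact p W) \<bullet> lcoact p c (?X \<otimes>\<^sub>o W) = ((ide ?X \<star> lact p W) \<bullet> as ?X ?X' (?X \<otimes>\<^sub>o W)) \<bullet> (c \<star> (ide ?X \<star> ide W)) \<bullet> ul (?X \<otimes>\<^sub>o W)"
    using W by (simp add: lcoact_def)
  also have "\<dots> = (ract p ?X \<star> ide W) \<bullet> sa (?X \<otimes>\<^sub>o ?X') ?X W \<bullet> (c \<star> (ide ?X \<star> ide W)) \<bullet> ul (?X \<otimes>\<^sub>o W)"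
    by (subst lact_ract) (use W in auto)
  also have "\<dots> = (ract p ?X \<star> ide W) \<bullet> ((c \<star> ide ?X) \<star> ide W) \<bullet> sa \<one>\<^sub>o ?X W \<bullet> ul (?X \<otimes>\<^sub>o W)"
    by (subst cmp_reduce[OF sa_nat]) (use W in auto)
  also have "\<dots> = (lu ?X \<star> ide W) \<bullet> sa \<one>\<^sub>o ?X W \<bullet> ul (?X \<otimes>\<^sub>o W)"
    using W dual_zigzag_rob by (simp add: ract_def)
  also have "\<dots> = ide (?X \<otimes>\<^sub>o W)"
    using W by (simp add: lu_ten[symmetric])
  finally show ?thesis .
qed

lemma ladj_triangle2:
  assumes W: "W \<in> Obj C"
  shows "lact p (lob p \<otimes>\<^sub>o W) \<bullet> (ide (lob p) \<star> lcoact p c W) = ide (lob p \<otimes>\<^sub>o W)"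
proof -
  let ?X = "rob p" let ?X' = "lob p" let ?b = "form p"
  have "lact p (?X' \<otimes>\<^sub>o W) \<bullet> (ide ?X' \<star> lcoact p c W) =
     lu (?X' \<otimes>\<^sub>o W) \<bullet> (?b \<star> ide (?X' \<otimes>\<^sub>o W)) \<bullet> (sa ?X' ?X (?X' \<otimes>\<^sub>o W) \<bullet> (ide ?X' \<star> as ?X ?X' W)) \<bullet>
       (ide ?X' \<star> (c \<star> ide W)) \<bullet> (ide ?X' \<star> ul W)"
    using W by (simp add: lcoact_def lact_def)
  also have "\<dots> = lu (?X' \<otimes>\<^sub>o W) \<bullet> (?b \<star> (ide ?X' \<star> ide W)) \<bullet> as (?X' \<otimes>\<^sub>o ?X) ?X' W \<bullet> (sa ?X' ?X ?X' \<star> ide W) \<bullet> sa ?X' (?X \<otimes>\<^sub>o ?X') W \<bullet>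
       (ide ?X' \<star> (c \<star> ide W)) \<bullet> (ide ?X' \<star> ul W)"
    by (subst pentagon_inv_b) (use W in auto)
  also have "\<dots> = lu (?X' \<otimes>\<^sub>o W) \<bullet> (?b \<star> (ide ?X' \<star> ide W)) \<bullet> as (?X' \<otimes>\<^sub>o ?X) ?X' W \<bullet> (sa ?X' ?X ?X' \<star> ide W) \<bullet>
       ((ide ?X' \<star> c) \<star> ide W) \<bullet> sa ?X' \<one>\<^sub>o W \<bullet> (ide ?X' \<star> ul W)"
    by (subst cmp_reduce[OF sa_nat]) (use W in auto)
  also have "\<dots> = lu (?X' \<otimes>\<^sub>o W) \<bullet> as \<one>\<^sub>o ?X' W \<bullet> ((?b \<star> ide ?X') \<star> ide W) \<bullet> (sa ?X' ?X ?X' \<star> ide W) \<bullet>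
       ((ide ?X' \<star> c) \<star> ide W) \<bullet> sa ?X' \<one>\<^sub>o W \<bullet> (ide ?X' \<star> ul W)"
    by (subst cmp_reduce[OF as_nat]) (use W in auto)
  also have "\<dots> = (lu ?X' \<star> ide W) \<bullet> ((?b \<star> ide ?X') \<star> ide W) \<bullet> (sa ?X' ?X ?X' \<star> ide W) \<bullet>
       ((ide ?X' \<star> c) \<star> ide W) \<bullet> sa ?X' \<one>\<^sub>o W \<bullet> (ide ?X' \<star> ul W)"
    by (subst cmp_reduce[OF lu_ten]) (use W in auto)
  also have "\<dots> = (ru ?X' \<star> ide W) \<bullet> sa ?X' \<one>\<^sub>o W \<bullet> (ide ?X' \<star> ul W)"
    using W dual_zigzag_lob by simp
  also have "\<dots> = ide (?X' \<otimes>\<^sub>o W)"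
    using W by (simp add: triangle_arr[symmetric])
  finally show ?thesis .
qed

lemma radj_triangle1:
  assumes W: "W \<in> Obj C"
  shows "ract p (W \<otimes>\<^sub>o rob p) \<bullet> (rcoact p c W \<star> ide (rob p)) = ide (W \<otimes>\<^sub>o rob p)"
proof -
  let ?X = "rob p" let ?X' = "lob p" let ?b = "form p"
  have "ract p (W \<otimes>\<^sub>o ?X) \<bullet> (rcoact p c W \<star> ide ?X) =
     ru (W \<otimes>\<^sub>o ?X) \<bullet> (ide (W \<otimes>\<^sub>o ?X) \<star> ?b) \<bullet> (as (W \<otimes>\<^sub>o ?X) ?X' ?X \<bullet> (sa W ?X ?X' \<star> ide ?X)) \<bullet>
       ((ide W \<star> c) \<star> ide ?X) \<bullet> (ur W \<star> ide ?X)"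
    using W by (simp add: rcoact_def ract_def)
  also have "\<dots> = ru (W \<otimes>\<^sub>o ?X) \<bullet> ((ide W \<star> ide ?X) \<star> ?b) \<bullet> sa W ?X (?X' \<otimes>\<^sub>o ?X) \<bullet> (ide W \<star> as ?X ?X' ?X) \<bullet> as W (?X \<otimes>\<^sub>o ?X') ?X \<bullet>
       ((ide W \<star> c) \<star> ide ?X) \<bullet> (ur W \<star> ide ?X)"
    by (subst pentagon_inv_c) (use W in auto)
  also have "\<dots> = ru (W \<otimes>\<^sub>o ?X) \<bullet> ((ide W \<star> ide ?X) \<star> ?b) \<bullet> sa W ?X (?X' \<otimes>\<^sub>o ?X) \<bullet> (ide W \<star> as ?X ?X' ?X) \<bullet>
       (ide W \<star> (c \<star> ide ?X)) \<bullet> as W \<one>\<^sub>o ?X \<bullet> (ur W \<star> ide ?X)"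
    by (subst cmp_reduce[OF as_nat]) (use W in auto)
  also have "\<dots> = ru (W \<otimes>\<^sub>o ?X) \<bullet> sa W ?X \<one>\<^sub>o \<bullet> (ide W \<star> (ide ?X \<star> ?b)) \<bullet> (ide W \<star> as ?X ?X' ?X) \<bullet>
       (ide W \<star> (c \<star> ide ?X)) \<bullet> as W \<one>\<^sub>o ?X \<bullet> (ur W \<star> ide ?X)"
    by (subst cmp_reduce[OF sa_nat]) (use W in auto)
  also have "\<dots> = (ide W \<star> lu ?X) \<bullet> as W \<one>\<^sub>o ?X \<bullet> (ur W \<star> ide ?X)"
    using W dual_zigzag_rob by (simp add: ru_ten[symmetric])
  also have "\<dots> = ide (W \<otimes>\<^sub>o ?X)"
    using W by (simp add: cmp_reduce[OF triangle_arr])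
  finally show ?thesis .
qed

lemma radj_triangle2:
  assumes W: "W \<in> Obj C"
  shows "(ract p W \<star> ide (lob p)) \<bullet> rcoact p c (W \<otimes>\<^sub>o lob p) = ide (W \<otimes>\<^sub>o lob p)"
proof -
  let ?X = "rob p" let ?X' = "lob p" let ?b = "form p"
  have "(ract p W \<star> ide ?X') \<bullet> rcoact p c (W \<otimes>\<^sub>o ?X') = ((ract p W \<star> ide ?X') \<bullet> sa (W \<otimes>\<^sub>o ?X') ?X ?X') \<bullet> ((ide W \<star> ide ?X') \<star> c) \<bullet> ur (W \<otimes>\<^sub>o ?X')"
    using W by (simp add: rcoact_def)
  also have "\<dots> = (ide W \<star> lact p ?X') \<bullet> as W ?X' (?X \<otimes>\<^sub>o ?X') \<bullet> ((ide W \<star> ide ?X') \<star> c) \<bullet> ur (W \<otimes>\<^sub>o ?X')"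
    by (subst lact_ract[symmetric]) (use W in auto)
  also have "\<dots> = (ide W \<star> lact p ?X') \<bullet> (ide W \<star> (ide ?X' \<star> c)) \<bullet> as W ?X' \<one>\<^sub>o \<bullet> ur (W \<otimes>\<^sub>o ?X')"
    by (subst cmp_reduce[OF as_nat]) (use W in auto)
  also have "\<dots> = (ide W \<star> ru ?X') \<bullet> as W ?X' \<one>\<^sub>o \<bullet> ur (W \<otimes>\<^sub>o ?X')"
    using W dual_zigzag_lob by (simp add: lact_def)
  also have "\<dots> = ide (W \<otimes>\<^sub>o ?X')"
    using W by (simp add: cmp_reduce[OF ru_ten])
  finally show ?thesis .
qed

lemma radj_inv:
  assumes "ok \<phi>" "src \<phi> = W \<otimes>\<^sub>o rob p" "W \<in> Obj C" "tgt \<phi> = M"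
  shows "ract p M \<bullet> (((\<phi> \<star> ide (lob p)) \<bullet> rcoact p c W) \<star> ide (rob p)) = \<phi>"
proof -
  have "ract p M \<bullet> (((\<phi> \<star> ide (lob p)) \<bullet> rcoact p c W) \<star> ide (rob p)) =
     (ract p M \<bullet> ((\<phi> \<star> ide (lob p)) \<star> ide (rob p))) \<bullet> (rcoact p c W \<star> ide (rob p))"
    using assms by auto
  also have "\<dots> = \<phi> \<bullet> ract p (W \<otimes>\<^sub>o rob p) \<bullet> (rcoact p c W \<star> ide (rob p))"
    by (subst ract_nat) (use assms in auto)
  finally show ?thesis using assms by (simp add: radj_triangle1)
qed

lemma radj_inv':
  assumes "ok h" "tgt h = M \<otimes>\<^sub>o lob p" "M \<in> Obj C" "src h = W"
  shows "((ract p M \<bullet> (h \<star> ide (rob p))) \<star> ide (lob p)) \<bullet> rcoact p c W = h"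
proof -
  have "((ract p M \<bullet> (h \<star> ide (rob p))) \<star> ide (lob p)) \<bullet> rcoact p c W =
     (ract p M \<star> ide (lob p)) \<bullet> ((h \<star> ide (rob p)) \<star> ide (lob p)) \<bullet> rcoact p c (src h)"
    using assms by auto
  also have "\<dots> = (ract p M \<star> ide (lob p)) \<bullet> rcoact p c (M \<otimes>\<^sub>o lob p) \<bullet> h"
    by (subst rcoact_nat) (use assms in auto)
  also have "\<dots> = h" using assms by (simp add: cmp_reduce[OF radj_triangle2])
  finally show ?thesis .
qed

lemma ladj_inv:
  assumes "ok \<phi>" "src \<phi> = lob p \<otimes>\<^sub>o W" "W \<in> Obj C" "tgt \<phi> = M"
  shows "lact p M \<bullet> (ide (lob p) \<star> ((ide (rob p) \<star> \<phi>) \<bullet> lcoact p c W)) = \<phi>"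
proof -
  have "lact p M \<bullet> (ide (lob p) \<star> ((ide (rob p) \<star> \<phi>) \<bullet> lcoact p c W)) =
     (lact p M \<bullet> (ide (lob p) \<star> (ide (rob p) \<star> \<phi>))) \<bullet> (ide (lob p) \<star> lcoact p c W)"
    using assms by auto
  also have "\<dots> = \<phi> \<bullet> lact p (lob p \<otimes>\<^sub>o W) \<bullet> (ide (lob p) \<star> lcoact p c W)"
    by (subst lact_nat) (use assms in auto)
  finally show ?thesis using assms by (simp add: ladj_triangle2)
qed

lemma ladj_inv':
  assumes "ok h" "tgt h = rob p \<otimes>\<^sub>o M" "M \<in> Obj C" "src h = W"
  shows "(ide (rob p) \<star> (lact p M \<bullet> (ide (lob p) \<star> h))) \<bullet> lcoact p c W = h"
proof -
  have "(ide (rob p) \<star> (lact p M \<bullet> (ide (lob p) \<star> h))) \<bullet> lcoact p c W =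
     (ide (rob p) \<star> lact p M) \<bullet> (ide (rob p) \<star> (ide (lob p) \<star> h)) \<bullet> lcoact p c (src h)"
    using assms by auto
  also have "\<dots> = (ide (rob p) \<star> lact p M) \<bullet> lcoact p c (rob p \<otimes>\<^sub>o M) \<bullet> h"
    by (subst lcoact_nat) (use assms in auto)
  also have "\<dots> = h" using assms by (simp add: cmp_reduce[OF ladj_triangle1])
  finally show ?thesis .
qed

end

text \<open>Outside the context the coevaluation would be undetermined in the premises of these rules.\<close>

declare dual_simps [simp del]

end

section \<open>Nested and perfect pairings\<close>

context finite_tensor_category
begin

text \<open>A left perfect pairing: \<open>h \<mapsto> form p \<circ> (h \<otimes> id)\<close> is a bijection from the morphisms \<open>W \<rightarrow> lob p\<close> to
  the morphisms \<open>W \<otimes> rob p \<rightarrow> \<one>\<close>, for every \<open>W\<close>. This is weaker than \<open>dual\<close>, since no coevaluation is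
  required.\<close>

definition lperf :: "('o, 'm) pairing \<Rightarrow> bool" where
  "lperf p \<longleftrightarrow> pr p \<and>
    (\<forall>W\<in>Obj C. \<forall>\<phi>. ok \<phi> \<and> src \<phi> = W \<otimes>\<^sub>o rob p \<and> tgt \<phi> = \<one>\<^sub>o \<longrightarrow>
      (\<exists>h. ok h \<and> src h = W \<and> tgt h = lob p \<and> form p \<bullet> (h \<star> ide (rob p)) = \<phi>)) \<and>
    (\<forall>h k. ok h \<and> ok k \<and> src h = src k \<and> tgt h = lob p \<and> tgt k = lob p \<and>
      form p \<bullet> (h \<star> ide (rob p)) = form p \<bullet> (k \<star> ide (rob p)) \<longrightarrow> h = k)"

text \<open>The same condition for the other argument of the pairing.\<close>

definition rperf :: "('o, 'm) pairing \<Rightarrow> bool" where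
  "rperf p \<longleftrightarrow> pr p \<and>
    (\<forall>W\<in>Obj C. \<forall>\<phi>. ok \<phi> \<and> src \<phi> = lob p \<otimes>\<^sub>o W \<and> tgt \<phi> = \<one>\<^sub>o \<longrightarrow>
      (\<exists>h. ok h \<and> src h = W \<and> tgt h = rob p \<and> form p \<bullet> (ide (lob p) \<star> h) = \<phi>)) \<and>
    (\<forall>h k. ok h \<and> ok k \<and> src h = src k \<and> tgt h = rob p \<and> tgt k = rob p \<and>
      form p \<bullet> (ide (lob p) \<star> h) = form p \<bullet> (ide (lob p) \<star> k) \<longrightarrow> h = k)"

text \<open>The pairing obtained by composing a pairing with \<open>f\<close> and \<open>g\<close> on its two objects.\<close>

definition pb :: "('o, 'm) pairing \<Rightarrow> ('o, 'm) arrow \<Rightarrow> ('o, 'm) arrow \<Rightarrow> ('o, 'm) pairing" where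
  "pb p f g = Pairing (src f) (src g) (form p \<bullet> (f \<star> g))"

text \<open>The nested pairing \<open>(A \<otimes> B) \<otimes> (B' \<otimes> A') \<rightarrow> \<one>\<close>, with \<open>q\<close> inside \<open>p\<close>.\<close>

definition star :: "('o, 'm) pairing \<Rightarrow> ('o, 'm) pairing \<Rightarrow> ('o, 'm) pairing" (infixl \<open>\<diamondop>\<close> 75) where
  "p \<diamondop> q = Pairing (lob p \<otimes>\<^sub>o lob q) (rob q \<otimes>\<^sub>o rob p)
     (form p \<bullet> (ide (lob p) \<star> lact q (rob p)) \<bullet> as (lob p) (lob q) (rob q \<otimes>\<^sub>o rob p))"

lemma pairing_eqI: "lob p = lob q \<Longrightarrow> rob p = rob q \<Longrightarrow> form p = form q \<Longrightarrow> p = q"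
  by (cases p; cases q) auto

lemma pb_simps [simp]: "lob (pb p f g) = src f" "rob (pb p f g) = src g" "form (pb p f g) = form p \<bullet> (f \<star> g)"
  by (simp_all add: pb_def)

lemma star_simps [simp]: "lob (p \<diamondop> q) = lob p \<otimes>\<^sub>o lob q" "rob (p \<diamondop> q) = rob q \<otimes>\<^sub>o rob p"
  by (simp_all add: star_def)

lemma form_star: "form (p \<diamondop> q) = form p \<bullet> (ide (lob p) \<star> lact q (rob p)) \<bullet> as (lob p) (lob q) (rob q \<otimes>\<^sub>o rob p)"
  by (simp add: star_def)

lemma pr_pb [simp]: "pr p \<Longrightarrow> ok f \<Longrightarrow> ok g \<Longrightarrow> tgt f = lob p \<Longrightarrow> tgt g = rob p \<Longrightarrow> pr (pb p f g)"
  unfolding pr_def[of "pb p f g"] by simp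

lemma pr_star [simp]: "pr p \<Longrightarrow> pr q \<Longrightarrow> pr (p \<diamondop> q)"
  unfolding pr_def[of "p \<diamondop> q"] by (simp add: form_star)

lemma pb_pb [simp]:
  assumes "pr p" "ok f" "ok g" "ok f'" "ok g'" "tgt f = lob p" "tgt g = rob p" "tgt f' = src f" "tgt g' = src g"
  shows "pb (pb p f g) f' g' = pb p (f \<bullet> f') (g \<bullet> g')"
  by (rule pairing_eqI) (use assms in auto)

lemma pb_ide: "pr p \<Longrightarrow> pb p (ide (lob p)) (ide (rob p)) = p"
  by (rule pairing_eqI) auto

lemma pb_form: "pb p f g = pb q h k \<Longrightarrow> form p \<bullet> (f \<star> g) = form q \<bullet> (h \<star> k)"
  by (simp add: pb_def)

lemma lact_pb:
  assumes "pr q" "ok h" "ok k" "tgt h = lob q" "tgt k = rob q" "W \<in> Obj C"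
  shows "lact (pb q h k) W = lact q W \<bullet> (h \<star> (k \<star> ide W))"
proof -
  have "lact (pb q h k) W = lu W \<bullet> (form q \<star> ide W) \<bullet> ((h \<star> k) \<star> ide W) \<bullet> sa (src h) (src k) W"
    using assms by (simp add: lact_def)
  also have "\<dots> = lu W \<bullet> (form q \<star> ide W) \<bullet> sa (lob q) (rob q) W \<bullet> (h \<star> (k \<star> ide W))"
    by (subst sa_nat) (use assms in auto)
  finally show ?thesis using assms by (simp add: lact_def)
qed

lemma star_pb:
  assumes "pr p" "pr q" "ok f" "ok g" "ok h" "ok k" "tgt f = lob p" "tgt g = rob p" "tgt h = lob q" "tgt k = rob q"
  shows "pb p f g \<diamondop> pb q h k = pb (p \<diamondop> q) (f \<star> h) (k \<star> g)"
proof (rule pairing_eqI)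
  have "form (pb p f g \<diamondop> pb q h k) = form p \<bullet> (f \<star> (g \<bullet> (lact q (src g) \<bullet> (h \<star> (k \<star> ide (src g)))))) \<bullet>
     as (src f) (src h) (src k \<otimes>\<^sub>o src g)"
    using assms by (simp add: form_star lact_pb)
  also have "g \<bullet> (lact q (src g) \<bullet> (h \<star> (k \<star> ide (src g)))) = (lact q (rob p) \<bullet> (ide (lob q) \<star> (ide (rob q) \<star> g))) \<bullet> (h \<star> (k \<star> ide (src g)))"
    by (subst lact_nat) (use assms in auto)
  also have "form p \<bullet> (f \<star> ((lact q (rob p) \<bullet> (ide (lob q) \<star> (ide (rob q) \<star> g))) \<bullet> (h \<star> (k \<star> ide (src g))))) \<bullet>
     as (src f) (src h) (src k \<otimes>\<^sub>o src g) =
     form p \<bullet> (ide (lob p) \<star> lact q (rob p)) \<bullet> (f \<star> (h \<star> (k \<star> g))) \<bullet> as (src f) (src h) (src (k \<star> g))"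
    using assms by simp
  also have "\<dots> = form p \<bullet> (ide (lob p) \<star> lact q (rob p)) \<bullet> as (lob p) (lob q) (rob q \<otimes>\<^sub>o rob p) \<bullet> ((f \<star> h) \<star> (k \<star> g))"
    by (subst as_nat) (use assms in auto)
  also have "\<dots> = form (pb (p \<diamondop> q) (f \<star> h) (k \<star> g))"
    using assms by (simp add: form_star)
  finally show "form (pb p f g \<diamondop> pb q h k) = form (pb (p \<diamondop> q) (f \<star> h) (k \<star> g))" .
qed auto

lemma star_pb_left:
  assumes "pr p" "pr q" "ok f" "ok g" "tgt f = lob p" "tgt g = rob p"
  shows "pb p f g \<diamondop> q = pb (p \<diamondop> q) (f \<star> ide (lob q)) (ide (rob q) \<star> g)"
  using star_pb[of p q f g "ide (lob q)" "ide (rob q)"] assms by (simp add: pb_ide)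

lemma star_pb_right:
  assumes "pr p" "pr q" "ok h" "ok k" "tgt h = lob q" "tgt k = rob q"
  shows "p \<diamondop> pb q h k = pb (p \<diamondop> q) (ide (lob p) \<star> h) (k \<star> ide (rob p))"
  using star_pb[of p q "ide (lob p)" "ide (rob p)" h k] assms by (simp add: pb_ide)

lemma pentagon_inv_e:
  assumes "W \<in> Obj C" "X \<in> Obj C" "Y \<in> Obj C" "Z \<in> Obj C"
  shows "(sa W X Y \<star> ide Z) \<bullet> sa W (X \<otimes>\<^sub>o Y) Z = sa (W \<otimes>\<^sub>o X) Y Z \<bullet> sa W X (Y \<otimes>\<^sub>o Z) \<bullet> (ide W \<star> as X Y Z)"
  by (subst pentagon_inv_b) (use assms in auto)

lemma lact_ten:
  assumes "pr p" "U \<in> Obj C" "W \<in> Obj C"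
  shows "(lact p U \<star> ide W) \<bullet> sa (lob p) (rob p \<otimes>\<^sub>o U) W = lact p (U \<otimes>\<^sub>o W) \<bullet> (ide (lob p) \<star> as (rob p) U W)"
proof -
  have "(lact p U \<star> ide W) \<bullet> sa (lob p) (rob p \<otimes>\<^sub>o U) W =
    (lu U \<star> ide W) \<bullet> ((form p \<star> ide U) \<star> ide W) \<bullet> (sa (lob p) (rob p) U \<star> ide W) \<bullet> sa (lob p) (rob p \<otimes>\<^sub>o U) W"
    using assms by (simp add: lact_def)
  also have "\<dots> = (lu U \<star> ide W) \<bullet> ((form p \<star> ide U) \<star> ide W) \<bullet> sa (lob p \<otimes>\<^sub>o rob p) U W \<bullet> sa (lob p) (rob p) (U \<otimes>\<^sub>o W) \<bullet> (ide (lob p) \<star> as (rob p) U W)"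
    by (subst pentagon_inv_e) (use assms in auto)
  also have "\<dots> = (lu U \<star> ide W) \<bullet> sa \<one>\<^sub>o U W \<bullet> (form p \<star> (ide U \<star> ide W)) \<bullet> sa (lob p) (rob p) (U \<otimes>\<^sub>o W) \<bullet> (ide (lob p) \<star> as (rob p) U W)"
    by (subst cmp_reduce[OF sa_nat]) (use assms in auto)
  also have "\<dots> = lact p (U \<otimes>\<^sub>o W) \<bullet> (ide (lob p) \<star> as (rob p) U W)"
    using assms by (simp add: lact_def lu_ten[symmetric])
  finally show ?thesis .
qed

lemma lact_star:
  assumes "pr q" "pr r" "W \<in> Obj C"
  shows "lact (q \<diamondop> r) W = lact q W \<bullet> (ide (lob q) \<star> lact r (rob q \<otimes>\<^sub>o W)) \<bullet> as (lob q) (lob r) (rob r \<otimes>\<^sub>o (rob q \<otimes>\<^sub>o W)) \<bullet>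
     (ide (lob q \<otimes>\<^sub>o lob r) \<star> as (rob r) (rob q) W)"
proof -
  let ?B = "lob q" let ?B' = "rob q" let ?D = "lob r" let ?D' = "rob r"
  have "lact (q \<diamondop> r) W = lu W \<bullet> (form q \<star> ide W) \<bullet> ((ide ?B \<star> lact r ?B') \<star> ide W) \<bullet>
     (as ?B ?D (?D' \<otimes>\<^sub>o ?B') \<star> ide W) \<bullet> sa (?B \<otimes>\<^sub>o ?D) (?D' \<otimes>\<^sub>o ?B') W"
    using assms by (simp add: lact_def[of "q \<diamondop> r"] form_star)
  also have "\<dots> = lu W \<bullet> (form q \<star> ide W) \<bullet> ((ide ?B \<star> lact r ?B') \<star> ide W) \<bullet>
     sa ?B (?D \<otimes>\<^sub>o (?D' \<otimes>\<^sub>o ?B')) W \<bullet> (ide ?B \<star> sa ?D (?D' \<otimes>\<^sub>o ?B') W) \<bullet> as ?B ?D ((?D' \<otimes>\<^sub>o ?B') \<otimes>\<^sub>o W)"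
    by (subst pentagon_inv_d) (use assms in auto)
  also have "\<dots> = lu W \<bullet> (form q \<star> ide W) \<bullet> sa ?B ?B' W \<bullet> (ide ?B \<star> (lact r ?B' \<star> ide W)) \<bullet>
     (ide ?B \<star> sa ?D (?D' \<otimes>\<^sub>o ?B') W) \<bullet> as ?B ?D ((?D' \<otimes>\<^sub>o ?B') \<otimes>\<^sub>o W)"
    by (subst cmp_reduce[OF sa_nat]) (use assms in auto)
  also have "\<dots> = lact q W \<bullet> (ide ?B \<star> ((lact r ?B' \<star> ide W) \<bullet> sa ?D (?D' \<otimes>\<^sub>o ?B') W)) \<bullet> as ?B ?D ((?D' \<otimes>\<^sub>o ?B') \<otimes>\<^sub>o W)"
    using assms by (simp add: lact_def[of q])
  also have "\<dots> = lact q W \<bullet> (ide ?B \<star> lact r (?B' \<otimes>\<^sub>o W)) \<bullet> (ide ?B \<star> (ide ?D \<star> as ?D' ?B' W)) \<bullet> as ?B ?D ((?D' \<otimes>\<^sub>o ?B') \<otimes>\<^sub>o W)"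
    by (subst lact_ten) (use assms in auto)
  also have "\<dots> = lact q W \<bullet> (ide ?B \<star> lact r (?B' \<otimes>\<^sub>o W)) \<bullet> as ?B ?D (?D' \<otimes>\<^sub>o (?B' \<otimes>\<^sub>o W)) \<bullet> ((ide ?B \<star> ide ?D) \<star> as ?D' ?B' W)"
    by (subst as_nat) (use assms in auto)
  finally show ?thesis using assms by simp
qed

lemma star_assoc:
  assumes "pr p" "pr q" "pr r"
  shows "pb (p \<diamondop> (q \<diamondop> r)) (as (lob p) (lob q) (lob r)) (ide ((rob r \<otimes>\<^sub>o rob q) \<otimes>\<^sub>o rob p)) =
    pb ((p \<diamondop> q) \<diamondop> r) (ide ((lob p \<otimes>\<^sub>o lob q) \<otimes>\<^sub>o lob r)) (as (rob r) (rob q) (rob p))"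
proof (rule pairing_eqI)
  let ?A = "lob p" let ?A' = "rob p" let ?B = "lob q" let ?B' = "rob q" let ?D = "lob r" let ?D' = "rob r"
  let ?Z = "?D' \<otimes>\<^sub>o (?B' \<otimes>\<^sub>o ?A')"
  have "form (pb (p \<diamondop> (q \<diamondop> r)) (as ?A ?B ?D) (ide ((?D' \<otimes>\<^sub>o ?B') \<otimes>\<^sub>o ?A'))) =
    form p \<bullet> (ide ?A \<star> lact q ?A') \<bullet> (ide ?A \<star> (ide ?B \<star> lact r (?B' \<otimes>\<^sub>o ?A'))) \<bullet> (ide ?A \<star> as ?B ?D ?Z) \<bullet>
    (ide ?A \<star> (ide (?B \<otimes>\<^sub>o ?D) \<star> as ?D' ?B' ?A')) \<bullet> as ?A (?B \<otimes>\<^sub>o ?D) ((?D' \<otimes>\<^sub>o ?B') \<otimes>\<^sub>o ?A') \<bullet> (as ?A ?B ?D \<star> ide ((?D' \<otimes>\<^sub>o ?B') \<otimes>\<^sub>o ?A'))"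
    using assms by (simp add: form_star lact_star)
  also have "\<dots> = form p \<bullet> (ide ?A \<star> lact q ?A') \<bullet> (ide ?A \<star> (ide ?B \<star> lact r (?B' \<otimes>\<^sub>o ?A'))) \<bullet> (ide ?A \<star> as ?B ?D ?Z) \<bullet>
    as ?A (?B \<otimes>\<^sub>o ?D) ?Z \<bullet> ((ide ?A \<star> ide (?B \<otimes>\<^sub>o ?D)) \<star> as ?D' ?B' ?A') \<bullet> (as ?A ?B ?D \<star> ide ((?D' \<otimes>\<^sub>o ?B') \<otimes>\<^sub>o ?A'))"
    by (subst cmp_reduce[OF as_nat]) (use assms in auto)
  also have "\<dots> = form p \<bullet> (ide ?A \<star> lact q ?A') \<bullet> (ide ?A \<star> (ide ?B \<star> lact r (?B' \<otimes>\<^sub>o ?A'))) \<bullet> ((ide ?A \<star> as ?B ?D ?Z) \<bullet>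
    as ?A (?B \<otimes>\<^sub>o ?D) ?Z \<bullet> (as ?A ?B ?D \<star> ide ?Z)) \<bullet> (ide ((?A \<otimes>\<^sub>o ?B) \<otimes>\<^sub>o ?D) \<star> as ?D' ?B' ?A')"
    using assms by simp
  also have "\<dots> = form p \<bullet> (ide ?A \<star> lact q ?A') \<bullet> (ide ?A \<star> (ide ?B \<star> lact r (?B' \<otimes>\<^sub>o ?A'))) \<bullet>
    as ?A ?B (?D \<otimes>\<^sub>o ?Z) \<bullet> as (?A \<otimes>\<^sub>o ?B) ?D ?Z \<bullet> (ide ((?A \<otimes>\<^sub>o ?B) \<otimes>\<^sub>o ?D) \<star> as ?D' ?B' ?A')"
    by (subst pentagon_arr[symmetric]) (use assms in auto)
  also have "\<dots> = form p \<bullet> (ide ?A \<star> lact q ?A') \<bullet> as ?A ?B (?B' \<otimes>\<^sub>o ?A') \<bullet> ((ide ?A \<star> ide ?B) \<star> lact r (?B' \<otimes>\<^sub>o ?A')) \<bullet>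
    as (?A \<otimes>\<^sub>o ?B) ?D ?Z \<bullet> (ide ((?A \<otimes>\<^sub>o ?B) \<otimes>\<^sub>o ?D) \<star> as ?D' ?B' ?A')"
    by (subst cmp_reduce[OF as_nat]) (use assms in auto)
  also have "\<dots> = form (pb ((p \<diamondop> q) \<diamondop> r) (ide ((?A \<otimes>\<^sub>o ?B) \<otimes>\<^sub>o ?D)) (as ?D' ?B' ?A'))"
    using assms by (simp add: form_star)
  finally show "form (pb (p \<diamondop> (q \<diamondop> r)) (as ?A ?B ?D) (ide ((?D' \<otimes>\<^sub>o ?B') \<otimes>\<^sub>o ?A'))) =
    form (pb ((p \<diamondop> q) \<diamondop> r) (ide ((?A \<otimes>\<^sub>o ?B) \<otimes>\<^sub>o ?D)) (as ?D' ?B' ?A'))" .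
qed (use assms in auto)

definition unit_pairing :: "('o, 'm) pairing" where
  "unit_pairing = Pairing \<one>\<^sub>o \<one>\<^sub>o (lu \<one>\<^sub>o)"

lemma unit_pairing_simps [simp]: "lob unit_pairing = \<one>\<^sub>o" "rob unit_pairing = \<one>\<^sub>o" "form unit_pairing = lu \<one>\<^sub>o" "pr unit_pairing"
  unfolding pr_def by (simp_all add: unit_pairing_def)

lemma dual_unit_pairing: "dual unit_pairing (ul \<one>\<^sub>o)"
proof -
  have "ru \<one>\<^sub>o \<bullet> (ide \<one>\<^sub>o \<star> lu \<one>\<^sub>o) \<bullet> as \<one>\<^sub>o \<one>\<^sub>o \<one>\<^sub>o \<bullet> (ul \<one>\<^sub>o \<star> ide \<one>\<^sub>o) = ru \<one>\<^sub>o \<bullet> (ru \<one>\<^sub>o \<star> ide \<one>\<^sub>o) \<bullet> (ul \<one>\<^sub>o \<star> ide \<one>\<^sub>o)"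
    by (subst cmp_reduce[OF triangle_arr]) auto
  moreover have "lu \<one>\<^sub>o \<bullet> (lu \<one>\<^sub>o \<star> ide \<one>\<^sub>o) \<bullet> sa \<one>\<^sub>o \<one>\<^sub>o \<one>\<^sub>o \<bullet> (ide \<one>\<^sub>o \<star> ul \<one>\<^sub>o) = lu \<one>\<^sub>o \<bullet> (ide \<one>\<^sub>o \<star> lu \<one>\<^sub>o) \<bullet> (ide \<one>\<^sub>o \<star> ul \<one>\<^sub>o)"
    by (simp add: lu_ten[symmetric] lu_unit_ten)
  ultimately show ?thesis
    by (simp add: dual_def lu_one_eq_ru_one[symmetric])
qed

lemma star_unit_pairing:
  assumes "pr p"
  shows "p \<diamondop> unit_pairing = pb p (ru (lob p)) (lu (rob p))"
proof (rule pairing_eqI)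
  let ?A = "lob p" let ?A' = "rob p"
  have "lact unit_pairing ?A' = lu ?A' \<bullet> (ide \<one>\<^sub>o \<star> lu ?A')"
    using assms by (simp add: lact_def lu_ten[symmetric] lu_unit_ten)
  hence "form (p \<diamondop> unit_pairing) = form p \<bullet> (ide ?A \<star> lu ?A') \<bullet> (ide ?A \<star> (ide \<one>\<^sub>o \<star> lu ?A')) \<bullet> as ?A \<one>\<^sub>o (\<one>\<^sub>o \<otimes>\<^sub>o ?A')"
    using assms by (simp add: form_star)
  also have "\<dots> = form p \<bullet> (ide ?A \<star> lu ?A') \<bullet> as ?A \<one>\<^sub>o ?A' \<bullet> ((ide ?A \<star> ide \<one>\<^sub>o) \<star> lu ?A')"
    by (subst as_nat) (use assms in auto)
  also have "\<dots> = form p \<bullet> (ru ?A \<star> ide ?A') \<bullet> ((ide ?A \<star> ide \<one>\<^sub>o) \<star> lu ?A')"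
    by (subst cmp_reduce[OF triangle_arr]) (use assms in auto)
  finally show "form (p \<diamondop> unit_pairing) = form (pb p (ru ?A) (lu ?A'))"
    using assms by simp
qed auto

lemma lperfD: "lperf p \<Longrightarrow> pr p" unfolding lperf_def by blast
lemma rperfD: "rperf p \<Longrightarrow> pr p" unfolding rperf_def by blast

lemma lperf_ex:
  assumes "lperf p" "ok \<phi>" "src \<phi> = W \<otimes>\<^sub>o rob p" "tgt \<phi> = \<one>\<^sub>o" "W \<in> Obj C"
  obtains h where "ok h" "src h = W" "tgt h = lob p" "form p \<bullet> (h \<star> ide (rob p)) = \<phi>"
  using assms unfolding lperf_def by blast

lemma lperf_inj:
  assumes "lperf p" "ok h" "ok k" "src h = src k" "tgt h = lob p" "tgt k = lob p"
    "form p \<bullet> (h \<star> ide (rob p)) = form p \<bullet> (k \<star> ide (rob p))"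
  shows "h = k"
  using assms unfolding lperf_def by blast

lemma rperf_ex:
  assumes "rperf p" "ok \<phi>" "src \<phi> = lob p \<otimes>\<^sub>o W" "tgt \<phi> = \<one>\<^sub>o" "W \<in> Obj C"
  obtains h where "ok h" "src h = W" "tgt h = rob p" "form p \<bullet> (ide (lob p) \<star> h) = \<phi>"
  using assms unfolding rperf_def by blast

lemma rperf_inj:
  assumes "rperf p" "ok h" "ok k" "src h = src k" "tgt h = rob p" "tgt k = rob p"
    "form p \<bullet> (ide (lob p) \<star> h) = form p \<bullet> (ide (lob p) \<star> k)"
  shows "h = k"
  using assms unfolding rperf_def by blast

lemma ract_one_cmp:
  assumes "pr p" "ok h" "tgt h = \<one>\<^sub>o \<otimes>\<^sub>o lob p"
  shows "ract p \<one>\<^sub>o \<bullet> (h \<star> ide (rob p)) = form p \<bullet> ((lu (lob p) \<bullet> h) \<star> ide (rob p))"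
  using assms by (simp add: ract_one)

lemma lact_one_cmp:
  assumes "pr p" "ok h" "tgt h = rob p \<otimes>\<^sub>o \<one>\<^sub>o"
  shows "lact p \<one>\<^sub>o \<bullet> (ide (lob p) \<star> h) = form p \<bullet> (ide (lob p) \<star> (ru (rob p) \<bullet> h))"
  using assms by (simp add: lact_one)

lemma dual_transpose:
  assumes d: "dual p c" and "ok \<phi>" "src \<phi> = W \<otimes>\<^sub>o rob p" "tgt \<phi> = \<one>\<^sub>o" "W \<in> Obj C"
  shows "form p \<bullet> ((lu (lob p) \<bullet> (\<phi> \<star> ide (lob p)) \<bullet> rcoact p c W) \<star> ide (rob p)) = \<phi>"
  using radj_inv[OF d assms(2,3,5,4)] ract_one_cmp[of p "(\<phi> \<star> ide (lob p)) \<bullet> rcoact p c W"] assms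
    dual_simps[OF d] coact_ok[OF d]
  by simp

lemma radj_inj:
  assumes d: "dual p c" and "ok h" "ok k" "src h = src k" "tgt h = M \<otimes>\<^sub>o lob p" "tgt k = M \<otimes>\<^sub>o lob p" "M \<in> Obj C"
    "ract p M \<bullet> (h \<star> ide (rob p)) = ract p M \<bullet> (k \<star> ide (rob p))"
  shows "h = k"
  using radj_inv'[OF d, of h M "src h"] radj_inv'[OF d, of k M "src h"] assms by metis

lemma ladj_inj:
  assumes d: "dual p c" and "ok h" "ok k" "src h = src k" "tgt h = rob p \<otimes>\<^sub>o M" "tgt k = rob p \<otimes>\<^sub>o M" "M \<in> Obj C"
    "lact p M \<bullet> (ide (lob p) \<star> h) = lact p M \<bullet> (ide (lob p) \<star> k)"
  shows "h = k"
  using ladj_inv'[OF d, of h M "src h"] ladj_inv'[OF d, of k M "src h"] assms by metis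

lemma radj_ex:
  assumes d: "dual p c" and "ok \<phi>" "src \<phi> = W \<otimes>\<^sub>o rob p" "tgt \<phi> = M" "W \<in> Obj C"
  obtains h where "ok h" "src h = W" "tgt h = M \<otimes>\<^sub>o lob p" "ract p M \<bullet> (h \<star> ide (rob p)) = \<phi>"
  using radj_inv[OF d assms(2,3,5,4)] assms dual_simps[OF d] coact_ok[OF d]
  by (intro that[of "(\<phi> \<star> ide (lob p)) \<bullet> rcoact p c W"]) auto

lemma ladj_ex:
  assumes d: "dual p c" and "ok \<phi>" "src \<phi> = lob p \<otimes>\<^sub>o W" "tgt \<phi> = M" "W \<in> Obj C"
  obtains h where "ok h" "src h = W" "tgt h = rob p \<otimes>\<^sub>o M" "lact p M \<bullet> (ide (lob p) \<star> h) = \<phi>"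
  using ladj_inv[OF d assms(2,3,5,4)] assms dual_simps[OF d] coact_ok[OF d]
  by (intro that[of "(ide (rob p) \<star> \<phi>) \<bullet> lcoact p c W"]) auto

lemma dual_lperf:
  assumes d: "dual p c" shows "lperf p"
  unfolding lperf_def
proof (intro conjI ballI allI impI; (elim conjE)?)
  show p: "pr p" using d by (rule dual_simps)
  fix W \<phi> assume W: "W \<in> Obj C" "ok \<phi>" "src \<phi> = W \<otimes>\<^sub>o rob p" "tgt \<phi> = \<one>\<^sub>o"
  show "\<exists>h. ok h \<and> src h = W \<and> tgt h = lob p \<and> form p \<bullet> (h \<star> ide (rob p)) = \<phi>"
    using dual_transpose[OF d, of \<phi> W] W dual_simps[OF d] coact_ok[OF d]
    by (intro exI[of _ "lu (lob p) \<bullet> (\<phi> \<star> ide (lob p)) \<bullet> rcoact p c W"]) auto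
next
  fix h k assume hk: "ok h" "ok k" "src h = src k" "tgt h = lob p" "tgt k = lob p"
    "form p \<bullet> (h \<star> ide (rob p)) = form p \<bullet> (k \<star> ide (rob p))"
  have p: "pr p" using d by (rule dual_simps)
  have "ul (lob p) \<bullet> h = ul (lob p) \<bullet> k"
    by (rule radj_inj[OF d, where M="\<one>\<^sub>o"]) (use hk p in \<open>auto simp: ract_one_cmp\<close>)
  thus "h = k" by (rule cancel_left[where r="lu (lob p)"]) (use hk p in auto)
qed

lemma dual_rperf:
  assumes d: "dual p c" shows "rperf p"
  unfolding rperf_def
proof (intro conjI ballI allI impI; (elim conjE)?)
  show p: "pr p" using d by (rule dual_simps)
  fix W \<phi> assume W: "W \<in> Obj C" "ok \<phi>" "src \<phi> = lob p \<otimes>\<^sub>o W" "tgt \<phi> = \<one>\<^sub>o"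
  obtain h where "ok h" "src h = W" "tgt h = rob p \<otimes>\<^sub>o \<one>\<^sub>o" "lact p \<one>\<^sub>o \<bullet> (ide (lob p) \<star> h) = \<phi>"
    using ladj_ex[OF d] W by metis
  thus "\<exists>h. ok h \<and> src h = W \<and> tgt h = rob p \<and> form p \<bullet> (ide (lob p) \<star> h) = \<phi>"
    using p by (intro exI[of _ "ru (rob p) \<bullet> h"]) (auto simp: lact_one_cmp)
next
  fix h k assume hk: "ok h" "ok k" "src h = src k" "tgt h = rob p" "tgt k = rob p"
    "form p \<bullet> (ide (lob p) \<star> h) = form p \<bullet> (ide (lob p) \<star> k)"
  have p: "pr p" using d by (rule dual_simps)
  have "ur (rob p) \<bullet> h = ur (rob p) \<bullet> k"
    by (rule ladj_inj[OF d, where M="\<one>\<^sub>o"]) (use hk p in \<open>auto simp: lact_one_cmp\<close>)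
  thus "h = k" by (rule cancel_left[where r="ru (rob p)"]) (use hk p in auto)
qed

lemma form_star_ract:
  assumes "pr p" "pr q" "ok h" "tgt h = lob p \<otimes>\<^sub>o lob q"
  shows "form (p \<diamondop> q) \<bullet> (h \<star> ide (rob q \<otimes>\<^sub>o rob p)) =
     form p \<bullet> ((ract q (lob p) \<bullet> (h \<star> ide (rob q))) \<star> ide (rob p)) \<bullet> sa (src h) (rob q) (rob p)"
proof -
  have "form (p \<diamondop> q) \<bullet> (h \<star> ide (rob q \<otimes>\<^sub>o rob p)) =
     form p \<bullet> ((ide (lob p) \<star> lact q (rob p)) \<bullet> as (lob p) (lob q) (rob q \<otimes>\<^sub>o rob p)) \<bullet> (h \<star> (ide (rob q) \<star> ide (rob p)))"
    using assms by (simp add: form_star)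
  also have "\<dots> = form p \<bullet> (ract q (lob p) \<star> ide (rob p)) \<bullet> sa (lob p \<otimes>\<^sub>o lob q) (rob q) (rob p) \<bullet> (h \<star> (ide (rob q) \<star> ide (rob p)))"
    by (subst lact_ract) (use assms in auto)
  also have "\<dots> = form p \<bullet> (ract q (lob p) \<star> ide (rob p)) \<bullet> ((h \<star> ide (rob q)) \<star> ide (rob p)) \<bullet> sa (src h) (rob q) (rob p)"
    by (subst sa_nat) (use assms in auto)
  finally show ?thesis using assms by simp
qed

text \<open>The outer pairing need only be perfect, but the inner one has to be a dual pair: the proof represents
  morphisms \<open>W \<otimes> B' \<rightarrow> A\<close> by morphisms \<open>W \<rightarrow> A \<otimes> B\<close>.\<close>

lemma lperf_star:
  assumes p: "lperf p" and d: "dual q c"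
  shows "lperf (p \<diamondop> q)"
  unfolding lperf_def
proof (intro conjI ballI allI impI; (elim conjE)?)
  have [simp]: "pr p" "pr q" using p d by (auto simp: lperfD dual_simps)
  show "pr (p \<diamondop> q)" by simp
  fix W \<phi> assume W: "W \<in> Obj C" "ok \<phi>" "src \<phi> = W \<otimes>\<^sub>o rob (p \<diamondop> q)" "tgt \<phi> = \<one>\<^sub>o"
  obtain h where h: "ok h" "src h = W \<otimes>\<^sub>o rob q" "tgt h = lob p" "form p \<bullet> (h \<star> ide (rob p)) = \<phi> \<bullet> as W (rob q) (rob p)"
    using lperf_ex[OF p, of "\<phi> \<bullet> as W (rob q) (rob p)" "W \<otimes>\<^sub>o rob q"] W by auto
  obtain k where k: "ok k" "src k = W" "tgt k = lob p \<otimes>\<^sub>o lob q" "ract q (lob p) \<bullet> (k \<star> ide (rob q)) = h"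
    using radj_ex[OF d, of h W "lob p"] h W by auto
  have "form (p \<diamondop> q) \<bullet> (k \<star> ide (rob q \<otimes>\<^sub>o rob p)) = form p \<bullet> (h \<star> ide (rob p)) \<bullet> sa W (rob q) (rob p)"
    using form_star_ract[of p q k] k by simp
  also have "\<dots> = (\<phi> \<bullet> as W (rob q) (rob p)) \<bullet> sa W (rob q) (rob p)"
    by (subst cmp_reduce[OF h(4)]) (use W h in auto)
  finally show "\<exists>h. ok h \<and> src h = W \<and> tgt h = lob (p \<diamondop> q) \<and> form (p \<diamondop> q) \<bullet> (h \<star> ide (rob (p \<diamondop> q))) = \<phi>"
    using k W by (intro exI[of _ k]) auto
next
  have [simp]: "pr p" "pr q" using p d by (auto simp: lperfD dual_simps)
  fix h k assume hk: "ok h" "ok k" "src h = src k" "tgt h = lob (p \<diamondop> q)" "tgt k = lob (p \<diamondop> q)"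
    "form (p \<diamondop> q) \<bullet> (h \<star> ide (rob (p \<diamondop> q))) = form (p \<diamondop> q) \<bullet> (k \<star> ide (rob (p \<diamondop> q)))"
  show "h = k"
  proof (rule radj_inj[OF d, where M="lob p"])
    show "ract q (lob p) \<bullet> (h \<star> ide (rob q)) = ract q (lob p) \<bullet> (k \<star> ide (rob q))"
    proof (rule lperf_inj[OF p])
      show "form p \<bullet> ((ract q (lob p) \<bullet> (h \<star> ide (rob q))) \<star> ide (rob p)) = form p \<bullet> ((ract q (lob p) \<bullet> (k \<star> ide (rob q))) \<star> ide (rob p))"
        by (rule cancel_right[where e="sa (src h) (rob q) (rob p)" and s="as (src h) (rob q) (rob p)"])
          (use hk form_star_ract[of p q h] form_star_ract[of p q k] in auto)
    qed (use hk in auto)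
  qed (use hk in auto)
qed

lemma lperf_pb_inj:
  assumes "lperf p" "ok h" "ok k" "src h = src k" "tgt h = lob p" "tgt k = lob p" "pb p h (ide (rob p)) = pb p k (ide (rob p))"
  shows "h = k"
  by (rule lperf_inj) (use assms pb_form[OF assms(7)] in auto)

lemma lperf_pb_ex:
  assumes "lperf p" "pr q" "rob q = rob p"
  obtains h where "ok h" "src h = lob q" "tgt h = lob p" "pb p h (ide (rob p)) = q"
proof -
  obtain h where h: "ok h" "src h = lob q" "tgt h = lob p" "form p \<bullet> (h \<star> ide (rob p)) = form q"
    using lperf_ex[of p "form q" "lob q"] assms by auto
  have "pb p h (ide (rob p)) = q" by (rule pairing_eqI) (use h assms in auto)
  with h that show ?thesis by blast
qed

lemma rperf_pb_inj:
  assumes "rperf p" "ok h" "ok k" "src h = src k" "tgt h = rob p" "tgt k = rob p" "pb p (ide (lob p)) h = pb p (ide (lob p)) k"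
  shows "h = k"
  by (rule rperf_inj) (use assms pb_form[OF assms(7)] in auto)

lemma rperf_pb_ex:
  assumes "rperf p" "pr q" "lob q = lob p"
  obtains h where "ok h" "src h = rob q" "tgt h = rob p" "pb p (ide (lob p)) h = q"
proof -
  obtain h where h: "ok h" "src h = rob q" "tgt h = rob p" "form p \<bullet> (ide (lob p) \<star> h) = form q"
    using rperf_ex[of p "form q" "rob q"] assms by auto
  have "pb p (ide (lob p)) h = q" by (rule pairing_eqI) (use h assms in auto)
  with h that show ?thesis by blast
qed

lemma lperf_iso:
  assumes "lperf p" "lperf q" "rob p = rob q"
  obtains \<phi> \<psi> where "ok \<phi>" "ok \<psi>" "src \<phi> = lob q" "tgt \<phi> = lob p" "src \<psi> = lob p" "tgt \<psi> = lob q"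
    "pb p \<phi> (ide (rob p)) = q" "pb q \<psi> (ide (rob q)) = p" "\<phi> \<bullet> \<psi> = ide (lob p)" "\<psi> \<bullet> \<phi> = ide (lob q)"
proof -
  have [simp]: "pr p" "pr q" using assms by (auto simp: lperfD)
  obtain \<phi> where p: "ok \<phi>" "src \<phi> = lob q" "tgt \<phi> = lob p" "pb p \<phi> (ide (rob p)) = q"
    using lperf_pb_ex[of p q] assms by auto
  obtain \<psi> where q: "ok \<psi>" "src \<psi> = lob p" "tgt \<psi> = lob q" "pb q \<psi> (ide (rob q)) = p"
    using lperf_pb_ex[of q p] assms by auto
  have "pb p (\<phi> \<bullet> \<psi>) (ide (rob p)) = pb (pb p \<phi> (ide (rob p))) \<psi> (ide (rob q))"
    using p q assms(3) by (subst pb_pb) auto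
  also have "\<dots> = p" unfolding p(4) q(4) ..
  also have "p = pb p (ide (lob p)) (ide (rob p))" by (rule pb_ide[symmetric]) simp
  finally have 1: "\<phi> \<bullet> \<psi> = ide (lob p)"
    by (rule lperf_pb_inj[OF assms(1), rotated -1]) (use p(1-3) q(1-3) in auto)
  have "pb q (\<psi> \<bullet> \<phi>) (ide (rob q)) = pb (pb q \<psi> (ide (rob q))) \<phi> (ide (rob p))"
    using p q assms(3) by (subst pb_pb) auto
  also have "\<dots> = q" unfolding p(4) q(4) ..
  also have "q = pb q (ide (lob q)) (ide (rob q))" by (rule pb_ide[symmetric]) simp
  finally have 2: "\<psi> \<bullet> \<phi> = ide (lob q)"
    by (rule lperf_pb_inj[OF assms(2), rotated -1]) (use p(1-3) q(1-3) in auto)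
  show ?thesis using that p q 1 2 by blast
qed

end

section \<open>Dual morphisms and the canonical isomorphisms\<close>

context finite_tensor_category
begin

text \<open>The evaluation as a pairing, and the coevaluation, of the chosen left duals.\<close>

definition evp :: "'o \<Rightarrow> ('o, 'm) pairing" where
  "evp X = Pairing (X\<^sup>\<or>) X (Arr (X\<^sup>\<or> \<otimes>\<^sub>o X) (Ev C X) \<one>\<^sub>o)"

definition coev :: "'o \<Rightarrow> ('o, 'm) arrow" where
  "coev X = Arr \<one>\<^sub>o (Coev C X) (X \<otimes>\<^sub>o X\<^sup>\<or>)"

lemma evp_simps [simp]: "lob (evp X) = X\<^sup>\<or>" "rob (evp X) = X" "src (form (evp X)) = X\<^sup>\<or> \<otimes>\<^sub>o X"
  "tgt (form (evp X)) = \<one>\<^sub>o" "src (coev X) = \<one>\<^sub>o" "tgt (coev X) = X \<otimes>\<^sub>o X\<^sup>\<or>"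
  by (simp_all add: evp_def coev_def)

lemma is_left_dual_dual:
  assumes "is_left_dual C X' X e c" "X \<in> Obj C" "X' \<in> Obj C"
  shows "dual (Pairing X' X (Arr (X' \<otimes>\<^sub>o X) e \<one>\<^sub>o)) (Arr \<one>\<^sub>o c (X \<otimes>\<^sub>o X'))"
  unfolding dual_def pr_def ok_def
  using assms by (auto simp: is_left_dual_def raw_simps intro!: arrow_eqI)

lemma dual_evp: "X \<in> Obj C \<Longrightarrow> dual (evp X) (coev X)"
  unfolding evp_def coev_def by (rule is_left_dual_dual) (auto simp: left_dual)

lemma right_dual_pairing:
  assumes "X \<in> Obj C"
  obtains p c where "dual p c" "lob p = X"
proof -
  obtain Y e c where "Y \<in> Obj C" "is_left_dual C X Y e c" using right_dual[OF assms] by blast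
  from is_left_dual_dual[OF this(2,1) assms] that show ?thesis by fastforce
qed

lemma pr_evp [simp]: "X \<in> Obj C \<Longrightarrow> pr (evp X)"
  by (rule dual_simps[OF dual_evp])

lemma ok_coev [simp]: "X \<in> Obj C \<Longrightarrow> ok (coev X)"
  by (rule dual_simps[OF dual_evp])

lemma lperf_evp: "X \<in> Obj C \<Longrightarrow> lperf (evp X)"
  by (rule dual_lperf[OF dual_evp])

lemma rperf_evp: "X \<in> Obj C \<Longrightarrow> rperf (evp X)"
  by (rule dual_rperf[OF dual_evp])

text \<open>The morphism into \<open>B\<^sup>\<or>\<close> that represents a pairing of \<open>A\<close> with \<open>B\<close>.\<close>

definition tp :: "'o \<Rightarrow> 'o \<Rightarrow> ('o, 'm) arrow \<Rightarrow> ('o, 'm) arrow" where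
  "tp A B \<phi> = lu (B\<^sup>\<or>) \<bullet> (\<phi> \<star> ide (B\<^sup>\<or>)) \<bullet> rcoact (evp B) (coev B) A"

lemma raw_tp: "raw (tp A B \<phi>) = transpose_pairing C A B (raw \<phi>)"
  by (simp add: tp_def transpose_pairing_def rcoact_def raw_simps coev_def)

lemma tp_src_tgt [simp]: "src (tp A B \<phi>) = A" "tgt (tp A B \<phi>) = B\<^sup>\<or>"
  by (simp_all add: tp_def)

lemma tp_prop:
  assumes "pr q" "rob q = B" "lob q = A"
  shows "ok (tp A B (form q))" "pb (evp B) (tp A B (form q)) (ide B) = q"
proof -
  have B: "B \<in> Obj C" "A \<in> Obj C" using assms by auto
  show ok: "ok (tp A B (form q))"
    using assms B coact_ok[OF dual_evp[OF B(1)]] by (auto simp: tp_def)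
  show "pb (evp B) (tp A B (form q)) (ide B) = q"
    by (rule pairing_eqI) (use dual_transpose[OF dual_evp[OF B(1)], of "form q" A] assms B in \<open>auto simp: tp_def\<close>)
qed

text \<open>The dual morphism; it is characterised by sliding through the evaluation (\<open>dm_slide\<close>).\<close>

definition dm :: "('o, 'm) arrow \<Rightarrow> ('o, 'm) arrow" where
  "dm f = Arr ((tgt f)\<^sup>\<or>) (dual_mor C (raw f)) ((src f)\<^sup>\<or>)"

lemma dm_src_tgt [simp]: "src (dm f) = (tgt f)\<^sup>\<or>" "tgt (dm f) = (src f)\<^sup>\<or>"
  by (simp_all add: dm_def)

lemma dm_eq_tp:
  assumes "ok f"
  shows "dm f = tp ((tgt f)\<^sup>\<or>) (src f) (form (pb (evp (tgt f)) (ide ((tgt f)\<^sup>\<or>)) f))"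
proof -
  have "Dom C (raw f) = src f" "Cod C (raw f) = tgt f"
    using assms dom_cod[of "src f" "tgt f" "raw f"] unfolding ok_def by auto
  thus ?thesis
    by (auto intro!: arrow_eqI simp: dm_def dual_mor_def raw_tp raw_simps evp_def)
qed

lemma ok_dm [simp]: "ok f \<Longrightarrow> ok (dm f)"
  using tp_prop(1)[of "pb (evp (tgt f)) (ide ((tgt f)\<^sup>\<or>)) f" "src f" "(tgt f)\<^sup>\<or>"] by (simp add: dm_eq_tp)

lemma dm_slide: "ok f \<Longrightarrow> src f = X \<Longrightarrow> tgt f = Y \<Longrightarrow> pb (evp X) (dm f) (ide X) = pb (evp Y) (ide (Y\<^sup>\<or>)) f"
  using tp_prop(2)[of "pb (evp Y) (ide (Y\<^sup>\<or>)) f" X "Y\<^sup>\<or>"] by (auto simp: dm_eq_tp)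

lemma dm_ide [simp]: "X \<in> Obj C \<Longrightarrow> dm (ide X) = ide (X\<^sup>\<or>)"
  by (rule lperf_pb_inj[OF lperf_evp[of X]]) (auto simp: dm_slide)

lemma dm_cmp:
  assumes "ok f" "ok g" "tgt f = src g"
  shows "dm (g \<bullet> f) = dm f \<bullet> dm g"
proof (rule lperf_pb_inj[OF lperf_evp[of "src f"]])
  have "pb (evp (src f)) (dm f \<bullet> dm g) (ide (src f)) = pb (pb (evp (src f)) (dm f) (ide (src f))) (dm g) (ide (src f))"
    using assms by simp
  also have "\<dots> = pb (pb (evp (tgt f)) (ide ((tgt f)\<^sup>\<or>)) f) (dm g) (ide (src f))"
    by (subst dm_slide[of f "src f" "tgt f"]) (use assms in auto)
  also have "\<dots> = pb (pb (evp (src g)) (dm g) (ide (src g))) (ide ((tgt g)\<^sup>\<or>)) f"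
    using assms by simp
  also have "\<dots> = pb (pb (evp (tgt g)) (ide ((tgt g)\<^sup>\<or>)) g) (ide ((tgt g)\<^sup>\<or>)) f"
    by (subst dm_slide[of g "src g" "tgt g"]) (use assms in auto)
  also have "\<dots> = pb (evp (src f)) (dm (g \<bullet> f)) (ide (src f))"
    by (subst dm_slide[of _ "src f" "tgt g"]) (use assms in auto)
  finally show "pb (evp (src f)) (dm (g \<bullet> f)) (ide (rob (evp (src f)))) =
    pb (evp (src f)) (dm f \<bullet> dm g) (ide (rob (evp (src f))))" by simp
qed (use assms in auto)

lemma dm_full:
  assumes "X \<in> Obj C" "Y \<in> Obj C" "ok g" "src g = Y\<^sup>\<or>" "tgt g = X\<^sup>\<or>"
  obtains f where "ok f" "src f = X" "tgt f = Y" "dm f = g"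
proof -
  obtain f where f: "ok f" "src f = X" "tgt f = Y" "pb (evp Y) (ide (Y\<^sup>\<or>)) f = pb (evp X) g (ide X)"
    using rperf_pb_ex[OF rperf_evp[OF assms(2)], of "pb (evp X) g (ide X)"] assms by auto
  have "dm f = g"
    by (rule lperf_pb_inj[OF lperf_evp[of X]]) (use f assms in \<open>auto simp: dm_slide\<close>)
  with f that show ?thesis by blast
qed

text \<open>The canonical isomorphism \<open>V\<^sup>\<or> \<otimes> W\<^sup>\<or> \<rightarrow> (W \<otimes> V)\<^sup>\<or>\<close>, by which the evaluation of \<open>W \<otimes> V\<close>
  becomes the nested evaluation (\<open>pb_gam\<close>), and its inverse.\<close>

definition gam :: "'o \<Rightarrow> 'o \<Rightarrow> ('o, 'm) arrow" where
  "gam V W = tp (V\<^sup>\<or> \<otimes>\<^sub>o W\<^sup>\<or>) (W \<otimes>\<^sub>o V) (form (evp V \<diamondop> evp W))"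

definition igam :: "'o \<Rightarrow> 'o \<Rightarrow> ('o, 'm) arrow" where
  "igam V W = inv_of (gam V W)"

lemma raw_gam: "raw (gam V W) = dual_tensor C V W"
  by (simp add: gam_def raw_tp dual_tensor_def form_star lact_def raw_simps evp_def)

lemma gam_src_tgt [simp]: "src (gam V W) = V\<^sup>\<or> \<otimes>\<^sub>o W\<^sup>\<or>" "tgt (gam V W) = (W \<otimes>\<^sub>o V)\<^sup>\<or>"
  "src (igam V W) = (W \<otimes>\<^sub>o V)\<^sup>\<or>" "tgt (igam V W) = V\<^sup>\<or> \<otimes>\<^sub>o W\<^sup>\<or>"
  by (simp_all add: gam_def igam_def inv_of_def)

lemma ok_gam [simp]: "V \<in> Obj C \<Longrightarrow> W \<in> Obj C \<Longrightarrow> ok (gam V W)"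
  unfolding gam_def by (rule tp_prop) auto

lemma pb_gam: "V \<in> Obj C \<Longrightarrow> W \<in> Obj C \<Longrightarrow> pb (evp (W \<otimes>\<^sub>o V)) (gam V W) (ide (W \<otimes>\<^sub>o V)) = evp V \<diamondop> evp W"
  unfolding gam_def by (rule tp_prop) auto

lemma inv_of_eq:
  assumes "ok f" "ok g" "src g = tgt f" "tgt g = src f" "g \<bullet> f = ide (src f)" "f \<bullet> g = ide (tgt f)"
  shows "inv_of f = g"
proof -
  have "iso_arr C (src f) (tgt f) (raw f)"
    unfolding iso_arr_def using assms(1-4) arg_cong[OF assms(5), of raw] arg_cong[OF assms(6), of raw]
    by (auto simp: ok_def raw_simps simp del: ok_obj)
  note i = inverse_arr_props[OF this ok_obj(1)[OF assms(1)] ok_obj(2)[OF assms(1)]]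
  have o: "ok (inv_of f)" using i(1) assms(1) by (simp add: inv_of_def ok_def del: ok_obj)
  have [simp]: "src (inv_of f) = tgt f" "tgt (inv_of f) = src f" by (auto simp: inv_of_def)
  have l: "inv_of f \<bullet> f = ide (src f)" by (rule arrow_eqI) (auto simp: raw_simps i inv_of_def)
  have "inv_of f = inv_of f \<bullet> (f \<bullet> g)" using assms o by simp
  also have "\<dots> = ide (src f) \<bullet> g" by (rule cmp_reduce[OF l]) (use assms o in auto)
  finally show ?thesis using assms by simp
qed

lemma gam_inv:
  assumes "V \<in> Obj C" "W \<in> Obj C"
  shows "ok (igam V W)" "gam V W \<bullet> igam V W = ide ((W \<otimes>\<^sub>o V)\<^sup>\<or>)" "igam V W \<bullet> gam V W = ide (V\<^sup>\<or> \<otimes>\<^sub>o W\<^sup>\<or>)"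
proof -
  have l: "lperf (evp (W \<otimes>\<^sub>o V))" using assms by (intro lperf_evp) auto
  have l': "lperf (evp V \<diamondop> evp W)" using assms by (intro lperf_star[OF _ dual_evp] lperf_evp) auto
  obtain f g where fg: "ok f" "ok g" "src f = V\<^sup>\<or> \<otimes>\<^sub>o W\<^sup>\<or>" "tgt f = (W \<otimes>\<^sub>o V)\<^sup>\<or>" "src g = (W \<otimes>\<^sub>o V)\<^sup>\<or>" "tgt g = V\<^sup>\<or> \<otimes>\<^sub>o W\<^sup>\<or>"
    "pb (evp (W \<otimes>\<^sub>o V)) f (ide (W \<otimes>\<^sub>o V)) = evp V \<diamondop> evp W" "f \<bullet> g = ide ((W \<otimes>\<^sub>o V)\<^sup>\<or>)" "g \<bullet> f = ide (V\<^sup>\<or> \<otimes>\<^sub>o W\<^sup>\<or>)"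
    by (rule lperf_iso[OF l l', unfolded evp_simps star_simps, OF refl])
  have f: "f = gam V W"
    by (rule lperf_pb_inj[OF l]) (use fg assms in \<open>auto simp: pb_gam\<close>)
  have "igam V W = g" unfolding igam_def by (rule inv_of_eq) (use fg assms in \<open>auto simp: f\<close>)
  thus "ok (igam V W)" "gam V W \<bullet> igam V W = ide ((W \<otimes>\<^sub>o V)\<^sup>\<or>)" "igam V W \<bullet> gam V W = ide (V\<^sup>\<or> \<otimes>\<^sub>o W\<^sup>\<or>)"
    using fg f by auto
qed

declare gam_inv [simp]

lemma gam_nat:
  assumes "ok f" "ok g" "src f = V" "tgt f = V'" "src g = W" "tgt g = W'"
  shows "gam V W \<bullet> (dm f \<star> dm g) = dm (g \<star> f) \<bullet> gam V' W'"
proof (rule lperf_pb_inj[OF lperf_evp[of "W \<otimes>\<^sub>o V"]])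
  have VW: "V \<in> Obj C" "W \<in> Obj C" "V' \<in> Obj C" "W' \<in> Obj C" using assms by auto
  have "pb (evp (W \<otimes>\<^sub>o V)) (gam V W \<bullet> (dm f \<star> dm g)) (ide (W \<otimes>\<^sub>o V)) = pb (evp V \<diamondop> evp W) (dm f \<star> dm g) (ide W \<star> ide V)"
    using assms VW by (simp add: pb_gam[symmetric])
  also have "\<dots> = pb (evp V) (dm f) (ide V) \<diamondop> pb (evp W) (dm g) (ide W)"
    by (rule star_pb[symmetric]) (use assms VW in auto)
  also have "\<dots> = pb (evp V') (ide (V'\<^sup>\<or>)) f \<diamondop> pb (evp W') (ide (W'\<^sup>\<or>)) g"
    using assms by (simp add: dm_slide)
  also have "\<dots> = pb (evp V' \<diamondop> evp W') (ide (V'\<^sup>\<or>) \<star> ide (W'\<^sup>\<or>)) (g \<star> f)"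
    by (rule star_pb) (use assms VW in auto)
  also have "\<dots> = pb (pb (evp (W' \<otimes>\<^sub>o V')) (ide ((W' \<otimes>\<^sub>o V')\<^sup>\<or>)) (g \<star> f)) (gam V' W') (ide (W \<otimes>\<^sub>o V))"
    using assms VW by (simp add: pb_gam[symmetric])
  also have "pb (evp (W' \<otimes>\<^sub>o V')) (ide ((W' \<otimes>\<^sub>o V')\<^sup>\<or>)) (g \<star> f) = pb (evp (W \<otimes>\<^sub>o V)) (dm (g \<star> f)) (ide (W \<otimes>\<^sub>o V))"
    by (rule dm_slide[symmetric]) (use assms in auto)
  also have "pb (pb (evp (W \<otimes>\<^sub>o V)) (dm (g \<star> f)) (ide (W \<otimes>\<^sub>o V))) (gam V' W') (ide (W \<otimes>\<^sub>o V)) =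
    pb (evp (W \<otimes>\<^sub>o V)) (dm (g \<star> f) \<bullet> gam V' W') (ide (W \<otimes>\<^sub>o V))"
    using assms VW by (subst pb_pb) auto
  finally show "pb (evp (W \<otimes>\<^sub>o V)) (gam V W \<bullet> (dm f \<star> dm g)) (ide (rob (evp (W \<otimes>\<^sub>o V)))) =
    pb (evp (W \<otimes>\<^sub>o V)) (dm (g \<star> f) \<bullet> gam V' W') (ide (rob (evp (W \<otimes>\<^sub>o V))))" by simp
qed (use assms in auto)

lemma igam_nat:
  assumes "ok f" "ok g" "src f = V" "tgt f = V'" "src g = W" "tgt g = W'"
  shows "igam V W \<bullet> dm (g \<star> f) = (dm f \<star> dm g) \<bullet> igam V' W'"
proof (rule cancel_left[where m="gam V W" and r="igam V W"])
  have VW: "V \<in> Obj C" "W \<in> Obj C" "V' \<in> Obj C" "W' \<in> Obj C" using assms by auto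
  have "gam V W \<bullet> (dm f \<star> dm g) \<bullet> igam V' W' = dm (g \<star> f) \<bullet> gam V' W' \<bullet> igam V' W'"
    by (subst cmp_reduce[OF gam_nat[OF assms]]) (use assms VW in auto)
  also have "\<dots> = dm (g \<star> f)" using assms VW by simp
  also have "\<dots> = gam V W \<bullet> igam V W \<bullet> dm (g \<star> f)"
    by (subst cmp_reduce[OF gam_inv(2)]) (use assms VW in auto)
  finally show "gam V W \<bullet> igam V W \<bullet> dm (g \<star> f) = gam V W \<bullet> (dm f \<star> dm g) \<bullet> igam V' W'" by simp
qed (use assms in auto)

text \<open>The nested pairing of \<open>(X\<^sup>\<or> \<otimes> P) \<otimes> Y\<^sup>\<or>\<^sup>\<or>\<close> with \<open>Y\<^sup>\<or> \<otimes> (Q \<otimes> X)\<close> induced by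
  \<open>q : P \<otimes> Q \<rightarrow> \<one>\<close>. Keeping \<open>X\<close> and \<open>Y\<close> apart allows dinaturality to be treated one variable at a time.\<close>

definition npair :: "'o \<Rightarrow> ('o, 'm) pairing \<Rightarrow> 'o \<Rightarrow> ('o, 'm) pairing" where
  "npair X q Y = (evp X \<diamondop> q) \<diamondop> evp (Y\<^sup>\<or>)"

lemma npair_simps [simp]:
  "lob (npair X q Y) = (X\<^sup>\<or> \<otimes>\<^sub>o lob q) \<otimes>\<^sub>o (Y\<^sup>\<or>)\<^sup>\<or>" "rob (npair X q Y) = Y\<^sup>\<or> \<otimes>\<^sub>o (rob q \<otimes>\<^sub>o X)"
  by (simp_all add: npair_def)

lemma pr_npair [simp]: "X \<in> Obj C \<Longrightarrow> Y \<in> Obj C \<Longrightarrow> pr q \<Longrightarrow> pr (npair X q Y)"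
  by (simp add: npair_def)

lemma lperf_npair: "dual q c \<Longrightarrow> X \<in> Obj C \<Longrightarrow> Y \<in> Obj C \<Longrightarrow> lperf (npair X q Y)"
  unfolding npair_def by (intro lperf_star[OF _ dual_evp] lperf_star[OF lperf_evp]) auto

lemma npair_pb:
  assumes "pr q" "ok h" "ok k" "tgt h = lob q" "tgt k = rob q" "X \<in> Obj C" "Y \<in> Obj C"
  shows "npair X (pb q h k) Y = pb (npair X q Y) ((ide (X\<^sup>\<or>) \<star> h) \<star> ide ((Y\<^sup>\<or>)\<^sup>\<or>)) (ide (Y\<^sup>\<or>) \<star> (k \<star> ide X))"
  unfolding npair_def
  using assms by (simp add: star_pb_right star_pb_left)

lemma npair_slide_left:
  assumes "pr q" "ok f" "src f = X" "tgt f = X'" "Y \<in> Obj C"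
  shows "pb (npair X q Y) ((dm f \<star> ide (lob q)) \<star> ide ((Y\<^sup>\<or>)\<^sup>\<or>)) (ide (Y\<^sup>\<or> \<otimes>\<^sub>o (rob q \<otimes>\<^sub>o X))) =
    pb (npair X' q Y) (ide ((X'\<^sup>\<or> \<otimes>\<^sub>o lob q) \<otimes>\<^sub>o (Y\<^sup>\<or>)\<^sup>\<or>)) (ide (Y\<^sup>\<or>) \<star> (ide (rob q) \<star> f))"
proof -
  have X: "X \<in> Obj C" "X' \<in> Obj C" using assms by auto
  have "(pb (evp X) (dm f) (ide X) \<diamondop> q) \<diamondop> evp (Y\<^sup>\<or>) = (pb (evp X') (ide (X'\<^sup>\<or>)) f \<diamondop> q) \<diamondop> evp (Y\<^sup>\<or>)"
    using assms by (simp add: dm_slide)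
  thus ?thesis using assms X by (simp add: star_pb_left npair_def)
qed

lemma npair_slide_right:
  assumes "pr q" "ok f" "src f = Y" "tgt f = Y'" "X \<in> Obj C"
  shows "pb (npair X q Y) (ide ((X\<^sup>\<or> \<otimes>\<^sub>o lob q) \<otimes>\<^sub>o (Y\<^sup>\<or>)\<^sup>\<or>)) (dm f \<star> ide (rob q \<otimes>\<^sub>o X)) =
    pb (npair X q Y') (ide (X\<^sup>\<or> \<otimes>\<^sub>o lob q) \<star> dm (dm f)) (ide (Y'\<^sup>\<or> \<otimes>\<^sub>o (rob q \<otimes>\<^sub>o X)))"
proof -
  have X: "Y \<in> Obj C" "Y' \<in> Obj C" using assms by auto
  have "(evp X \<diamondop> q) \<diamondop> pb (evp (Y\<^sup>\<or>)) (ide ((Y\<^sup>\<or>)\<^sup>\<or>)) (dm f) = (evp X \<diamondop> q) \<diamondop> pb (evp (Y'\<^sup>\<or>)) (dm (dm f)) (ide (Y'\<^sup>\<or>))"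
    using assms by (simp add: dm_slide)
  thus ?thesis using assms X by (simp add: star_pb_right npair_def)
qed

end

section \<open>The coends and ends\<close>

context finite_tensor_category
begin

text \<open>A jointly epic family of morphisms to \<open>W\<close>.\<close>

definition jointly_epic :: "'o \<Rightarrow> ('o, 'm) arrow set \<Rightarrow> bool" where
  "jointly_epic W F \<longleftrightarrow> W \<in> Obj C \<and> (\<forall>e\<in>F. ok e \<and> tgt e = W) \<and>
    (\<forall>u v. ok u \<and> ok v \<and> src u = W \<and> src v = W \<and> tgt u = tgt v \<and> (\<forall>e\<in>F. u \<bullet> e = v \<bullet> e) \<longrightarrow> u = v)"

lemma jointly_epicD:
  assumes "jointly_epic W F" "ok u" "ok v" "src u = W" "src v = W" "tgt u = tgt v" "\<And>e. e \<in> F \<Longrightarrow> u \<bullet> e = v \<bullet> e"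
  shows "u = v"
  using assms unfolding jointly_epic_def by blast

lemma jointly_epic_ok:
  assumes "jointly_epic W F"
  shows "W \<in> Obj C" "e \<in> F \<Longrightarrow> ok e" "e \<in> F \<Longrightarrow> tgt e = W"
  using assms unfolding jointly_epic_def by auto

text \<open>Tensoring with an object on either side has a right adjoint, hence preserves jointly epic families. On
  the left this uses a right dual of \<open>L\<close>, on the right the left dual.\<close>

lemma jointly_epic_ten_left:
  assumes j: "jointly_epic W F" and L: "L \<in> Obj C"
  shows "jointly_epic (L \<otimes>\<^sub>o W) ((\<lambda>e. ide L \<star> e) ` F)"
proof -
  obtain p c where d: "dual p c" and p: "lob p = L" using right_dual_pairing[OF L] .
  have [simp]: "pr p" using dual_simps[OF d] by simp
  note [simp] = jointly_epic_ok[OF j] L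
  have "u = v" if uv: "ok u" "ok v" "src u = L \<otimes>\<^sub>o W" "src v = L \<otimes>\<^sub>o W" "tgt u = tgt v"
    "\<And>e. e \<in> F \<Longrightarrow> u \<bullet> (ide L \<star> e) = v \<bullet> (ide L \<star> e)" for u v
  proof -
    obtain u' where u': "ok u'" "src u' = W" "tgt u' = rob p \<otimes>\<^sub>o tgt u" "lact p (tgt u) \<bullet> (ide (lob p) \<star> u') = u"
      using ladj_ex[OF d, of u W] uv p by auto
    obtain v' where v': "ok v'" "src v' = W" "tgt v' = rob p \<otimes>\<^sub>o tgt u" "lact p (tgt u) \<bullet> (ide (lob p) \<star> v') = v"
      using ladj_ex[OF d, of v W] uv p by auto
    have "u' = v'"
    proof (rule jointly_epicD[OF j])
      fix e assume e: "e \<in> F"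
      have "lact p (tgt u) \<bullet> (ide (lob p) \<star> (u' \<bullet> e)) = (lact p (tgt u) \<bullet> (ide (lob p) \<star> u')) \<bullet> (ide L \<star> e)"
        using u'(1-3) e uv p by auto
      note ue = this[unfolded u'(4)]
      have "lact p (tgt u) \<bullet> (ide (lob p) \<star> (v' \<bullet> e)) = (lact p (tgt u) \<bullet> (ide (lob p) \<star> v')) \<bullet> (ide L \<star> e)"
        using v'(1-3) e uv p by auto
      note ve = this[unfolded v'(4)]
      show "u' \<bullet> e = v' \<bullet> e"
        by (rule ladj_inj[OF d, where M="tgt u"]) (use ue ve u' v' e uv in auto)
    qed (use u' v' uv in auto)
    thus "u = v" using u'(4) v'(4) by simp
  qed
  thus ?thesis unfolding jointly_epic_def by auto
qed

lemma jointly_epic_ten_right: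
  assumes j: "jointly_epic W F" and L: "L \<in> Obj C"
  shows "jointly_epic (W \<otimes>\<^sub>o L) ((\<lambda>e. e \<star> ide L) ` F)"
proof -
  have d: "dual (evp L) (coev L)" using dual_evp[OF L] .
  note [simp] = jointly_epic_ok[OF j] L
  have "u = v" if uv: "ok u" "ok v" "src u = W \<otimes>\<^sub>o L" "src v = W \<otimes>\<^sub>o L" "tgt u = tgt v"
    "\<And>e. e \<in> F \<Longrightarrow> u \<bullet> (e \<star> ide L) = v \<bullet> (e \<star> ide L)" for u v
  proof -
    obtain u' where u': "ok u'" "src u' = W" "tgt u' = tgt u \<otimes>\<^sub>o L\<^sup>\<or>" "ract (evp L) (tgt u) \<bullet> (u' \<star> ide L) = u"
      using radj_ex[OF d, of u W] uv by auto
    obtain v' where v': "ok v'" "src v' = W" "tgt v' = tgt u \<otimes>\<^sub>o L\<^sup>\<or>" "ract (evp L) (tgt u) \<bullet> (v' \<star> ide L) = v"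
      using radj_ex[OF d, of v W] uv by auto
    have "u' = v'"
    proof (rule jointly_epicD[OF j])
      fix e assume e: "e \<in> F"
      have "ract (evp L) (tgt u) \<bullet> ((u' \<bullet> e) \<star> ide L) = (ract (evp L) (tgt u) \<bullet> (u' \<star> ide L)) \<bullet> (e \<star> ide L)"
        using u'(1-3) e uv by auto
      note ue = this[unfolded u'(4)]
      have "ract (evp L) (tgt u) \<bullet> ((v' \<bullet> e) \<star> ide L) = (ract (evp L) (tgt u) \<bullet> (v' \<star> ide L)) \<bullet> (e \<star> ide L)"
        using v'(1-3) e uv by auto
      note ve = this[unfolded v'(4)]
      show "u' \<bullet> e = v' \<bullet> e"
        by (rule radj_inj[OF d, where M="tgt u"]) (use ue ve u' v' e uv in auto)
    qed (use u' v' uv in auto)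
    thus "u = v" using u'(4) v'(4) by simp
  qed
  thus ?thesis unfolding jointly_epic_def by auto
qed

text \<open>Every object is isomorphic to a left dual.\<close>

lemma dual_cover:
  assumes "Y \<in> Obj C"
  obtains R \<phi> \<psi> where "R \<in> Obj C" "ok \<phi>" "ok \<psi>" "src \<phi> = R\<^sup>\<or>" "tgt \<phi> = Y" "src \<psi> = Y" "tgt \<psi> = R\<^sup>\<or>"
    "\<phi> \<bullet> \<psi> = ide Y" "\<psi> \<bullet> \<phi> = ide (R\<^sup>\<or>)"
proof -
  obtain p c where d: "dual p c" and p: "lob p = Y" using right_dual_pairing[OF assms] .
  have r: "rob p \<in> Obj C" using dual_simps[OF d] by simp
  show ?thesis
    by (rule lperf_iso[OF dual_lperf[OF d] lperf_evp[OF r], unfolded evp_simps, OF refl]) (rule that; use r p in simp)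
qed

end

locale coend_end_data = finite_tensor_category K C
  for K :: "('k, 'r) ring_scheme" and C :: "('k, 'o, 'm, 'c) tensor_cat_scheme" (structure) +
  fixes A Z :: "'o \<Rightarrow> 'o" and \<iota> \<pi> :: "'o \<Rightarrow> 'o \<Rightarrow> 'm"
  assumes A2: "is_A2 C A \<iota>" and Z4: "is_Z4 C Z \<pi>"
begin

text \<open>The universal dinatural transformations of the coends and of the ends.\<close>

definition io :: "'o \<Rightarrow> 'o \<Rightarrow> ('o, 'm) arrow" where
  "io V X = Arr (X\<^sup>\<or> \<otimes>\<^sub>o (V \<otimes>\<^sub>o X)) (\<iota> V X) (A V)"

definition pj :: "'o \<Rightarrow> 'o \<Rightarrow> ('o, 'm) arrow" where
  "pj V X = Arr (Z V) (\<pi> V X) ((X \<otimes>\<^sub>o V) \<otimes>\<^sub>o X\<^sup>\<or>)"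

lemma io_pj_src_tgt [simp]:
  "src (io V X) = X\<^sup>\<or> \<otimes>\<^sub>o (V \<otimes>\<^sub>o X)" "tgt (io V X) = A V" "src (pj V X) = Z V" "tgt (pj V X) = (X \<otimes>\<^sub>o V) \<otimes>\<^sub>o X\<^sup>\<or>"
  by (simp_all add: io_def pj_def)

lemma raw_io_pj: "raw (io V X) = \<iota> V X" "raw (pj V X) = \<pi> V X"
  by (simp_all add: io_def pj_def)

lemma A_coend: "V \<in> Obj C \<Longrightarrow> is_coend C (\<lambda>X Y. X\<^sup>\<or> \<otimes>\<^sub>o (V \<otimes>\<^sub>o Y)) (\<lambda>f g. dual_mor C f \<otimes>\<^sub>m (\<i>\<d> V \<otimes>\<^sub>m g)) (A V) (\<iota> V)"
  using A2 by (simp add: is_A2_def)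

lemma Z_end: "V \<in> Obj C \<Longrightarrow> is_end C (\<lambda>X Y. (Y \<otimes>\<^sub>o V) \<otimes>\<^sub>o X\<^sup>\<or>) (\<lambda>f g. (g \<otimes>\<^sub>m \<i>\<d> V) \<otimes>\<^sub>m dual_mor C f) (Z V) (\<pi> V)"
  using Z4 by (simp add: is_Z4_def)

lemma AZ_obj [simp]: "V \<in> Obj C \<Longrightarrow> A V \<in> Obj C" "V \<in> Obj C \<Longrightarrow> Z V \<in> Obj C"
  using A_coend[of V] Z_end[of V] unfolding is_coend_def is_end_def by auto

lemma ok_io [simp]: "V \<in> Obj C \<Longrightarrow> X \<in> Obj C \<Longrightarrow> ok (io V X)"
  using A_coend[of V] unfolding is_coend_def dinatural_to_def ok_def by (auto simp: raw_io_pj)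

lemma ok_pj [simp]: "V \<in> Obj C \<Longrightarrow> X \<in> Obj C \<Longrightarrow> ok (pj V X)"
  using Z_end[of V] unfolding is_end_def dinatural_from_def ok_def by (auto simp: raw_io_pj)

lemma dual_mor_raw: "dual_mor C (raw f) = raw (dm f)"
  by (simp add: dm_def)

lemma dual_mor_ide: "X \<in> Obj C \<Longrightarrow> dual_mor C (\<i>\<d> X) = \<i>\<d> (X\<^sup>\<or>)"
  using arg_cong[OF dm_ide[of X], of raw] by (simp add: dm_def raw_simps)

lemma ok_raw: "ok f \<Longrightarrow> raw f \<in> homset C (src f) (tgt f)"
  by (simp add: ok_def del: ok_obj)

lemma io_dinat:
  assumes V: "V \<in> Obj C" and f: "ok f" "src f = X" "tgt f = Y"
  shows "io V X \<bullet> (dm f \<star> ide (V \<otimes>\<^sub>o X)) = io V Y \<bullet> (ide (Y\<^sup>\<or>) \<star> (ide V \<star> f))"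
proof -
  have X: "X \<in> Obj C" "Y \<in> Obj C" "raw f \<in> homset C X Y" using f ok_raw by auto
  have "\<iota> V X \<cdot> (dual_mor C (raw f) \<otimes>\<^sub>m (\<i>\<d> V \<otimes>\<^sub>m \<i>\<d> X)) = \<iota> V Y \<cdot> (dual_mor C (\<i>\<d> Y) \<otimes>\<^sub>m (\<i>\<d> V \<otimes>\<^sub>m raw f))"
    using A_coend[OF V] X unfolding is_coend_def dinatural_to_def by blast
  thus ?thesis
    by (intro arrow_eqI) (use X f V in \<open>auto simp: raw_simps raw_io_pj dual_mor_raw dual_mor_ide tensor_ide\<close>)
qed

lemma pj_dinat:
  assumes V: "V \<in> Obj C" and f: "ok f" "src f = X" "tgt f = Y"
  shows "((f \<star> ide V) \<star> ide (X\<^sup>\<or>)) \<bullet> pj V X = (ide (Y \<otimes>\<^sub>o V) \<star> dm f) \<bullet> pj V Y"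
proof -
  have X: "X \<in> Obj C" "Y \<in> Obj C" "raw f \<in> homset C X Y" using f ok_raw by auto
  have "((raw f \<otimes>\<^sub>m \<i>\<d> V) \<otimes>\<^sub>m dual_mor C (\<i>\<d> X)) \<cdot> \<pi> V X = ((\<i>\<d> Y \<otimes>\<^sub>m \<i>\<d> V) \<otimes>\<^sub>m dual_mor C (raw f)) \<cdot> \<pi> V Y"
    using Z_end[OF V] X unfolding is_end_def dinatural_from_def by blast
  thus ?thesis
    by (intro arrow_eqI) (use X f V in \<open>auto simp: raw_simps raw_io_pj dual_mor_raw dual_mor_ide tensor_ide\<close>)
qed

lemma A_desc:
  assumes V: "V \<in> Obj C" and S: "S \<in> Obj C"
    and j: "\<And>X. X \<in> Obj C \<Longrightarrow> ok (j X)" "\<And>X. X \<in> Obj C \<Longrightarrow> src (j X) = X\<^sup>\<or> \<otimes>\<^sub>o (V \<otimes>\<^sub>o X)" "\<And>X. X \<in> Obj C \<Longrightarrow> tgt (j X) = S"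
    and dinat: "\<And>f X Y. ok f \<Longrightarrow> src f = X \<Longrightarrow> tgt f = Y \<Longrightarrow> j X \<bullet> (dm f \<star> ide (V \<otimes>\<^sub>o X)) = j Y \<bullet> (ide (Y\<^sup>\<or>) \<star> (ide V \<star> f))"
  obtains h where "ok h" "src h = A V" "tgt h = S" "\<And>X. X \<in> Obj C \<Longrightarrow> h \<bullet> io V X = j X"
proof -
  have "dinatural_to C (\<lambda>X Y. X\<^sup>\<or> \<otimes>\<^sub>o (V \<otimes>\<^sub>o Y)) (\<lambda>f g. dual_mor C f \<otimes>\<^sub>m (\<i>\<d> V \<otimes>\<^sub>m g)) S (\<lambda>X. raw (j X))"
    unfolding dinatural_to_def
  proof (intro conjI ballI)
    fix X assume "X \<in> Obj C"
    thus "raw (j X) \<in> homset C (X\<^sup>\<or> \<otimes>\<^sub>o (V \<otimes>\<^sub>o X)) S" using j ok_raw by metis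
  next
    fix X Y f assume X: "X \<in> Obj C" "Y \<in> Obj C" "f \<in> homset C X Y"
    have "ok (Arr X f Y)" using X by (simp add: ok_def del: ok_obj)
    from arg_cong[OF dinat[OF this, of X Y], of raw] show "raw (j X) \<cdot> (dual_mor C f \<otimes>\<^sub>m (\<i>\<d> V \<otimes>\<^sub>m \<i>\<d> X)) = raw (j Y) \<cdot> (dual_mor C (\<i>\<d> Y) \<otimes>\<^sub>m (\<i>\<d> V \<otimes>\<^sub>m f))"
      using X V by (simp add: raw_simps dual_mor_ide tensor_ide dm_def)
  qed
  then obtain h where h: "h \<in> homset C (A V) S" "\<And>X. X \<in> Obj C \<Longrightarrow> h \<cdot> \<iota> V X = raw (j X)"
    using A_coend[OF V] S unfolding is_coend_def by blast
  show ?thesis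
  proof (rule that[of "Arr (A V) h S"])
    show "ok (Arr (A V) h S)" using h V S by (simp add: ok_def del: ok_obj)
    show "Arr (A V) h S \<bullet> io V X = j X" if "X \<in> Obj C" for X
      by (rule arrow_eqI) (use that j h in \<open>auto simp: raw_simps raw_io_pj\<close>)
  qed auto
qed

lemma A_jointly_epic:
  assumes V: "V \<in> Obj C"
  shows "jointly_epic (A V) (io V ` Obj C)"
proof -
  have "u = v" if uv: "ok u" "ok v" "src u = A V" "src v = A V" "tgt u = tgt v"
    "\<And>X. X \<in> Obj C \<Longrightarrow> u \<bullet> io V X = v \<bullet> io V X" for u v
  proof -
    let ?j = "\<lambda>X. u \<bullet> io V X"
    have din: "dinatural_to C (\<lambda>X Y. X\<^sup>\<or> \<otimes>\<^sub>o (V \<otimes>\<^sub>o Y)) (\<lambda>f g. dual_mor C f \<otimes>\<^sub>m (\<i>\<d> V \<otimes>\<^sub>m g)) (tgt u) (\<lambda>X. raw (?j X))"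
      unfolding dinatural_to_def
    proof (intro conjI ballI)
      fix X assume X: "X \<in> Obj C"
      have "ok (?j X)" using uv X V by simp
      from ok_raw[OF this] show "raw (?j X) \<in> homset C (X\<^sup>\<or> \<otimes>\<^sub>o (V \<otimes>\<^sub>o X)) (tgt u)" by simp
    next
      fix X Y f assume X: "X \<in> Obj C" "Y \<in> Obj C" "f \<in> homset C X Y"
      have f: "ok (Arr X f Y)" using X by (simp add: ok_def del: ok_obj)
      have "(u \<bullet> io V X) \<bullet> (dm (Arr X f Y) \<star> ide (V \<otimes>\<^sub>o X)) = (u \<bullet> io V Y) \<bullet> (ide (Y\<^sup>\<or>) \<star> (ide V \<star> Arr X f Y))"
        using io_dinat[OF V f, of X Y] f X V uv by simp
      from arg_cong[OF this, of raw] show "raw (?j X) \<cdot> (dual_mor C f \<otimes>\<^sub>m (\<i>\<d> V \<otimes>\<^sub>m \<i>\<d> X)) = raw (?j Y) \<cdot> (dual_mor C (\<i>\<d> Y) \<otimes>\<^sub>m (\<i>\<d> V \<otimes>\<^sub>m f))"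
        using X V by (simp add: raw_simps dual_mor_ide tensor_ide dm_def)
    qed
    have un: "\<exists>!h. h \<in> homset C (A V) (tgt u) \<and> (\<forall>X\<in>Obj C. h \<cdot> \<iota> V X = raw (?j X))"
      using A_coend[OF V, unfolded is_coend_def] din ok_obj(2)[OF uv(1)] by blast
    have u: "raw u \<in> homset C (A V) (tgt u)" "\<forall>X\<in>Obj C. raw u \<cdot> \<iota> V X = raw (?j X)"
      using ok_raw[OF uv(1)] unfolding uv(3) raw_simps raw_io_pj by blast+
    have v: "raw v \<in> homset C (A V) (tgt u)" "\<forall>X\<in>Obj C. raw v \<cdot> \<iota> V X = raw (?j X)"
      using ok_raw[OF uv(2)] arg_cong[OF uv(6), of _ raw] unfolding uv(4,5) raw_simps raw_io_pj by metis+
    have "raw u = raw v" using un u v by blast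
    thus ?thesis using uv by (intro arrow_eqI) auto
  qed
  thus ?thesis unfolding jointly_epic_def using V by auto
qed

lemma Z_lift:
  assumes V: "V \<in> Obj C" and S: "S \<in> Obj C"
    and j: "\<And>X. X \<in> Obj C \<Longrightarrow> ok (j X)" "\<And>X. X \<in> Obj C \<Longrightarrow> src (j X) = S" "\<And>X. X \<in> Obj C \<Longrightarrow> tgt (j X) = (X \<otimes>\<^sub>o V) \<otimes>\<^sub>o X\<^sup>\<or>"
    and dinat: "\<And>f X Y. ok f \<Longrightarrow> src f = X \<Longrightarrow> tgt f = Y \<Longrightarrow> ((f \<star> ide V) \<star> ide (X\<^sup>\<or>)) \<bullet> j X = (ide (Y \<otimes>\<^sub>o V) \<star> dm f) \<bullet> j Y"
  obtains h where "ok h" "src h = S" "tgt h = Z V" "\<And>X. X \<in> Obj C \<Longrightarrow> pj V X \<bullet> h = j X"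
proof -
  have "dinatural_from C (\<lambda>X Y. (Y \<otimes>\<^sub>o V) \<otimes>\<^sub>o X\<^sup>\<or>) (\<lambda>f g. (g \<otimes>\<^sub>m \<i>\<d> V) \<otimes>\<^sub>m dual_mor C f) S (\<lambda>X. raw (j X))"
    unfolding dinatural_from_def
  proof (intro conjI ballI)
    fix X assume "X \<in> Obj C"
    thus "raw (j X) \<in> homset C S ((X \<otimes>\<^sub>o V) \<otimes>\<^sub>o X\<^sup>\<or>)" using j ok_raw by metis
  next
    fix X Y f assume X: "X \<in> Obj C" "Y \<in> Obj C" "f \<in> homset C X Y"
    have "ok (Arr X f Y)" using X by (simp add: ok_def del: ok_obj)
    from arg_cong[OF dinat[OF this, of X Y], of raw] show "((f \<otimes>\<^sub>m \<i>\<d> V) \<otimes>\<^sub>m dual_mor C (\<i>\<d> X)) \<cdot> raw (j X) = ((\<i>\<d> Y \<otimes>\<^sub>m \<i>\<d> V) \<otimes>\<^sub>m dual_mor C f) \<cdot> raw (j Y)"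
      using X V by (simp add: raw_simps dual_mor_ide tensor_ide dm_def)
  qed
  then obtain h where h: "h \<in> homset C S (Z V)" "\<And>X. X \<in> Obj C \<Longrightarrow> \<pi> V X \<cdot> h = raw (j X)"
    using Z_end[OF V] S unfolding is_end_def by blast
  show ?thesis
  proof (rule that[of "Arr S h (Z V)"])
    show "ok (Arr S h (Z V))" using h V S by (simp add: ok_def del: ok_obj)
    show "pj V X \<bullet> Arr S h (Z V) = j X" if "X \<in> Obj C" for X
      by (rule arrow_eqI) (use that j h in \<open>auto simp: raw_simps raw_io_pj\<close>)
  qed auto
qed

lemma Z_jointly_monic:
  assumes V: "V \<in> Obj C"
    and uv: "ok u" "ok v" "tgt u = Z V" "tgt v = Z V" "src u = src v" "\<And>X. X \<in> Obj C \<Longrightarrow> pj V X \<bullet> u = pj V X \<bullet> v"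
  shows "u = v"
proof -
  let ?j = "\<lambda>X. pj V X \<bullet> u"
  have din: "dinatural_from C (\<lambda>X Y. (Y \<otimes>\<^sub>o V) \<otimes>\<^sub>o X\<^sup>\<or>) (\<lambda>f g. (g \<otimes>\<^sub>m \<i>\<d> V) \<otimes>\<^sub>m dual_mor C f) (src u) (\<lambda>X. raw (?j X))"
    unfolding dinatural_from_def
  proof (intro conjI ballI)
    fix X assume X: "X \<in> Obj C"
    have "ok (?j X)" using uv X V by simp
    from ok_raw[OF this] show "raw (?j X) \<in> homset C (src u) ((X \<otimes>\<^sub>o V) \<otimes>\<^sub>o X\<^sup>\<or>)" by simp
  next
    fix X Y f assume X: "X \<in> Obj C" "Y \<in> Obj C" "f \<in> homset C X Y"
    have f: "ok (Arr X f Y)" using X by (simp add: ok_def del: ok_obj)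
    have "((Arr X f Y \<star> ide V) \<star> ide (X\<^sup>\<or>)) \<bullet> pj V X \<bullet> u = (ide (Y \<otimes>\<^sub>o V) \<star> dm (Arr X f Y)) \<bullet> pj V Y \<bullet> u"
      by (subst cmp_reduce[OF pj_dinat]) (use f X V uv in auto)
    from arg_cong[OF this, of raw] show "((f \<otimes>\<^sub>m \<i>\<d> V) \<otimes>\<^sub>m dual_mor C (\<i>\<d> X)) \<cdot> raw (?j X) = ((\<i>\<d> Y \<otimes>\<^sub>m \<i>\<d> V) \<otimes>\<^sub>m dual_mor C f) \<cdot> raw (?j Y)"
      using X V by (simp add: raw_simps dual_mor_ide tensor_ide dm_def)
  qed
  have un: "\<exists>!h. h \<in> homset C (src u) (Z V) \<and> (\<forall>X\<in>Obj C. \<pi> V X \<cdot> h = raw (?j X))"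
    using Z_end[OF V, unfolded is_end_def] din ok_obj(1)[OF uv(1)] by blast
  have u: "raw u \<in> homset C (src u) (Z V)" "\<forall>X\<in>Obj C. \<pi> V X \<cdot> raw u = raw (?j X)"
    using ok_raw[OF uv(1)] unfolding uv(3) raw_simps raw_io_pj by blast+
  have v: "raw v \<in> homset C (src u) (Z V)" "\<forall>X\<in>Obj C. \<pi> V X \<cdot> raw v = raw (?j X)"
    using ok_raw[OF uv(2)] arg_cong[OF uv(6), of _ raw] unfolding uv(4,5) raw_simps raw_io_pj by metis+
  have "raw u = raw v" using un u v by blast
  thus ?thesis using uv by (intro arrow_eqI) auto
qed

end

section \<open>The pairing between the end and the coend\<close>

context coend_end_data
begin

lemma A_ext:
  assumes "V \<in> Obj C" "ok u" "ok v" "src u = A V" "src v = A V" "tgt u = tgt v"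
    "\<And>X. X \<in> Obj C \<Longrightarrow> u \<bullet> io V X = v \<bullet> io V X"
  shows "u = v"
  by (rule jointly_epicD[OF A_jointly_epic[OF assms(1)]]) (use assms in auto)

lemma A_pairing_ext:
  assumes "V \<in> Obj C" "pr p" "pr q" "lob p = L" "lob q = L" "rob p = A V" "rob q = A V"
    "\<And>X. X \<in> Obj C \<Longrightarrow> pb p (ide L) (io V X) = pb q (ide L) (io V X)"
  shows "p = q"
proof (rule pairing_eqI)
  have L: "L \<in> Obj C" using assms(2,4) by auto
  show "form p = form q"
  proof (rule jointly_epicD[OF jointly_epic_ten_left[OF A_jointly_epic[OF assms(1)] L]])
    fix e assume "e \<in> (\<lambda>e. ide L \<star> e) ` io V ` Obj C"
    then obtain X where "X \<in> Obj C" "e = ide L \<star> io V X" by auto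
    thus "form p \<bullet> e = form q \<bullet> e" using pb_form[OF assms(8)] by simp
  qed (use assms in auto)
qed (use assms in auto)

text \<open>The action of the monad and of the comonad on morphisms.\<close>

definition amor :: "('o, 'm) arrow \<Rightarrow> ('o, 'm) arrow" where
  "amor f = Arr (A (src f)) (A2_mor C A \<iota> (raw f)) (A (tgt f))"

definition zmor :: "('o, 'm) arrow \<Rightarrow> ('o, 'm) arrow" where
  "zmor f = Arr (Z (src f)) (Z4_mor C Z \<pi> (raw f)) (Z (tgt f))"

lemma mor_src_tgt [simp]: "src (amor f) = A (src f)" "tgt (amor f) = A (tgt f)"
  "src (zmor f) = Z (src f)" "tgt (zmor f) = Z (tgt f)"
  by (simp_all add: amor_def zmor_def)

lemma raw_dom_cod: "ok f \<Longrightarrow> Dom C (raw f) = src f" "ok f \<Longrightarrow> Cod C (raw f) = tgt f"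
  using dom_cod[of "src f" "tgt f" "raw f"] unfolding ok_def by auto

text \<open>Evaluation of a definite description of a morphism with given source and target.\<close>

lemma the_arrow_eq:
  assumes "ok h" "src h = X" "tgt h = Y" "Q (raw h)"
    "\<And>k. ok k \<Longrightarrow> src k = X \<Longrightarrow> tgt k = Y \<Longrightarrow> Q (raw k) \<Longrightarrow> k = h"
  shows "(THE r. r \<in> homset C X Y \<and> Q r) = raw h"
proof (rule the_equality)
  show "raw h \<in> homset C X Y \<and> Q (raw h)" using assms(2-4) ok_raw[OF assms(1)] by auto
next
  fix r assume r: "r \<in> homset C X Y \<and> Q r"
  have "ok (Arr X r Y)"
    unfolding ok_def using r ok_obj[OF assms(1)] assms(2,3) by simp
  from assms(5)[OF this] r have "Arr X r Y = h" by simp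
  thus "r = raw h" by (metis arrow.sel(2))
qed

lemma amor_props:
  assumes f: "ok f"
  shows "ok (amor f)" "X \<in> Obj C \<Longrightarrow> amor f \<bullet> io (src f) X = io (tgt f) X \<bullet> (ide (X\<^sup>\<or>) \<star> (f \<star> ide X))"
proof -
  let ?j = "\<lambda>X. io (tgt f) X \<bullet> (ide (X\<^sup>\<or>) \<star> (f \<star> ide X))"
  have din: "?j X \<bullet> (dm g \<star> ide (src f \<otimes>\<^sub>o X)) = ?j Y \<bullet> (ide (Y\<^sup>\<or>) \<star> (ide (src f) \<star> g))"
    if g: "ok g" "src g = X" "tgt g = Y" for g X Y
  proof -
    have X: "X \<in> Obj C" "Y \<in> Obj C" using g by auto
    have "?j X \<bullet> (dm g \<star> ide (src f \<otimes>\<^sub>o X)) = io (tgt f) X \<bullet> (dm g \<star> ide (tgt f \<otimes>\<^sub>o X)) \<bullet> (ide (Y\<^sup>\<or>) \<star> (f \<star> ide X))"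
      using f g X by auto
    also have "\<dots> = io (tgt f) Y \<bullet> (ide (Y\<^sup>\<or>) \<star> (ide (tgt f) \<star> g)) \<bullet> (ide (Y\<^sup>\<or>) \<star> (f \<star> ide X))"
      using f g X cmp_reduce[OF io_dinat[of "tgt f" g X Y], of "ide (Y\<^sup>\<or>) \<star> (f \<star> ide X)"] by simp
    finally show ?thesis using f g X by simp
  qed
  obtain h where h: "ok h" "src h = A (src f)" "tgt h = A (tgt f)" "\<And>X. X \<in> Obj C \<Longrightarrow> h \<bullet> io (src f) X = ?j X"
    by (rule A_desc[of "src f" "A (tgt f)" ?j, OF _ _ _ _ _ din]) (use f in auto)
  have "A2_mor C A \<iota> (raw f) = raw h"
    unfolding A2_mor_def raw_dom_cod[OF f]
  proof (rule the_arrow_eq[OF h(1-3)])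
    show "\<forall>X\<in>Obj C. raw h \<cdot> \<iota> (src f) X = \<iota> (tgt f) X \<cdot> (\<i>\<d> (X\<^sup>\<or>) \<otimes>\<^sub>m (raw f \<otimes>\<^sub>m \<i>\<d> X))"
      using arg_cong[OF h(4), of _ raw] by (simp add: raw_simps raw_io_pj)
  next
    fix k assume k: "ok k" "src k = A (src f)" "tgt k = A (tgt f)" "\<forall>X\<in>Obj C. raw k \<cdot> \<iota> (src f) X = \<iota> (tgt f) X \<cdot> (\<i>\<d> (X\<^sup>\<or>) \<otimes>\<^sub>m (raw f \<otimes>\<^sub>m \<i>\<d> X))"
    show "k = h"
    proof (rule A_ext[of "src f"])
      fix X assume "X \<in> Obj C"
      thus "k \<bullet> io (src f) X = h \<bullet> io (src f) X"
        unfolding h(4) by (intro arrow_eqI) (use k h f in \<open>auto simp: raw_simps raw_io_pj\<close>)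
    qed (use h k f in auto)
  qed
  hence a: "amor f = h" unfolding amor_def using h by (intro arrow_eqI) auto
  show "ok (amor f)" "X \<in> Obj C \<Longrightarrow> amor f \<bullet> io (src f) X = ?j X"
    unfolding a using h by auto
qed

lemma zmor_props:
  assumes f: "ok f"
  shows "ok (zmor f)" "X \<in> Obj C \<Longrightarrow> pj (tgt f) X \<bullet> zmor f = ((ide X \<star> f) \<star> ide (X\<^sup>\<or>)) \<bullet> pj (src f) X"
proof -
  let ?j = "\<lambda>X. ((ide X \<star> f) \<star> ide (X\<^sup>\<or>)) \<bullet> pj (src f) X"
  have din: "((g \<star> ide (tgt f)) \<star> ide (X\<^sup>\<or>)) \<bullet> ?j X = (ide (Y \<otimes>\<^sub>o tgt f) \<star> dm g) \<bullet> ?j Y"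
    if g: "ok g" "src g = X" "tgt g = Y" for g X Y
  proof -
    have X: "X \<in> Obj C" "Y \<in> Obj C" using g by auto
    have "((g \<star> ide (tgt f)) \<star> ide (X\<^sup>\<or>)) \<bullet> ?j X = ((ide Y \<star> f) \<star> ide (X\<^sup>\<or>)) \<bullet> ((g \<star> ide (src f)) \<star> ide (X\<^sup>\<or>)) \<bullet> pj (src f) X"
      using f g X by auto
    also have "\<dots> = ((ide Y \<star> f) \<star> ide (X\<^sup>\<or>)) \<bullet> (ide (Y \<otimes>\<^sub>o src f) \<star> dm g) \<bullet> pj (src f) Y"
      using f g X pj_dinat[of "src f" g X Y] by simp
    finally show ?thesis using f g X by simp
  qed
  obtain h where h: "ok h" "src h = Z (src f)" "tgt h = Z (tgt f)" "\<And>X. X \<in> Obj C \<Longrightarrow> pj (tgt f) X \<bullet> h = ?j X"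
    by (rule Z_lift[of "tgt f" "Z (src f)" ?j, OF _ _ _ _ _ din]) (use f in auto)
  have "Z4_mor C Z \<pi> (raw f) = raw h"
    unfolding Z4_mor_def raw_dom_cod[OF f]
  proof (rule the_arrow_eq[OF h(1-3)])
    show "\<forall>X\<in>Obj C. \<pi> (tgt f) X \<cdot> raw h = ((\<i>\<d> X \<otimes>\<^sub>m raw f) \<otimes>\<^sub>m \<i>\<d> (X\<^sup>\<or>)) \<cdot> \<pi> (src f) X"
      using arg_cong[OF h(4), of _ raw] by (simp add: raw_simps raw_io_pj)
  next
    fix k assume k: "ok k" "src k = Z (src f)" "tgt k = Z (tgt f)" "\<forall>X\<in>Obj C. \<pi> (tgt f) X \<cdot> raw k = ((\<i>\<d> X \<otimes>\<^sub>m raw f) \<otimes>\<^sub>m \<i>\<d> (X\<^sup>\<or>)) \<cdot> \<pi> (src f) X"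
    show "k = h"
    proof (rule Z_jointly_monic[of "tgt f"])
      fix X assume "X \<in> Obj C"
      thus "pj (tgt f) X \<bullet> k = pj (tgt f) X \<bullet> h"
        unfolding h(4) by (intro arrow_eqI) (use k h f in \<open>auto simp: raw_simps raw_io_pj\<close>)
    qed (use h k f in auto)
  qed
  hence a: "zmor f = h" unfolding zmor_def using h by (intro arrow_eqI) auto
  show "ok (zmor f)" "X \<in> Obj C \<Longrightarrow> pj (tgt f) X \<bullet> zmor f = ?j X"
    unfolding a using h by auto
qed

declare amor_props(1) [simp] zmor_props(1) [simp]

text \<open>The pairing of \<open>Z(P)\<close> with \<open>X\<^sup>\<or> \<otimes> (Q \<otimes> X)\<close> obtained from the component of the end at \<open>X\<^sup>\<or>\<close>.\<close>

definition fam :: "('o, 'm) pairing \<Rightarrow> 'o \<Rightarrow> ('o, 'm) pairing" where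
  "fam q X = pb (npair X q X) (pj (lob q) (X\<^sup>\<or>)) (ide (X\<^sup>\<or> \<otimes>\<^sub>o (rob q \<otimes>\<^sub>o X)))"

lemma fam_simps [simp]: "lob (fam q X) = Z (lob q)" "rob (fam q X) = X\<^sup>\<or> \<otimes>\<^sub>o (rob q \<otimes>\<^sub>o X)"
  "pr q \<Longrightarrow> X \<in> Obj C \<Longrightarrow> pr (fam q X)"
  by (simp_all add: fam_def)

lemma fam_dinat:
  assumes q: "pr q" and f: "ok f" "src f = X" "tgt f = Y"
  shows "pb (fam q X) (ide (Z (lob q))) (dm f \<star> ide (rob q \<otimes>\<^sub>o X)) = pb (fam q Y) (ide (Z (lob q))) (ide (Y\<^sup>\<or>) \<star> (ide (rob q) \<star> f))"
proof -
  have X: "X \<in> Obj C" "Y \<in> Obj C" using f by auto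
  let ?P = "lob q" let ?Q = "rob q"
  have "pb (fam q X) (ide (Z ?P)) (dm f \<star> ide (?Q \<otimes>\<^sub>o X)) =
     pb (pb (npair X q X) (ide ((X\<^sup>\<or> \<otimes>\<^sub>o ?P) \<otimes>\<^sub>o (X\<^sup>\<or>)\<^sup>\<or>)) (dm f \<star> ide (?Q \<otimes>\<^sub>o X))) (pj ?P (X\<^sup>\<or>)) (ide (Y\<^sup>\<or> \<otimes>\<^sub>o (?Q \<otimes>\<^sub>o X)))"
    using q f X by (simp add: fam_def)
  also have "\<dots> = pb (npair X q Y) ((ide (X\<^sup>\<or> \<otimes>\<^sub>o ?P) \<star> dm (dm f)) \<bullet> pj ?P (X\<^sup>\<or>)) (ide (Y\<^sup>\<or> \<otimes>\<^sub>o (?Q \<otimes>\<^sub>o X)))"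
    using q f X by (simp add: npair_slide_right)
  also have "(ide (X\<^sup>\<or> \<otimes>\<^sub>o ?P) \<star> dm (dm f)) \<bullet> pj ?P (X\<^sup>\<or>) = ((dm f \<star> ide ?P) \<star> ide ((Y\<^sup>\<or>)\<^sup>\<or>)) \<bullet> pj ?P (Y\<^sup>\<or>)"
    by (rule pj_dinat[symmetric]) (use q f X in auto)
  also have "pb (npair X q Y) (((dm f \<star> ide ?P) \<star> ide ((Y\<^sup>\<or>)\<^sup>\<or>)) \<bullet> pj ?P (Y\<^sup>\<or>)) (ide (Y\<^sup>\<or> \<otimes>\<^sub>o (?Q \<otimes>\<^sub>o X))) =
    pb (pb (npair X q Y) ((dm f \<star> ide ?P) \<star> ide ((Y\<^sup>\<or>)\<^sup>\<or>)) (ide (Y\<^sup>\<or> \<otimes>\<^sub>o (?Q \<otimes>\<^sub>o X)))) (pj ?P (Y\<^sup>\<or>)) (ide (Y\<^sup>\<or> \<otimes>\<^sub>o (?Q \<otimes>\<^sub>o X)))"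
    using q f X by simp
  also have "\<dots> = pb (npair Y q Y) (pj ?P (Y\<^sup>\<or>)) (ide (Y\<^sup>\<or>) \<star> (ide ?Q \<star> f))"
    using q f X by (simp add: npair_slide_left)
  also have "\<dots> = pb (fam q Y) (ide (Z ?P)) (ide (Y\<^sup>\<or>) \<star> (ide ?Q \<star> f))"
    using q f X by (simp add: fam_def)
  finally show ?thesis .
qed

lemma Ep_ex:
  assumes q: "pr q"
  shows "\<exists>e. pr e \<and> lob e = Z (lob q) \<and> rob e = A (rob q) \<and> (\<forall>X\<in>Obj C. pb e (ide (Z (lob q))) (io (rob q) X) = fam q X)"
proof -
  let ?P = "lob q" let ?Q = "rob q"
  \<comment> \<open>a right dual of \<open>Z(P)\<close> represents the pairings with \<open>Z(P)\<close>\<close>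
  have "Z ?P \<in> Obj C" using q by simp
  then obtain p c where d: "dual p c" and lp: "lob p = Z ?P" using right_dual_pairing by metis
  have rp: "rperf p" using dual_rperf[OF d] .
  have p [simp]: "pr p" using rp by (rule rperfD)
  have "\<exists>h. ok h \<and> src h = X\<^sup>\<or> \<otimes>\<^sub>o (?Q \<otimes>\<^sub>o X) \<and> tgt h = rob p \<and> pb p (ide (Z ?P)) h = fam q X" if "X \<in> Obj C" for X
    using rperf_pb_ex[OF rp, of "fam q X"] that q lp by (metis fam_simps)
  then obtain j where j: "\<And>X. X \<in> Obj C \<Longrightarrow> ok (j X)" "\<And>X. X \<in> Obj C \<Longrightarrow> src (j X) = X\<^sup>\<or> \<otimes>\<^sub>o (?Q \<otimes>\<^sub>o X)"
      "\<And>X. X \<in> Obj C \<Longrightarrow> tgt (j X) = rob p" "\<And>X. X \<in> Obj C \<Longrightarrow> pb p (ide (Z ?P)) (j X) = fam q X"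
    by metis
  have din: "j X \<bullet> (dm f \<star> ide (?Q \<otimes>\<^sub>o X)) = j Y \<bullet> (ide (Y\<^sup>\<or>) \<star> (ide ?Q \<star> f))"
    if f: "ok f" "src f = X" "tgt f = Y" for f X Y
  proof (rule rperf_pb_inj[OF rp])
    have X: "X \<in> Obj C" "Y \<in> Obj C" using f by auto
    have "pb p (ide (lob p)) (j X \<bullet> (dm f \<star> ide (?Q \<otimes>\<^sub>o X))) = pb (fam q X) (ide (Z ?P)) (dm f \<star> ide (?Q \<otimes>\<^sub>o X))"
      unfolding j(4)[OF X(1), symmetric] using j(1-3) X f q lp by simp
    also have "\<dots> = pb (fam q Y) (ide (Z ?P)) (ide (Y\<^sup>\<or>) \<star> (ide ?Q \<star> f))"
      using fam_dinat[OF q f] .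
    also have "\<dots> = pb p (ide (lob p)) (j Y \<bullet> (ide (Y\<^sup>\<or>) \<star> (ide ?Q \<star> f)))"
      unfolding j(4)[OF X(2), symmetric] using j(1-3) X f q lp by simp
    finally show "pb p (ide (lob p)) (j X \<bullet> (dm f \<star> ide (?Q \<otimes>\<^sub>o X))) = pb p (ide (lob p)) (j Y \<bullet> (ide (Y\<^sup>\<or>) \<star> (ide ?Q \<star> f)))" .
  qed (use f q j(1-3) ok_obj[OF f(1)] in auto)
  obtain h where h: "ok h" "src h = A ?Q" "tgt h = rob p" "\<And>X. X \<in> Obj C \<Longrightarrow> h \<bullet> io ?Q X = j X"
    by (rule A_desc[of ?Q "rob p" j, OF _ _ _ _ _ din]) (use q j(1-3) in auto)
  have "pb (pb p (ide (Z ?P)) h) (ide (Z ?P)) (io ?Q X) = fam q X" if "X \<in> Obj C" for X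
    using that h j q lp by simp
  thus ?thesis using h q lp by (intro exI[of _ "pb p (ide (Z ?P)) h"]) auto
qed

text \<open>The pairing of \<open>Z(P)\<close> with \<open>A(Q)\<close> induced by a pairing of \<open>P\<close> with \<open>Q\<close>.\<close>

definition Ep :: "('o, 'm) pairing \<Rightarrow> ('o, 'm) pairing" where
  "Ep q = (SOME e. pr e \<and> lob e = Z (lob q) \<and> rob e = A (rob q) \<and> (\<forall>X\<in>Obj C. pb e (ide (Z (lob q))) (io (rob q) X) = fam q X))"

lemma Ep_props:
  assumes "pr q"
  shows "pr (Ep q)" "lob (Ep q) = Z (lob q)" "rob (Ep q) = A (rob q)"
    "X \<in> Obj C \<Longrightarrow> pb (Ep q) (ide (Z (lob q))) (io (rob q) X) = fam q X"
  using someI_ex[OF Ep_ex[OF assms]] unfolding Ep_def[symmetric] by blast+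

declare Ep_props(1-3) [simp]

lemma Ep_nat:
  assumes q: "pr q" and p: "ok p" "tgt p = lob q" and r: "ok r" "tgt r = rob q"
  shows "Ep (pb q p r) = pb (Ep q) (zmor p) (amor r)"
proof (rule A_pairing_ext[of "src r" _ _ "Z (src p)"])
  fix X assume X: "X \<in> Obj C"
  have "pb (pb (Ep q) (zmor p) (amor r)) (ide (Z (src p))) (io (src r) X) = pb (Ep q) (zmor p) (io (rob q) X \<bullet> (ide (X\<^sup>\<or>) \<star> (r \<star> ide X)))"
    using q p r X amor_props(2)[OF r(1) X] by simp
  also have "\<dots> = pb (pb (Ep q) (ide (Z (lob q))) (io (rob q) X)) (zmor p) (ide (X\<^sup>\<or>) \<star> (r \<star> ide X))"
    using q p r X by simp
  also have "\<dots> = pb (npair X q X) (pj (tgt p) (X\<^sup>\<or>) \<bullet> zmor p) (ide (X\<^sup>\<or>) \<star> (r \<star> ide X))"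
    unfolding Ep_props(4)[OF q X] using q p r X by (simp add: fam_def)
  also have "\<dots> = pb (npair X q X) (((ide (X\<^sup>\<or>) \<star> p) \<star> ide ((X\<^sup>\<or>)\<^sup>\<or>)) \<bullet> pj (src p) (X\<^sup>\<or>)) (ide (X\<^sup>\<or>) \<star> (r \<star> ide X))"
    using zmor_props(2)[OF p(1), of "X\<^sup>\<or>"] X by simp
  also have "\<dots> = fam (pb q p r) X"
    using q p r X by (simp add: fam_def npair_pb)
  also have "\<dots> = pb (Ep (pb q p r)) (ide (Z (src p))) (io (src r) X)"
    using Ep_props(4)[of "pb q p r" X] q p r X by simp
  finally show "pb (Ep (pb q p r)) (ide (Z (src p))) (io (src r) X) = pb (pb (Ep q) (zmor p) (amor r)) (ide (Z (src p))) (io (src r) X)" ..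
qed (use q p r in auto)

text \<open>Since every object is isomorphic to a left dual, the end is determined by its components at left duals.\<close>

lemma Z_dual_jointly_monic:
  assumes V: "V \<in> Obj C"
    and uv: "ok u" "ok v" "tgt u = Z V" "tgt v = Z V" "src u = src v"
      "\<And>X. X \<in> Obj C \<Longrightarrow> pj V (X\<^sup>\<or>) \<bullet> u = pj V (X\<^sup>\<or>) \<bullet> v"
  shows "u = v"
proof (rule Z_jointly_monic[OF V uv(1-5)])
  fix Y assume Y: "Y \<in> Obj C"
  obtain R \<phi> \<psi> where R: "R \<in> Obj C" "ok \<phi>" "ok \<psi>" "src \<phi> = R\<^sup>\<or>" "tgt \<phi> = Y" "src \<psi> = Y" "tgt \<psi> = R\<^sup>\<or>" "\<phi> \<bullet> \<psi> = ide Y"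
    using dual_cover[OF Y] by metis
  have dd: "dm \<psi> \<bullet> dm \<phi> = ide (Y\<^sup>\<or>)" using R Y by (simp add: dm_cmp[symmetric])
  have "pj V Y = (ide (Y \<otimes>\<^sub>o V) \<star> dm \<psi>) \<bullet> (ide (Y \<otimes>\<^sub>o V) \<star> dm \<phi>) \<bullet> pj V Y"
    using R Y V dd by simp
  also have "(ide (Y \<otimes>\<^sub>o V) \<star> dm \<phi>) \<bullet> pj V Y = ((\<phi> \<star> ide V) \<star> ide ((R\<^sup>\<or>)\<^sup>\<or>)) \<bullet> pj V (R\<^sup>\<or>)"
    by (rule pj_dinat[symmetric]) (use R V in auto)
  finally have e: "pj V Y = ((\<phi> \<star> ide V) \<star> dm \<psi>) \<bullet> pj V (R\<^sup>\<or>)"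
    using R Y V by simp
  have "((\<phi> \<star> ide V) \<star> dm \<psi>) \<bullet> pj V (R\<^sup>\<or>) \<bullet> u = ((\<phi> \<star> ide V) \<star> dm \<psi>) \<bullet> pj V (R\<^sup>\<or>) \<bullet> v"
    using uv(6)[OF R(1)] by simp
  thus "pj V Y \<bullet> u = pj V Y \<bullet> v" unfolding e using R Y V uv(1-5) by simp
qed

lemma Z_dual_lift:
  assumes V: "V \<in> Obj C" and S: "S \<in> Obj C"
    and k: "\<And>X. X \<in> Obj C \<Longrightarrow> ok (k X)" "\<And>X. X \<in> Obj C \<Longrightarrow> src (k X) = S"
      "\<And>X. X \<in> Obj C \<Longrightarrow> tgt (k X) = (X\<^sup>\<or> \<otimes>\<^sub>o V) \<otimes>\<^sub>o (X\<^sup>\<or>)\<^sup>\<or>"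
    and din: "\<And>f X Y. ok f \<Longrightarrow> src f = X \<Longrightarrow> tgt f = Y \<Longrightarrow>
      ((dm f \<star> ide V) \<star> ide ((Y\<^sup>\<or>)\<^sup>\<or>)) \<bullet> k Y = (ide (X\<^sup>\<or> \<otimes>\<^sub>o V) \<star> dm (dm f)) \<bullet> k X"
  obtains h where "ok h" "src h = S" "tgt h = Z V" "\<And>X. X \<in> Obj C \<Longrightarrow> pj V (X\<^sup>\<or>) \<bullet> h = k X"
proof -
  let ?Q = "\<lambda>Y (R, \<phi>, \<psi>). R \<in> Obj C \<and> ok \<phi> \<and> ok \<psi> \<and> src \<phi> = R\<^sup>\<or> \<and> tgt \<phi> = Y \<and> src \<psi> = Y \<and> tgt \<psi> = R\<^sup>\<or> \<and>
    \<phi> \<bullet> \<psi> = ide Y \<and> \<psi> \<bullet> \<phi> = ide (R\<^sup>\<or>)"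
  have "\<forall>Y\<in>Obj C. \<exists>r. ?Q Y r"
  proof
    fix Y assume "Y \<in> Obj C"
    from dual_cover[OF this] obtain R \<phi> \<psi> where "R \<in> Obj C" "ok \<phi>" "ok \<psi>" "src \<phi> = R\<^sup>\<or>" "tgt \<phi> = Y"
      "src \<psi> = Y" "tgt \<psi> = R\<^sup>\<or>" "\<phi> \<bullet> \<psi> = ide Y" "\<psi> \<bullet> \<phi> = ide (R\<^sup>\<or>)" by blast
    hence "?Q Y (R, \<phi>, \<psi>)" by (simp only: prod.case simp_thms)
    thus "\<exists>r. ?Q Y r" by (rule exI)
  qed
  from bchoice[OF this] obtain r where r: "\<forall>Y\<in>Obj C. ?Q Y (r Y)" by blast
  define R where "R Y = fst (r Y)" for Y
  define \<phi> where "\<phi> Y = fst (snd (r Y))" for Y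
  define \<psi> where "\<psi> Y = snd (snd (r Y))" for Y
  have R: "R Y \<in> Obj C" "ok (\<phi> Y)" "ok (\<psi> Y)" "src (\<phi> Y) = (R Y)\<^sup>\<or>" "tgt (\<phi> Y) = Y"
    "src (\<psi> Y) = Y" "tgt (\<psi> Y) = (R Y)\<^sup>\<or>" "\<phi> Y \<bullet> \<psi> Y = ide Y" "\<psi> Y \<bullet> \<phi> Y = ide ((R Y)\<^sup>\<or>)" if "Y \<in> Obj C" for Y
    using r[rule_format, OF that] by (auto simp: R_def \<phi>_def \<psi>_def split_beta)
  let ?j = "\<lambda>Y. ((\<phi> Y \<star> ide V) \<star> dm (\<psi> Y)) \<bullet> k (R Y)"
  \<comment> \<open>the two sides are compared by writing \<open>\<psi> Y' \<bullet> g\<close>, a morphism between left duals, as a dual morphism\<close>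
  have key: "((g \<star> ide V) \<star> ide ((Y\<^sup>\<or>)\<^sup>\<or>)) \<bullet> k Y = (ide (Y' \<otimes>\<^sub>o V) \<star> dm g) \<bullet> ((\<phi> Y' \<star> ide V) \<star> dm (\<psi> Y')) \<bullet> k (R Y')"
    if g: "ok g" "src g = Y\<^sup>\<or>" "tgt g = Y'" "Y \<in> Obj C" "Y' \<in> Obj C" for g Y Y'
  proof -
    obtain f where f: "ok f" "src f = R Y'" "tgt f = Y" "dm f = \<psi> Y' \<bullet> g"
      by (rule dm_full[of "R Y'" Y "\<psi> Y' \<bullet> g"]) (use R g in auto)
    have "((g \<star> ide V) \<star> ide ((Y\<^sup>\<or>)\<^sup>\<or>)) \<bullet> k Y = ((\<phi> Y' \<star> ide V) \<star> ide ((Y\<^sup>\<or>)\<^sup>\<or>)) \<bullet> ((dm f \<star> ide V) \<star> ide ((Y\<^sup>\<or>)\<^sup>\<or>)) \<bullet> k Y"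
      using f g R V k(1-3) cmp_reduce[OF R(8)[of Y'], of g] by simp
    also have "\<dots> = ((\<phi> Y' \<star> ide V) \<star> ide ((Y\<^sup>\<or>)\<^sup>\<or>)) \<bullet> (ide ((R Y')\<^sup>\<or> \<otimes>\<^sub>o V) \<star> dm (dm f)) \<bullet> k (R Y')"
      using din[OF f(1-3)] by simp
    also have "\<dots> = (ide (Y' \<otimes>\<^sub>o V) \<star> dm g) \<bullet> ((\<phi> Y' \<star> ide V) \<star> dm (\<psi> Y')) \<bullet> k (R Y')"
      using f g R V k(1-3) by (simp add: dm_cmp)
    finally show ?thesis .
  qed
  have dinj: "((g \<star> ide V) \<star> ide (Y\<^sup>\<or>)) \<bullet> ?j Y = (ide (Y' \<otimes>\<^sub>o V) \<star> dm g) \<bullet> ?j Y'"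
    if g: "ok g" "src g = Y" "tgt g = Y'" for g Y Y'
  proof -
    have Y: "Y \<in> Obj C" "Y' \<in> Obj C" using g by auto
    have "((g \<star> ide V) \<star> ide (Y\<^sup>\<or>)) \<bullet> ?j Y = (ide (Y' \<otimes>\<^sub>o V) \<star> dm (\<psi> Y)) \<bullet> (((g \<bullet> \<phi> Y) \<star> ide V) \<star> ide (((R Y)\<^sup>\<or>)\<^sup>\<or>)) \<bullet> k (R Y)"
      using g Y R V k(1-3) by simp
    also have "\<dots> = (ide (Y' \<otimes>\<^sub>o V) \<star> dm (\<psi> Y)) \<bullet> (ide (Y' \<otimes>\<^sub>o V) \<star> dm (g \<bullet> \<phi> Y)) \<bullet> ?j Y'"
      by (subst key[of "g \<bullet> \<phi> Y" "R Y" Y']) (use g Y R V in auto)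
    also have "\<dots> = (ide (Y' \<otimes>\<^sub>o V) \<star> (dm (\<psi> Y) \<bullet> dm (g \<bullet> \<phi> Y))) \<bullet> ?j Y'"
      using g Y R V k(1-3) by simp
    also have "dm (\<psi> Y) \<bullet> dm (g \<bullet> \<phi> Y) = dm g"
      using g Y R by (subst dm_cmp[symmetric]) auto
    finally show ?thesis .
  qed
  obtain h where h: "ok h" "src h = S" "tgt h = Z V" "\<And>X. X \<in> Obj C \<Longrightarrow> pj V X \<bullet> h = ?j X"
    by (rule Z_lift[of V S ?j, OF _ _ _ _ _ dinj]) (use k(1-3) R V S in auto)
  have "pj V (X\<^sup>\<or>) \<bullet> h = k X" if X: "X \<in> Obj C" for X
    using h(4)[of "X\<^sup>\<or>"] key[of "ide (X\<^sup>\<or>)" X "X\<^sup>\<or>"] X V k(1-3) R by simp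
  with h that show ?thesis by blast
qed

lemma Ep_inj:
  assumes d: "dual q c" and uv: "ok u" "ok v" "tgt u = Z (lob q)" "tgt v = Z (lob q)" "src u = src v"
    and eq: "pb (Ep q) u (ide (A (rob q))) = pb (Ep q) v (ide (A (rob q)))"
  shows "u = v"
proof (rule Z_dual_jointly_monic[OF _ uv])
  have q [simp]: "pr q" using d by (rule dual_simps)
  show "lob q \<in> Obj C" by simp
  fix X assume X: "X \<in> Obj C"
  have "pb (npair X q X) (pj (lob q) (X\<^sup>\<or>) \<bullet> w) (ide (X\<^sup>\<or> \<otimes>\<^sub>o (rob q \<otimes>\<^sub>o X))) = pb (pb (Ep q) w (ide (A (rob q)))) (ide (src w)) (io (rob q) X)"
    if w: "ok w" "tgt w = Z (lob q)" for w
  proof -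
    have "pb (npair X q X) (pj (lob q) (X\<^sup>\<or>) \<bullet> w) (ide (X\<^sup>\<or> \<otimes>\<^sub>o (rob q \<otimes>\<^sub>o X))) = pb (fam q X) w (ide (X\<^sup>\<or> \<otimes>\<^sub>o (rob q \<otimes>\<^sub>o X)))"
      using w X by (simp add: fam_def)
    also have "\<dots> = pb (pb (Ep q) (ide (Z (lob q))) (io (rob q) X)) w (ide (X\<^sup>\<or> \<otimes>\<^sub>o (rob q \<otimes>\<^sub>o X)))"
      using X by (simp add: Ep_props(4))
    finally show ?thesis using w X by simp
  qed
  from this[of u] this[of v] show "pj (lob q) (X\<^sup>\<or>) \<bullet> u = pj (lob q) (X\<^sup>\<or>) \<bullet> v"
    by (intro lperf_pb_inj[OF lperf_npair[OF d X X]]) (use uv X eq in auto)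
qed

text \<open>A universal morphism \<open>A(Q)\<^sup>\<or> \<rightarrow> Z(P)\<close> is inverse to the morphism \<open>Z(P) \<rightarrow> A(Q)\<^sup>\<or>\<close>
  representing \<open>Ep q\<close>; so \<open>Ep q\<close> is isomorphic to the evaluation of \<open>A(Q)\<close>, which is right perfect.\<close>

lemma Ep_rperf:
  assumes d: "dual q c"
  shows "rperf (Ep q)"
proof -
  let ?P = "lob q" let ?Q = "rob q"
  have q [simp]: "pr q" using d by (rule dual_simps)
  have AQ [simp]: "A ?Q \<in> Obj C" by simp
  let ?e = "evp (A ?Q)"
  let ?D = "(A ?Q)\<^sup>\<or>"
  have "\<exists>h. ok h \<and> src h = ?D \<and> tgt h = lob (npair X q X) \<and>
      pb (npair X q X) h (ide (X\<^sup>\<or> \<otimes>\<^sub>o (?Q \<otimes>\<^sub>o X))) = pb ?e (ide ?D) (io ?Q X)" if "X \<in> Obj C" for X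
  proof -
    have 1: "pr (pb ?e (ide ?D) (io ?Q X))" "rob (pb ?e (ide ?D) (io ?Q X)) = rob (npair X q X)"
      using that by auto
    from lperf_pb_ex[OF lperf_npair[OF d that that] 1] obtain h where "ok h" "src h = lob (pb ?e (ide ?D) (io ?Q X))"
      "tgt h = lob (npair X q X)" "pb (npair X q X) h (ide (rob (npair X q X))) = pb ?e (ide ?D) (io ?Q X)" by blast
    thus ?thesis by (intro exI[of _ h]) simp
  qed
  then obtain k where k: "\<And>X. X \<in> Obj C \<Longrightarrow> ok (k X)" "\<And>X. X \<in> Obj C \<Longrightarrow> src (k X) = ?D"
      "\<And>X. X \<in> Obj C \<Longrightarrow> tgt (k X) = (X\<^sup>\<or> \<otimes>\<^sub>o ?P) \<otimes>\<^sub>o (X\<^sup>\<or>)\<^sup>\<or>"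
      "\<And>X. X \<in> Obj C \<Longrightarrow> pb (npair X q X) (k X) (ide (X\<^sup>\<or> \<otimes>\<^sub>o (?Q \<otimes>\<^sub>o X))) = pb ?e (ide ?D) (io ?Q X)"
    unfolding npair_simps by metis
  have din: "((dm f \<star> ide ?P) \<star> ide ((Y\<^sup>\<or>)\<^sup>\<or>)) \<bullet> k Y = (ide (X\<^sup>\<or> \<otimes>\<^sub>o ?P) \<star> dm (dm f)) \<bullet> k X"
    if f: "ok f" "src f = X" "tgt f = Y" for f X Y
  proof (rule lperf_pb_inj[OF lperf_npair[OF d]])
    show X: "X \<in> Obj C" and Y: "Y \<in> Obj C" using f by auto
    let ?i = "ide (Y\<^sup>\<or> \<otimes>\<^sub>o (?Q \<otimes>\<^sub>o X))"
    have "pb (npair X q Y) (((dm f \<star> ide ?P) \<star> ide ((Y\<^sup>\<or>)\<^sup>\<or>)) \<bullet> k Y) ?i =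
      pb (pb (npair X q Y) ((dm f \<star> ide ?P) \<star> ide ((Y\<^sup>\<or>)\<^sup>\<or>)) ?i) (k Y) ?i"
      using f X Y k(1-3) by simp
    also have "\<dots> = pb (pb (npair Y q Y) (k Y) (ide (Y\<^sup>\<or> \<otimes>\<^sub>o (?Q \<otimes>\<^sub>o Y)))) (ide ?D) (ide (Y\<^sup>\<or>) \<star> (ide ?Q \<star> f))"
      using f X Y k(1-3) by (simp add: npair_slide_left)
    also have "\<dots> = pb ?e (ide ?D) (io ?Q Y \<bullet> (ide (Y\<^sup>\<or>) \<star> (ide ?Q \<star> f)))"
      unfolding k(4)[OF Y] using f X Y by simp
    also have "\<dots> = pb ?e (ide ?D) (io ?Q X \<bullet> (dm f \<star> ide (?Q \<otimes>\<^sub>o X)))"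
      using io_dinat[of ?Q f X Y] f by simp
    also have "\<dots> = pb (pb (npair X q X) (k X) (ide (X\<^sup>\<or> \<otimes>\<^sub>o (?Q \<otimes>\<^sub>o X)))) (ide ?D) (dm f \<star> ide (?Q \<otimes>\<^sub>o X))"
      unfolding k(4)[OF X] using f X Y by simp
    also have "\<dots> = pb (pb (npair X q X) (ide ((X\<^sup>\<or> \<otimes>\<^sub>o ?P) \<otimes>\<^sub>o (X\<^sup>\<or>)\<^sup>\<or>)) (dm f \<star> ide (?Q \<otimes>\<^sub>o X))) (k X) ?i"
      using f X Y k(1-3) by simp
    also have "\<dots> = pb (npair X q Y) ((ide (X\<^sup>\<or> \<otimes>\<^sub>o ?P) \<star> dm (dm f)) \<bullet> k X) ?i"
      using f X Y k(1-3) by (simp add: npair_slide_right)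
    finally show "pb (npair X q Y) (((dm f \<star> ide ?P) \<star> ide ((Y\<^sup>\<or>)\<^sup>\<or>)) \<bullet> k Y) (ide (rob (npair X q Y))) =
      pb (npair X q Y) ((ide (X\<^sup>\<or> \<otimes>\<^sub>o ?P) \<star> dm (dm f)) \<bullet> k X) (ide (rob (npair X q Y)))"
      by simp
  qed (use f k(1-3) ok_obj[OF f(1)] in auto)
  obtain h where h: "ok h" "src h = ?D" "tgt h = Z ?P" "\<And>X. X \<in> Obj C \<Longrightarrow> pj ?P (X\<^sup>\<or>) \<bullet> h = k X"
    by (rule Z_dual_lift[of ?P ?D k, OF _ _ _ _ _ din]) (use k(1-3) in auto)
  have eh: "pb (Ep q) h (ide (A ?Q)) = ?e"
  proof (rule A_pairing_ext[of ?Q _ _ ?D])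
    fix X assume X: "X \<in> Obj C"
    have "pb (pb (Ep q) h (ide (A ?Q))) (ide ?D) (io ?Q X) = pb (pb (Ep q) (ide (Z ?P)) (io ?Q X)) h (ide (X\<^sup>\<or> \<otimes>\<^sub>o (?Q \<otimes>\<^sub>o X)))"
      using h X by simp
    also have "\<dots> = pb (npair X q X) (pj ?P (X\<^sup>\<or>) \<bullet> h) (ide (X\<^sup>\<or> \<otimes>\<^sub>o (?Q \<otimes>\<^sub>o X)))"
      unfolding Ep_props(4)[OF q X] using h(1-3) X by (simp add: fam_def)
    finally show "pb (pb (Ep q) h (ide (A ?Q))) (ide ?D) (io ?Q X) = pb ?e (ide ?D) (io ?Q X)"
      using h(4)[OF X] k(4)[OF X] by simp
  qed (use h in auto)
  obtain t where t: "ok t" "src t = Z ?P" "tgt t = ?D" "pb ?e t (ide (A ?Q)) = Ep q"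
    using lperf_pb_ex[OF lperf_evp[OF AQ], of "Ep q"] by auto
  have ht: "h \<bullet> t = ide (Z ?P)"
  proof (rule Ep_inj[OF d])
    have "pb (Ep q) (h \<bullet> t) (ide (A ?Q)) = pb (pb (Ep q) h (ide (A ?Q))) t (ide (A ?Q))"
      using h(1-3) t(1-3) by simp
    also have "\<dots> = Ep q" unfolding eh t(4) ..
    also have "\<dots> = pb (Ep q) (ide (Z ?P)) (ide (A ?Q))" using pb_ide[of "Ep q"] by simp
    finally show "pb (Ep q) (h \<bullet> t) (ide (A ?Q)) = pb (Ep q) (ide (Z ?P)) (ide (A ?Q))" .
  qed (use h t in auto)
  have th: "t \<bullet> h = ide ?D"
  proof (rule lperf_pb_inj[OF lperf_evp[OF AQ]])
    have "pb ?e (t \<bullet> h) (ide (A ?Q)) = pb (pb ?e t (ide (A ?Q))) h (ide (A ?Q))"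
      using h(1-3) t(1-3) by simp
    also have "\<dots> = ?e" unfolding t(4) eh ..
    also have "\<dots> = pb ?e (ide ?D) (ide (A ?Q))" using pb_ide[of ?e] by simp
    finally show "pb ?e (t \<bullet> h) (ide (rob ?e)) = pb ?e (ide ?D) (ide (rob ?e))" by simp
  qed (use h t in auto)
  note re = rperf_evp[OF AQ]
  have fe: "form (Ep q) = form ?e \<bullet> (t \<star> ide (A ?Q))" using t(4) by (metis pb_simps(3))
  show ?thesis
    unfolding rperf_def
  proof (intro conjI ballI allI impI; (elim conjE)?)
    show "pr (Ep q)" by simp
    fix W \<phi> assume W: "W \<in> Obj C" "ok \<phi>" "src \<phi> = lob (Ep q) \<otimes>\<^sub>o W" "tgt \<phi> = \<one>\<^sub>o"
    obtain x where x: "ok x" "src x = W" "tgt x = A ?Q" "form ?e \<bullet> (ide ?D \<star> x) = \<phi> \<bullet> (h \<star> ide W)"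
      using rperf_ex[OF re, of "\<phi> \<bullet> (h \<star> ide W)" W] W h by auto
    have "form (Ep q) \<bullet> (ide (Z ?P) \<star> x) = form ?e \<bullet> (ide ?D \<star> x) \<bullet> (t \<star> ide W)"
      unfolding fe using x(1-3) t(1-3) W by simp
    also have "\<dots> = (\<phi> \<bullet> (h \<star> ide W)) \<bullet> (t \<star> ide W)"
      by (rule cmp_reduce[OF x(4)]) (use x t W in auto)
    also have "\<dots> = \<phi>" using W h(1-3) t(1-3) ht by simp
    finally show "\<exists>x. ok x \<and> src x = W \<and> tgt x = rob (Ep q) \<and> form (Ep q) \<bullet> (ide (lob (Ep q)) \<star> x) = \<phi>"
      using x by (intro exI[of _ x]) auto
  next
    fix x y assume xy: "ok x" "ok y" "src x = src y" "tgt x = rob (Ep q)" "tgt y = rob (Ep q)"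
      "form (Ep q) \<bullet> (ide (lob (Ep q)) \<star> x) = form (Ep q) \<bullet> (ide (lob (Ep q)) \<star> y)"
    have w: "(form (Ep q) \<bullet> (ide (lob (Ep q)) \<star> w)) \<bullet> (h \<star> ide (src w)) = form ?e \<bullet> (ide ?D \<star> w)" if "ok w" "tgt w = A ?Q" for w
      unfolding fe using that h(1-3) t(1-3) th by simp
    have "form ?e \<bullet> (ide ?D \<star> x) = (form (Ep q) \<bullet> (ide (lob (Ep q)) \<star> x)) \<bullet> (h \<star> ide (src x))"
      by (rule w[symmetric]) (use xy in auto)
    also have "\<dots> = form ?e \<bullet> (ide ?D \<star> y)"
      unfolding xy(3,6) by (rule w) (use xy in auto)
    finally have "form ?e \<bullet> (ide ?D \<star> x) = form ?e \<bullet> (ide ?D \<star> y)" .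
    thus "x = y" using xy(1-5) rperf_inj[OF re, of x y] by simp
  qed
qed

end

section \<open>Rebracketing, adjunction and coevaluation\<close>

context finite_tensor_category
begin

text \<open>The associativity isomorphisms \<open>D ((B (V X)) Y) \<rightarrow> (D B) (V (X Y))\<close> and
  \<open>((X Y) V) (B D) \<rightarrow> (X ((Y V) B)) D\<close>, where juxtaposition is the tensor product.\<close>

definition aco :: "'o \<Rightarrow> 'o \<Rightarrow> 'o \<Rightarrow> 'o \<Rightarrow> 'o \<Rightarrow> ('o, 'm) arrow" where
  "aco D B V X Y = sa D B (V \<otimes>\<^sub>o (X \<otimes>\<^sub>o Y)) \<bullet> (ide D \<star> ((ide B \<star> as V X Y) \<bullet> as B (V \<otimes>\<^sub>o X) Y))"

definition zco :: "'o \<Rightarrow> 'o \<Rightarrow> 'o \<Rightarrow> 'o \<Rightarrow> 'o \<Rightarrow> ('o, 'm) arrow" where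
  "zco X Y V B D = ((as X (Y \<otimes>\<^sub>o V) B \<bullet> (as X Y V \<star> ide B)) \<star> ide D) \<bullet> sa ((X \<otimes>\<^sub>o Y) \<otimes>\<^sub>o V) B D"

lemma co_src_tgt [simp]:
  "src (aco D B V X Y) = D \<otimes>\<^sub>o ((B \<otimes>\<^sub>o (V \<otimes>\<^sub>o X)) \<otimes>\<^sub>o Y)" "tgt (aco D B V X Y) = (D \<otimes>\<^sub>o B) \<otimes>\<^sub>o (V \<otimes>\<^sub>o (X \<otimes>\<^sub>o Y))"
  "src (zco X Y V B D) = ((X \<otimes>\<^sub>o Y) \<otimes>\<^sub>o V) \<otimes>\<^sub>o (B \<otimes>\<^sub>o D)" "tgt (zco X Y V B D) = (X \<otimes>\<^sub>o ((Y \<otimes>\<^sub>o V) \<otimes>\<^sub>o B)) \<otimes>\<^sub>o D"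
  by (simp_all add: aco_def zco_def)

lemma ok_co [simp]:
  "D \<in> Obj C \<Longrightarrow> B \<in> Obj C \<Longrightarrow> V \<in> Obj C \<Longrightarrow> X \<in> Obj C \<Longrightarrow> Y \<in> Obj C \<Longrightarrow> ok (aco D B V X Y)"
  "D \<in> Obj C \<Longrightarrow> B \<in> Obj C \<Longrightarrow> V \<in> Obj C \<Longrightarrow> X \<in> Obj C \<Longrightarrow> Y \<in> Obj C \<Longrightarrow> ok (zco X Y V B D)"
  by (simp_all add: aco_def zco_def)

lemma raw_co: "raw (aco (Y\<^sup>\<or>) (X\<^sup>\<or>) V X Y) = A2_coherence C V X Y" "raw (zco X Y V (Y\<^sup>\<or>) (X\<^sup>\<or>)) = Z4_coherence C V X Y"
  by (simp_all add: aco_def zco_def A2_coherence_def Z4_coherence_def raw_simps)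

lemma zco_nat:
  assumes "ok f" "ok g" "ok v" "ok b" "ok d"
  shows "((f \<star> ((g \<star> v) \<star> b)) \<star> d) \<bullet> zco (src f) (src g) (src v) (src b) (src d) =
    zco (tgt f) (tgt g) (tgt v) (tgt b) (tgt d) \<bullet> (((f \<star> g) \<star> v) \<star> (b \<star> d))"
proof -
  let ?X = "tgt f" let ?Y = "tgt g" let ?V = "tgt v" let ?B = "tgt b" let ?D = "tgt d"
  have 1: "as ?X (?Y \<otimes>\<^sub>o ?V) ?B \<bullet> (as ?X ?Y ?V \<star> ide ?B) \<bullet> (((f \<star> g) \<star> v) \<star> b) =
    (f \<star> ((g \<star> v) \<star> b)) \<bullet> as (src f) (src g \<otimes>\<^sub>o src v) (src b) \<bullet> (as (src f) (src g) (src v) \<star> ide (src b))"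
  proof -
    have "as ?X (?Y \<otimes>\<^sub>o ?V) ?B \<bullet> (as ?X ?Y ?V \<star> ide ?B) \<bullet> (((f \<star> g) \<star> v) \<star> b) =
      as ?X (?Y \<otimes>\<^sub>o ?V) ?B \<bullet> ((as ?X ?Y ?V \<bullet> ((f \<star> g) \<star> v)) \<star> b)"
      using assms by simp
    also have "\<dots> = as ?X (?Y \<otimes>\<^sub>o ?V) ?B \<bullet> ((f \<star> (g \<star> v)) \<star> b) \<bullet> (as (src f) (src g) (src v) \<star> ide (src b))"
      by (subst as_nat) (use assms in auto)
    also have "\<dots> = (f \<star> ((g \<star> v) \<star> b)) \<bullet> as (src f) (src g \<otimes>\<^sub>o src v) (src b) \<bullet> (as (src f) (src g) (src v) \<star> ide (src b))"
      by (subst cmp_reduce[OF as_nat]) (use assms in auto)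
    finally show ?thesis .
  qed
  have "zco ?X ?Y ?V ?B ?D \<bullet> (((f \<star> g) \<star> v) \<star> (b \<star> d)) =
    ((as ?X (?Y \<otimes>\<^sub>o ?V) ?B \<bullet> (as ?X ?Y ?V \<star> ide ?B)) \<star> ide ?D) \<bullet> sa ((?X \<otimes>\<^sub>o ?Y) \<otimes>\<^sub>o ?V) ?B ?D \<bullet> (((f \<star> g) \<star> v) \<star> (b \<star> d))"
    using assms by (simp add: zco_def)
  also have "\<dots> = ((as ?X (?Y \<otimes>\<^sub>o ?V) ?B \<bullet> (as ?X ?Y ?V \<star> ide ?B)) \<star> ide ?D) \<bullet> ((((f \<star> g) \<star> v) \<star> b) \<star> d) \<bullet>
      sa ((src f \<otimes>\<^sub>o src g) \<otimes>\<^sub>o src v) (src b) (src d)"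
    by (subst sa_nat) (use assms in auto)
  also have "\<dots> = ((as ?X (?Y \<otimes>\<^sub>o ?V) ?B \<bullet> (as ?X ?Y ?V \<star> ide ?B) \<bullet> (((f \<star> g) \<star> v) \<star> b)) \<star> d) \<bullet>
      sa ((src f \<otimes>\<^sub>o src g) \<otimes>\<^sub>o src v) (src b) (src d)"
    using assms by simp
  also have "\<dots> = ((f \<star> ((g \<star> v) \<star> b)) \<star> d) \<bullet> zco (src f) (src g) (src v) (src b) (src d)"
    unfolding 1 using assms by (simp add: zco_def)
  finally show ?thesis ..
qed

text \<open>The two bracketings of five nested pairings that occur in the multiplication of the monad and in the
  comultiplication of the comonad; three applications of \<open>star_assoc\<close>.\<close>

lemma star_rebracket:
  assumes "pr y" "pr x" "pr q" "pr x'" "pr y'"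
  shows "pb (((y \<diamondop> x) \<diamondop> q) \<diamondop> (x' \<diamondop> y')) (ide (((lob y \<otimes>\<^sub>o lob x) \<otimes>\<^sub>o lob q) \<otimes>\<^sub>o (lob x' \<otimes>\<^sub>o lob y')))
      (aco (rob y') (rob x') (rob q) (rob x) (rob y)) =
    pb ((y \<diamondop> ((x \<diamondop> q) \<diamondop> x')) \<diamondop> y') (zco (lob y) (lob x) (lob q) (lob x') (lob y'))
      (ide (rob y' \<otimes>\<^sub>o ((rob x' \<otimes>\<^sub>o (rob q \<otimes>\<^sub>o rob x)) \<otimes>\<^sub>o rob y)))"
proof -
  let ?T = "(y \<diamondop> x) \<diamondop> q"
  let ?q = "as (rob q) (rob x) (rob y)" let ?p = "as (lob y) (lob x) (lob q)"
  let ?s = "as (lob y) (lob x \<otimes>\<^sub>o lob q) (lob x') \<bullet> (?p \<star> ide (lob x'))"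
  let ?m = "(ide (rob x') \<star> ?q) \<bullet> as (rob x') (rob q \<otimes>\<^sub>o rob x) (rob y)"
  let ?SA = "sa (lob ?T) (lob x') (lob y')"
  let ?SB = "sa (rob y') (rob x') (rob ?T)"
  note [simp] = assms
  have a: "pb (?T \<diamondop> (x' \<diamondop> y')) (ide (lob ?T \<otimes>\<^sub>o (lob x' \<otimes>\<^sub>o lob y'))) ?SB = pb ((?T \<diamondop> x') \<diamondop> y') ?SA (ide (rob y' \<otimes>\<^sub>o (rob x' \<otimes>\<^sub>o rob ?T)))"
  proof -
    have "pb (pb (?T \<diamondop> (x' \<diamondop> y')) (as (lob ?T) (lob x') (lob y')) (ide ((rob y' \<otimes>\<^sub>o rob x') \<otimes>\<^sub>o rob ?T))) ?SA ?SB =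
      pb (pb ((?T \<diamondop> x') \<diamondop> y') (ide ((lob ?T \<otimes>\<^sub>o lob x') \<otimes>\<^sub>o lob y')) (as (rob y') (rob x') (rob ?T))) ?SA ?SB"
      by (subst star_assoc) auto
    thus ?thesis by simp
  qed
  have "pb (pb (y \<diamondop> ((x \<diamondop> q) \<diamondop> x')) (as (lob y) (lob x \<otimes>\<^sub>o lob q) (lob x')) (ide ((rob x' \<otimes>\<^sub>o (rob q \<otimes>\<^sub>o rob x)) \<otimes>\<^sub>o rob y)))
      (?p \<star> ide (lob x')) (ide ((rob x' \<otimes>\<^sub>o (rob q \<otimes>\<^sub>o rob x)) \<otimes>\<^sub>o rob y)) =
    pb (pb ((y \<diamondop> (x \<diamondop> q)) \<diamondop> x') (ide ((lob y \<otimes>\<^sub>o (lob x \<otimes>\<^sub>o lob q)) \<otimes>\<^sub>o lob x')) (as (rob x') (rob q \<otimes>\<^sub>o rob x) (rob y)))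
      (?p \<star> ide (lob x')) (ide ((rob x' \<otimes>\<^sub>o (rob q \<otimes>\<^sub>o rob x)) \<otimes>\<^sub>o rob y))"
    using star_assoc[of y "x \<diamondop> q" x'] by simp
  also have "\<dots> = pb (pb (y \<diamondop> (x \<diamondop> q)) ?p (ide ((rob q \<otimes>\<^sub>o rob x) \<otimes>\<^sub>o rob y)) \<diamondop> x') (ide (((lob y \<otimes>\<^sub>o lob x) \<otimes>\<^sub>o lob q) \<otimes>\<^sub>o lob x')) (as (rob x') (rob q \<otimes>\<^sub>o rob x) (rob y))"
    by (simp add: star_pb_left)
  also have "\<dots> = pb (pb ?T (ide ((lob y \<otimes>\<^sub>o lob x) \<otimes>\<^sub>o lob q)) ?q \<diamondop> x') (ide (((lob y \<otimes>\<^sub>o lob x) \<otimes>\<^sub>o lob q) \<otimes>\<^sub>o lob x')) (as (rob x') (rob q \<otimes>\<^sub>o rob x) (rob y))"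
    by (subst star_assoc) auto
  finally have d: "pb (y \<diamondop> ((x \<diamondop> q) \<diamondop> x')) ?s (ide ((rob x' \<otimes>\<^sub>o (rob q \<otimes>\<^sub>o rob x)) \<otimes>\<^sub>o rob y)) = pb (?T \<diamondop> x') (ide (lob ?T \<otimes>\<^sub>o lob x')) ?m"
    by (simp add: star_pb_left)
  have "pb ((y \<diamondop> ((x \<diamondop> q) \<diamondop> x')) \<diamondop> y') ((?s \<star> ide (lob y')) \<bullet> ?SA) (ide (rob y' \<otimes>\<^sub>o ((rob x' \<otimes>\<^sub>o (rob q \<otimes>\<^sub>o rob x)) \<otimes>\<^sub>o rob y))) =
    pb (pb (y \<diamondop> ((x \<diamondop> q) \<diamondop> x')) ?s (ide ((rob x' \<otimes>\<^sub>o (rob q \<otimes>\<^sub>o rob x)) \<otimes>\<^sub>o rob y)) \<diamondop> y') ?SA (ide (rob y' \<otimes>\<^sub>o ((rob x' \<otimes>\<^sub>o (rob q \<otimes>\<^sub>o rob x)) \<otimes>\<^sub>o rob y)))"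
    by (simp add: star_pb_left)
  also have "\<dots> = pb (pb ((?T \<diamondop> x') \<diamondop> y') ?SA (ide (rob y' \<otimes>\<^sub>o (rob x' \<otimes>\<^sub>o rob ?T)))) (ide (lob ?T \<otimes>\<^sub>o (lob x' \<otimes>\<^sub>o lob y'))) (ide (rob y') \<star> ?m)"
    unfolding d by (simp add: star_pb_left)
  also have "\<dots> = pb (?T \<diamondop> (x' \<diamondop> y')) (ide (lob ?T \<otimes>\<^sub>o (lob x' \<otimes>\<^sub>o lob y'))) (?SB \<bullet> (ide (rob y') \<star> ?m))"
    unfolding a[symmetric] by simp
  finally show ?thesis by (simp add: aco_def zco_def)
qed

text \<open>The bijection between morphisms \<open>W \<rightarrow> (X \<otimes> T) \<otimes> Y\<^sup>\<or>\<close> and morphisms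
  \<open>X\<^sup>\<or> \<otimes> (W \<otimes> Y) \<rightarrow> T\<close>.\<close>

definition adj :: "'o \<Rightarrow> 'o \<Rightarrow> 'o \<Rightarrow> ('o, 'm) arrow \<Rightarrow> ('o, 'm) arrow" where
  "adj X Y T h = lact (evp X) T \<bullet> (ide (X\<^sup>\<or>) \<star> (ract (evp Y) (X \<otimes>\<^sub>o T) \<bullet> (h \<star> ide Y)))"

lemma adj_src_tgt [simp]: "src (adj X Y T h) = X\<^sup>\<or> \<otimes>\<^sub>o (src h \<otimes>\<^sub>o Y)" "tgt (adj X Y T h) = T"
  by (simp_all add: adj_def)

lemma adj_ok [simp]: "X \<in> Obj C \<Longrightarrow> Y \<in> Obj C \<Longrightarrow> T \<in> Obj C \<Longrightarrow> ok h \<Longrightarrow> tgt h = (X \<otimes>\<^sub>o T) \<otimes>\<^sub>o Y\<^sup>\<or> \<Longrightarrow> ok (adj X Y T h)"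
  by (simp add: adj_def)

lemma adj_nat:
  assumes "X \<in> Obj C" "Y \<in> Obj C" "ok t" "ok h" "tgt h = (X \<otimes>\<^sub>o src t) \<otimes>\<^sub>o Y\<^sup>\<or>"
  shows "adj X Y (tgt t) (((ide X \<star> t) \<star> ide (Y\<^sup>\<or>)) \<bullet> h) = t \<bullet> adj X Y (src t) h"
proof -
  have r: "ract (evp Y) (X \<otimes>\<^sub>o tgt t) \<bullet> ((((ide X \<star> t) \<star> ide (Y\<^sup>\<or>)) \<bullet> h) \<star> ide Y) = (ide X \<star> t) \<bullet> ract (evp Y) (X \<otimes>\<^sub>o src t) \<bullet> (h \<star> ide Y)"
  proof -
    have "ract (evp Y) (X \<otimes>\<^sub>o tgt t) \<bullet> ((((ide X \<star> t) \<star> ide (Y\<^sup>\<or>)) \<bullet> h) \<star> ide Y) =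
      (ract (evp Y) (X \<otimes>\<^sub>o tgt t) \<bullet> (((ide X \<star> t) \<star> ide (lob (evp Y))) \<star> ide (rob (evp Y)))) \<bullet> (h \<star> ide Y)"
      using assms by simp
    also have "\<dots> = ((ide X \<star> t) \<bullet> ract (evp Y) (X \<otimes>\<^sub>o src t)) \<bullet> (h \<star> ide Y)"
      by (subst ract_nat) (use assms in auto)
    finally show ?thesis using assms by simp
  qed
  have "adj X Y (tgt t) (((ide X \<star> t) \<star> ide (Y\<^sup>\<or>)) \<bullet> h) =
    (lact (evp X) (tgt t) \<bullet> (ide (lob (evp X)) \<star> (ide (rob (evp X)) \<star> t))) \<bullet> (ide (X\<^sup>\<or>) \<star> (ract (evp Y) (X \<otimes>\<^sub>o src t) \<bullet> (h \<star> ide Y)))"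
    unfolding adj_def r using assms by simp
  also have "\<dots> = (t \<bullet> lact (evp X) (src t)) \<bullet> (ide (X\<^sup>\<or>) \<star> (ract (evp Y) (X \<otimes>\<^sub>o src t) \<bullet> (h \<star> ide Y)))"
    by (subst lact_nat) (use assms in auto)
  finally show ?thesis using assms by (simp add: adj_def)
qed

lemma adj_inj:
  assumes "X \<in> Obj C" "Y \<in> Obj C" "T \<in> Obj C" "ok h" "tgt h = (X \<otimes>\<^sub>o T) \<otimes>\<^sub>o Y\<^sup>\<or>" "ok k" "tgt k = (X \<otimes>\<^sub>o T) \<otimes>\<^sub>o Y\<^sup>\<or>"
    "src h = src k" "adj X Y T h = adj X Y T k"
  shows "h = k"
proof (rule radj_inj[OF dual_evp[OF assms(2)], where M="X \<otimes>\<^sub>o T"])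
  show "ract (evp Y) (X \<otimes>\<^sub>o T) \<bullet> (h \<star> ide (rob (evp Y))) = ract (evp Y) (X \<otimes>\<^sub>o T) \<bullet> (k \<star> ide (rob (evp Y)))"
    by (rule ladj_inj[OF dual_evp[OF assms(1)], where M=T]) (use assms in \<open>auto simp: adj_def\<close>)
qed (use assms in auto)

lemma adj_surj:
  assumes "X \<in> Obj C" "Y \<in> Obj C" "W \<in> Obj C" "ok g" "src g = X\<^sup>\<or> \<otimes>\<^sub>o (W \<otimes>\<^sub>o Y)" "tgt g = T"
  obtains h where "ok h" "src h = W" "tgt h = (X \<otimes>\<^sub>o T) \<otimes>\<^sub>o Y\<^sup>\<or>" "adj X Y T h = g"
proof -
  obtain k where k: "ok k" "src k = W \<otimes>\<^sub>o Y" "tgt k = X \<otimes>\<^sub>o T" "lact (evp X) T \<bullet> (ide (X\<^sup>\<or>) \<star> k) = g"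
    using ladj_ex[OF dual_evp[OF assms(1)], of g "W \<otimes>\<^sub>o Y" T] assms by auto
  obtain h where h: "ok h" "src h = W" "tgt h = (X \<otimes>\<^sub>o T) \<otimes>\<^sub>o Y\<^sup>\<or>" "ract (evp Y) (X \<otimes>\<^sub>o T) \<bullet> (h \<star> ide Y) = k"
    using radj_ex[OF dual_evp[OF assms(2)], of k W "X \<otimes>\<^sub>o T"] k assms by auto
  show ?thesis by (rule that[of h]) (use h k in \<open>auto simp: adj_def\<close>)
qed

lemma coev_nat:
  assumes "ok f" "src f = X" "tgt f = Y"
  shows "(f \<star> ide (X\<^sup>\<or>)) \<bullet> coev X = (ide Y \<star> dm f) \<bullet> coev Y"
proof (rule radj_inj[OF dual_evp, where M=Y])
  show X: "X \<in> Obj C" and "Y \<in> Obj C" using assms by auto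
  note [simp] = this
  have z: "ract (evp W) W \<bullet> (coev W \<star> ide W) = lu W" if "W \<in> Obj C" for W
    using dual_zigzag_rob[OF dual_evp[OF that]] that by (simp add: ract_def)
  have "ract (evp X) Y \<bullet> (((f \<star> ide (X\<^sup>\<or>)) \<bullet> coev X) \<star> ide X) = (ract (evp X) Y \<bullet> ((f \<star> ide (lob (evp X))) \<star> ide (rob (evp X)))) \<bullet> (coev X \<star> ide X)"
    using assms by simp
  also have "\<dots> = (f \<bullet> ract (evp X) X) \<bullet> (coev X \<star> ide X)"
    by (subst ract_nat) (use assms in auto)
  also have "\<dots> = lu Y \<bullet> (ide \<one>\<^sub>o \<star> f)"
    using assms z[of X] lu_nat[of f Y] by simp
  also have "\<dots> = ract (evp Y) Y \<bullet> (coev Y \<star> ide Y) \<bullet> (ide \<one>\<^sub>o \<star> f)"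
    by (subst cmp_reduce[OF z]) (use assms in auto)
  also have "\<dots> = ru Y \<bullet> (ide Y \<star> form (pb (evp Y) (ide (Y\<^sup>\<or>)) f)) \<bullet> as Y (Y\<^sup>\<or>) X \<bullet> (coev Y \<star> ide X)"
  proof -
    have "ract (evp Y) Y \<bullet> (coev Y \<star> ide Y) \<bullet> (ide \<one>\<^sub>o \<star> f) = ru Y \<bullet> (ide Y \<star> form (evp Y)) \<bullet> as Y (Y\<^sup>\<or>) Y \<bullet> ((ide Y \<star> ide (Y\<^sup>\<or>)) \<star> f) \<bullet> (coev Y \<star> ide X)"
      using assms by (simp add: ract_def)
    also have "\<dots> = ru Y \<bullet> (ide Y \<star> form (evp Y)) \<bullet> (ide Y \<star> (ide (Y\<^sup>\<or>) \<star> f)) \<bullet> as Y (Y\<^sup>\<or>) X \<bullet> (coev Y \<star> ide X)"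
      by (subst cmp_reduce[OF as_nat]) (use assms in auto)
    finally show ?thesis using assms by simp
  qed
  also have "\<dots> = ru Y \<bullet> (ide Y \<star> form (pb (evp X) (dm f) (ide X))) \<bullet> as Y (Y\<^sup>\<or>) X \<bullet> (coev Y \<star> ide X)"
    using dm_slide[OF assms] by simp
  also have "\<dots> = ru Y \<bullet> (ide Y \<star> form (evp X)) \<bullet> (ide Y \<star> (dm f \<star> ide X)) \<bullet> as Y (Y\<^sup>\<or>) X \<bullet> (coev Y \<star> ide X)"
    using assms by simp
  also have "\<dots> = ru Y \<bullet> (ide Y \<star> form (evp X)) \<bullet> as Y (X\<^sup>\<or>) X \<bullet> ((ide Y \<star> dm f) \<star> ide X) \<bullet> (coev Y \<star> ide X)"
    by (subst cmp_reduce[OF as_nat]) (use assms in auto)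
  also have "\<dots> = ract (evp X) Y \<bullet> (((ide Y \<star> dm f) \<bullet> coev Y) \<star> ide X)"
    using assms by (simp add: ract_def)
  finally show "ract (evp X) Y \<bullet> (((f \<star> ide (X\<^sup>\<or>)) \<bullet> coev X) \<star> ide (rob (evp X))) =
    ract (evp X) Y \<bullet> (((ide Y \<star> dm f) \<bullet> coev Y) \<star> ide (rob (evp X)))" by simp
qed (use assms ok_obj[OF assms(1)] in auto)

text \<open>A zigzag identity: the inner pairing absorbs the coevaluation.\<close>

lemma star_coev:
  assumes d: "dual q c" and p: "pr p" and pq: "lob p = rob q"
  shows "form (p \<diamondop> q) \<bullet> (c \<star> ide (rob q \<otimes>\<^sub>o rob p)) = form p \<bullet> lu (rob q \<otimes>\<^sub>o rob p)"
proof -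
  note [simp] = dual_simps[OF d] p pq
  have z: "ract q (rob q) \<bullet> (c \<star> ide (rob q)) = lu (rob q)"
    using dual_zigzag_rob[OF d] by (simp add: ract_def)
  have "form (p \<diamondop> q) \<bullet> (c \<star> ide (rob q \<otimes>\<^sub>o rob p)) = form p \<bullet> (lu (rob q) \<star> ide (rob p)) \<bullet> sa \<one>\<^sub>o (rob q) (rob p)"
    using form_star_ract[of p q c] z by simp
  thus ?thesis by (simp add: lu_ten[symmetric])
qed

end

section \<open>Structure morphisms under the pairing\<close>

context coend_end_data
begin

text \<open>The isomorphism \<open>Y\<^sup>\<or> \<otimes> ((X\<^sup>\<or> \<otimes> (V \<otimes> X)) \<otimes> Y) \<rightarrow> (X \<otimes> Y)\<^sup>\<or> \<otimes> (V \<otimes> (X \<otimes> Y))\<close> that enters the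
  multiplication of the monad, and the morphism \<open>Z(V) \<rightarrow> (X \<otimes> ((Y \<otimes> V) \<otimes> Y\<^sup>\<or>)) \<otimes> X\<^sup>\<or>\<close> that defines the
  comultiplication of the comonad.\<close>

definition kap :: "'o \<Rightarrow> 'o \<Rightarrow> 'o \<Rightarrow> ('o, 'm) arrow" where
  "kap V X Y = (gam Y X \<star> ide (V \<otimes>\<^sub>o (X \<otimes>\<^sub>o Y))) \<bullet> aco (Y\<^sup>\<or>) (X\<^sup>\<or>) V X Y"

definition zet :: "'o \<Rightarrow> 'o \<Rightarrow> 'o \<Rightarrow> ('o, 'm) arrow" where
  "zet V X Y = zco X Y V (Y\<^sup>\<or>) (X\<^sup>\<or>) \<bullet> (ide ((X \<otimes>\<^sub>o Y) \<otimes>\<^sub>o V) \<star> igam Y X) \<bullet> pj V (X \<otimes>\<^sub>o Y)"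

lemma kap_zet_src_tgt [simp]:
  "src (kap V X Y) = Y\<^sup>\<or> \<otimes>\<^sub>o ((X\<^sup>\<or> \<otimes>\<^sub>o (V \<otimes>\<^sub>o X)) \<otimes>\<^sub>o Y)" "tgt (kap V X Y) = (X \<otimes>\<^sub>o Y)\<^sup>\<or> \<otimes>\<^sub>o (V \<otimes>\<^sub>o (X \<otimes>\<^sub>o Y))"
  "src (zet V X Y) = Z V" "tgt (zet V X Y) = (X \<otimes>\<^sub>o ((Y \<otimes>\<^sub>o V) \<otimes>\<^sub>o Y\<^sup>\<or>)) \<otimes>\<^sub>o X\<^sup>\<or>"
  by (simp_all add: kap_def zet_def)

lemma ok_kap_zet [simp]:
  "V \<in> Obj C \<Longrightarrow> X \<in> Obj C \<Longrightarrow> Y \<in> Obj C \<Longrightarrow> ok (kap V X Y)"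
  "V \<in> Obj C \<Longrightarrow> X \<in> Obj C \<Longrightarrow> Y \<in> Obj C \<Longrightarrow> ok (zet V X Y)"
  by (simp_all add: kap_def zet_def)

text \<open>The isomorphisms that define the multiplication and the comultiplication are adjoint to each other under
  the nested pairings.\<close>

lemma fam_kap:
  assumes q: "pr q" and X: "X \<in> Obj C" and Y: "Y \<in> Obj C"
  shows "pb (fam q (X \<otimes>\<^sub>o Y)) (ide (Z (lob q))) (kap (rob q) X Y) =
    pb (npair Y (npair X q X) Y) (zet (lob q) (Y\<^sup>\<or>) (X\<^sup>\<or>)) (ide (Y\<^sup>\<or> \<otimes>\<^sub>o ((X\<^sup>\<or> \<otimes>\<^sub>o (rob q \<otimes>\<^sub>o X)) \<otimes>\<^sub>o Y)))"
proof -
  let ?P = "lob q" let ?Q = "rob q" let ?XY = "X \<otimes>\<^sub>o Y" let ?YX = "Y\<^sup>\<or> \<otimes>\<^sub>o X\<^sup>\<or>"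
  let ?a = "aco (Y\<^sup>\<or>) (X\<^sup>\<or>) ?Q X Y"
  note [simp] = q X Y
  have 1: "pb (npair ?XY q ?XY) (ide ((?XY\<^sup>\<or> \<otimes>\<^sub>o ?P) \<otimes>\<^sub>o (?XY\<^sup>\<or>)\<^sup>\<or>)) (gam Y X \<star> ide (?Q \<otimes>\<^sub>o ?XY)) =
    pb ((evp ?XY \<diamondop> q) \<diamondop> evp ?YX) (ide (?XY\<^sup>\<or> \<otimes>\<^sub>o ?P) \<star> dm (gam Y X)) (ide (?YX \<otimes>\<^sub>o (?Q \<otimes>\<^sub>o ?XY)))"
  proof -
    have "(evp ?XY \<diamondop> q) \<diamondop> pb (evp (?XY\<^sup>\<or>)) (ide ((?XY\<^sup>\<or>)\<^sup>\<or>)) (gam Y X) = (evp ?XY \<diamondop> q) \<diamondop> pb (evp ?YX) (dm (gam Y X)) (ide ?YX)"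
      using dm_slide[of "gam Y X" ?YX "?XY\<^sup>\<or>"] by simp
    thus ?thesis by (simp add: star_pb_right npair_def)
  qed
  have "pb (fam q ?XY) (ide (Z ?P)) (kap ?Q X Y) =
    pb (pb (npair ?XY q ?XY) (ide ((?XY\<^sup>\<or> \<otimes>\<^sub>o ?P) \<otimes>\<^sub>o (?XY\<^sup>\<or>)\<^sup>\<or>)) (gam Y X \<star> ide (?Q \<otimes>\<^sub>o ?XY))) (pj ?P (?XY\<^sup>\<or>)) ?a"
    by (simp add: fam_def kap_def)
  also have "\<dots> = pb ((evp ?XY \<diamondop> q) \<diamondop> evp ?YX) ((ide (?XY\<^sup>\<or> \<otimes>\<^sub>o ?P) \<star> dm (gam Y X)) \<bullet> pj ?P (?XY\<^sup>\<or>)) ?a"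
    unfolding 1 by simp
  also have "(ide (?XY\<^sup>\<or> \<otimes>\<^sub>o ?P) \<star> dm (gam Y X)) \<bullet> pj ?P (?XY\<^sup>\<or>) = ((gam Y X \<star> ide ?P) \<star> ide (?YX\<^sup>\<or>)) \<bullet> pj ?P ?YX"
    by (rule pj_dinat[symmetric]) auto
  also have "pb ((evp ?XY \<diamondop> q) \<diamondop> evp ?YX) (((gam Y X \<star> ide ?P) \<star> ide (?YX\<^sup>\<or>)) \<bullet> pj ?P ?YX) ?a =
    pb ((pb (evp ?XY) (gam Y X) (ide ?XY) \<diamondop> q) \<diamondop> evp ?YX) (pj ?P ?YX) ?a"
    by (simp add: star_pb_left)
  also have "\<dots> = pb (((evp Y \<diamondop> evp X) \<diamondop> q) \<diamondop> evp ?YX) (pj ?P ?YX) ?a"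
    by (simp add: pb_gam)
  also have "evp ?YX = pb (evp (X\<^sup>\<or>) \<diamondop> evp (Y\<^sup>\<or>)) (igam (X\<^sup>\<or>) (Y\<^sup>\<or>)) (ide ?YX)"
  proof -
    have "pb (evp (X\<^sup>\<or>) \<diamondop> evp (Y\<^sup>\<or>)) (igam (X\<^sup>\<or>) (Y\<^sup>\<or>)) (ide ?YX) = pb (evp ?YX) (ide (?YX\<^sup>\<or>)) (ide ?YX)"
      by (simp add: pb_gam[symmetric])
    thus ?thesis using pb_ide[of "evp ?YX"] by simp
  qed
  also have "pb (((evp Y \<diamondop> evp X) \<diamondop> q) \<diamondop> pb (evp (X\<^sup>\<or>) \<diamondop> evp (Y\<^sup>\<or>)) (igam (X\<^sup>\<or>) (Y\<^sup>\<or>)) (ide ?YX)) (pj ?P ?YX) ?a =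
    pb (pb (((evp Y \<diamondop> evp X) \<diamondop> q) \<diamondop> (evp (X\<^sup>\<or>) \<diamondop> evp (Y\<^sup>\<or>))) (ide ((?YX \<otimes>\<^sub>o ?P) \<otimes>\<^sub>o ((X\<^sup>\<or>)\<^sup>\<or> \<otimes>\<^sub>o (Y\<^sup>\<or>)\<^sup>\<or>))) ?a)
      ((ide (?YX \<otimes>\<^sub>o ?P) \<star> igam (X\<^sup>\<or>) (Y\<^sup>\<or>)) \<bullet> pj ?P ?YX) (ide (src ?a))"
    by (simp add: star_pb_right)
  also have "\<dots> = pb (npair Y (npair X q X) Y) (zet ?P (Y\<^sup>\<or>) (X\<^sup>\<or>)) (ide (src ?a))"
    using star_rebracket[of "evp Y" "evp X" q "evp (X\<^sup>\<or>)" "evp (Y\<^sup>\<or>)"] by (simp add: npair_def zet_def)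
  finally show ?thesis by simp
qed

text \<open>The functor \<open>(X \<otimes> -) \<otimes> X'\<^sup>\<or>\<close> preserves the end, being a right adjoint.\<close>

lemma S_jointly_monic:
  assumes X: "X \<in> Obj C" and X': "X' \<in> Obj C" and V: "V \<in> Obj C"
    and uv: "ok u" "ok v" "tgt u = (X \<otimes>\<^sub>o Z V) \<otimes>\<^sub>o X'\<^sup>\<or>" "tgt v = (X \<otimes>\<^sub>o Z V) \<otimes>\<^sub>o X'\<^sup>\<or>" "src u = src v"
      "\<And>Y. Y \<in> Obj C \<Longrightarrow> ((ide X \<star> pj V Y) \<star> ide (X'\<^sup>\<or>)) \<bullet> u = ((ide X \<star> pj V Y) \<star> ide (X'\<^sup>\<or>)) \<bullet> v"
  shows "u = v"
proof (rule adj_inj[OF X X', where T="Z V"])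
  show "adj X X' (Z V) u = adj X X' (Z V) v"
  proof (rule Z_jointly_monic[OF V])
    fix Y assume Y: "Y \<in> Obj C"
    show "pj V Y \<bullet> adj X X' (Z V) u = pj V Y \<bullet> adj X X' (Z V) v"
      using adj_nat[OF X X', of "pj V Y" u] adj_nat[OF X X', of "pj V Y" v] uv(1-5) uv(6)[OF Y] Y V by simp
  qed (use X X' V uv in auto)
qed (use uv V in auto)

lemma S_lift:
  assumes X: "X \<in> Obj C" and X': "X' \<in> Obj C" and V: "V \<in> Obj C" and W: "W \<in> Obj C"
    and j: "\<And>Y. Y \<in> Obj C \<Longrightarrow> ok (j Y)" "\<And>Y. Y \<in> Obj C \<Longrightarrow> src (j Y) = W"
      "\<And>Y. Y \<in> Obj C \<Longrightarrow> tgt (j Y) = (X \<otimes>\<^sub>o ((Y \<otimes>\<^sub>o V) \<otimes>\<^sub>o Y\<^sup>\<or>)) \<otimes>\<^sub>o X'\<^sup>\<or>"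
    and din: "\<And>f Y Y'. ok f \<Longrightarrow> src f = Y \<Longrightarrow> tgt f = Y' \<Longrightarrow>
      ((ide X \<star> ((f \<star> ide V) \<star> ide (Y\<^sup>\<or>))) \<star> ide (X'\<^sup>\<or>)) \<bullet> j Y = ((ide X \<star> (ide (Y' \<otimes>\<^sub>o V) \<star> dm f)) \<star> ide (X'\<^sup>\<or>)) \<bullet> j Y'"
  obtains d where "ok d" "src d = W" "tgt d = (X \<otimes>\<^sub>o Z V) \<otimes>\<^sub>o X'\<^sup>\<or>" "\<And>Y. Y \<in> Obj C \<Longrightarrow> ((ide X \<star> pj V Y) \<star> ide (X'\<^sup>\<or>)) \<bullet> d = j Y"
proof -
  let ?k = "\<lambda>Y. adj X X' ((Y \<otimes>\<^sub>o V) \<otimes>\<^sub>o Y\<^sup>\<or>) (j Y)"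
  have dk: "((f \<star> ide V) \<star> ide (Y\<^sup>\<or>)) \<bullet> ?k Y = (ide (Y' \<otimes>\<^sub>o V) \<star> dm f) \<bullet> ?k Y'"
    if f: "ok f" "src f = Y" "tgt f = Y'" for f Y Y'
  proof -
    have Y: "Y \<in> Obj C" "Y' \<in> Obj C" using f by auto
    have "((f \<star> ide V) \<star> ide (Y\<^sup>\<or>)) \<bullet> ?k Y = adj X X' ((Y' \<otimes>\<^sub>o V) \<otimes>\<^sub>o Y\<^sup>\<or>) (((ide X \<star> ((f \<star> ide V) \<star> ide (Y\<^sup>\<or>))) \<star> ide (X'\<^sup>\<or>)) \<bullet> j Y)"
      using adj_nat[OF X X', of "(f \<star> ide V) \<star> ide (Y\<^sup>\<or>)" "j Y"] f Y V j by simp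
    also have "\<dots> = adj X X' ((Y' \<otimes>\<^sub>o V) \<otimes>\<^sub>o Y\<^sup>\<or>) (((ide X \<star> (ide (Y' \<otimes>\<^sub>o V) \<star> dm f)) \<star> ide (X'\<^sup>\<or>)) \<bullet> j Y')"
      by (simp only: din[OF f])
    also have "\<dots> = (ide (Y' \<otimes>\<^sub>o V) \<star> dm f) \<bullet> ?k Y'"
      using adj_nat[OF X X', of "ide (Y' \<otimes>\<^sub>o V) \<star> dm f" "j Y'"] f Y V j by simp
    finally show ?thesis .
  qed
  obtain g where g: "ok g" "src g = X\<^sup>\<or> \<otimes>\<^sub>o (W \<otimes>\<^sub>o X')" "tgt g = Z V" "\<And>Y. Y \<in> Obj C \<Longrightarrow> pj V Y \<bullet> g = ?k Y"
    by (rule Z_lift[of V "X\<^sup>\<or> \<otimes>\<^sub>o (W \<otimes>\<^sub>o X')" ?k, OF _ _ _ _ _ dk]) (use X X' V W j in auto)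
  obtain d where d: "ok d" "src d = W" "tgt d = (X \<otimes>\<^sub>o Z V) \<otimes>\<^sub>o X'\<^sup>\<or>" "adj X X' (Z V) d = g"
    by (rule adj_surj[OF X X' W g(1,2,3)])
  have "((ide X \<star> pj V Y) \<star> ide (X'\<^sup>\<or>)) \<bullet> d = j Y" if Y: "Y \<in> Obj C" for Y
    by (rule adj_inj[OF X X', where T="(Y \<otimes>\<^sub>o V) \<otimes>\<^sub>o Y\<^sup>\<or>"])
      (use adj_nat[OF X X', of "pj V Y" d] d g(4)[OF Y] Y X X' V j in auto)
  with d that show ?thesis by blast
qed

lemma zet_dinat:
  assumes V: "V \<in> Obj C" and g: "ok g" "src g = X" "tgt g = X'" and f: "ok f" "src f = Y" "tgt f = Y'"
  shows "((g \<star> ((f \<star> ide V) \<star> ide (Y\<^sup>\<or>))) \<star> ide (X\<^sup>\<or>)) \<bullet> zet V X Y = ((ide X' \<star> (ide (Y' \<otimes>\<^sub>o V) \<star> dm f)) \<star> dm g) \<bullet> zet V X' Y'"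
proof -
  have [simp]: "X \<in> Obj C" "X' \<in> Obj C" "Y \<in> Obj C" "Y' \<in> Obj C" "V \<in> Obj C" using f g V by auto
  note [simp] = g f
  have "((g \<star> ((f \<star> ide V) \<star> ide (Y\<^sup>\<or>))) \<star> ide (X\<^sup>\<or>)) \<bullet> zet V X Y =
    (((g \<star> ((f \<star> ide V) \<star> ide (Y\<^sup>\<or>))) \<star> ide (X\<^sup>\<or>)) \<bullet> zco (src g) (src f) (src (ide V)) (src (ide (Y\<^sup>\<or>))) (src (ide (X\<^sup>\<or>)))) \<bullet>
    (ide ((X \<otimes>\<^sub>o Y) \<otimes>\<^sub>o V) \<star> igam Y X) \<bullet> pj V (X \<otimes>\<^sub>o Y)"
    by (simp add: zet_def)
  also have "\<dots> = zco X' Y' V (Y\<^sup>\<or>) (X\<^sup>\<or>) \<bullet> (ide ((X' \<otimes>\<^sub>o Y') \<otimes>\<^sub>o V) \<star> igam Y X) \<bullet> (((g \<star> f) \<star> ide V) \<star> ide ((X \<otimes>\<^sub>o Y)\<^sup>\<or>)) \<bullet> pj V (X \<otimes>\<^sub>o Y)"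
    by (subst zco_nat) auto
  also have "\<dots> = zco X' Y' V (Y\<^sup>\<or>) (X\<^sup>\<or>) \<bullet> (ide ((X' \<otimes>\<^sub>o Y') \<otimes>\<^sub>o V) \<star> igam Y X) \<bullet> (ide ((X' \<otimes>\<^sub>o Y') \<otimes>\<^sub>o V) \<star> dm (g \<star> f)) \<bullet> pj V (X' \<otimes>\<^sub>o Y')"
    using pj_dinat[of V "g \<star> f" "X \<otimes>\<^sub>o Y" "X' \<otimes>\<^sub>o Y'"] by simp
  also have "\<dots> = zco X' Y' V (Y\<^sup>\<or>) (X\<^sup>\<or>) \<bullet> (ide ((X' \<otimes>\<^sub>o Y') \<otimes>\<^sub>o V) \<star> (igam Y X \<bullet> dm (g \<star> f))) \<bullet> pj V (X' \<otimes>\<^sub>o Y')"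
    by simp
  also have "igam Y X \<bullet> dm (g \<star> f) = (dm f \<star> dm g) \<bullet> igam Y' X'"
    by (rule igam_nat) auto
  also have "zco X' Y' V (Y\<^sup>\<or>) (X\<^sup>\<or>) \<bullet> (ide ((X' \<otimes>\<^sub>o Y') \<otimes>\<^sub>o V) \<star> ((dm f \<star> dm g) \<bullet> igam Y' X')) \<bullet> pj V (X' \<otimes>\<^sub>o Y') =
    (zco (tgt (ide X')) (tgt (ide Y')) (tgt (ide V)) (tgt (dm f)) (tgt (dm g)) \<bullet> (((ide X' \<star> ide Y') \<star> ide V) \<star> (dm f \<star> dm g))) \<bullet>
      (ide ((X' \<otimes>\<^sub>o Y') \<otimes>\<^sub>o V) \<star> igam Y' X') \<bullet> pj V (X' \<otimes>\<^sub>o Y')"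
    by simp
  also have "\<dots> = (((ide X' \<star> ((ide Y' \<star> ide V) \<star> dm f)) \<star> dm g) \<bullet> zco (src (ide X')) (src (ide Y')) (src (ide V)) (src (dm f)) (src (dm g))) \<bullet>
      (ide ((X' \<otimes>\<^sub>o Y') \<otimes>\<^sub>o V) \<star> igam Y' X') \<bullet> pj V (X' \<otimes>\<^sub>o Y')"
    by (subst zco_nat) auto
  also have "\<dots> = ((ide X' \<star> (ide (Y' \<otimes>\<^sub>o V) \<star> dm f)) \<star> dm g) \<bullet> zet V X' Y'"
    by (simp add: zet_def)
  finally show ?thesis .
qed

text \<open>The comultiplication of the comonad.\<close>

definition delta :: "'o \<Rightarrow> ('o, 'm) arrow" where
  "delta V = Arr (Z V) (Z4_comult C Z \<pi> V) (Z (Z V))"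

lemma delta_src_tgt [simp]: "src (delta V) = Z V" "tgt (delta V) = Z (Z V)"
  by (simp_all add: delta_def)

lemma delta_props:
  assumes V: "V \<in> Obj C"
  shows "ok (delta V)" "X \<in> Obj C \<Longrightarrow> Y \<in> Obj C \<Longrightarrow> ((ide X \<star> pj V Y) \<star> ide (X\<^sup>\<or>)) \<bullet> pj (Z V) X \<bullet> delta V = zet V X Y"
proof -
  note [simp] = V
  have "\<forall>X\<in>Obj C. \<exists>d. ok d \<and> src d = Z V \<and> tgt d = (X \<otimes>\<^sub>o Z V) \<otimes>\<^sub>o X\<^sup>\<or> \<and> (\<forall>Y\<in>Obj C. ((ide X \<star> pj V Y) \<star> ide (X\<^sup>\<or>)) \<bullet> d = zet V X Y)"
  proof
    fix X assume X [simp]: "X \<in> Obj C"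
    have din: "((ide X \<star> ((f \<star> ide V) \<star> ide (Y\<^sup>\<or>))) \<star> ide (X\<^sup>\<or>)) \<bullet> zet V X Y = ((ide X \<star> (ide (Y' \<otimes>\<^sub>o V) \<star> dm f)) \<star> ide (X\<^sup>\<or>)) \<bullet> zet V X Y'"
      if "ok f" "src f = Y" "tgt f = Y'" for f Y Y'
      using zet_dinat[of V "ide X" X X f Y Y'] that by simp
    show "\<exists>d. ok d \<and> src d = Z V \<and> tgt d = (X \<otimes>\<^sub>o Z V) \<otimes>\<^sub>o X\<^sup>\<or> \<and> (\<forall>Y\<in>Obj C. ((ide X \<star> pj V Y) \<star> ide (X\<^sup>\<or>)) \<bullet> d = zet V X Y)"
      by (rule S_lift[of X X V "Z V" "zet V X", OF _ _ _ _ _ _ _ din]) auto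
  qed
  from bchoice[OF this] obtain d where d: "\<And>X. X \<in> Obj C \<Longrightarrow> ok (d X)" "\<And>X. X \<in> Obj C \<Longrightarrow> src (d X) = Z V"
    "\<And>X. X \<in> Obj C \<Longrightarrow> tgt (d X) = (X \<otimes>\<^sub>o Z V) \<otimes>\<^sub>o X\<^sup>\<or>"
    "\<And>X Y. X \<in> Obj C \<Longrightarrow> Y \<in> Obj C \<Longrightarrow> ((ide X \<star> pj V Y) \<star> ide (X\<^sup>\<or>)) \<bullet> d X = zet V X Y" by blast
  have din: "((g \<star> ide (Z V)) \<star> ide (X\<^sup>\<or>)) \<bullet> d X = (ide (X' \<otimes>\<^sub>o Z V) \<star> dm g) \<bullet> d X'"
    if g: "ok g" "src g = X" "tgt g = X'" for g X X'
  proof (rule S_jointly_monic[of X' X V])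
    show X [simp]: "X' \<in> Obj C" "X \<in> Obj C" using g by auto
    note [simp] = g d(1-3)
    fix Y assume Y [simp]: "Y \<in> Obj C"
    have "((ide X' \<star> pj V Y) \<star> ide (X\<^sup>\<or>)) \<bullet> ((g \<star> ide (Z V)) \<star> ide (X\<^sup>\<or>)) \<bullet> d X =
      ((g \<star> ide ((Y \<otimes>\<^sub>o V) \<otimes>\<^sub>o Y\<^sup>\<or>)) \<star> ide (X\<^sup>\<or>)) \<bullet> ((ide X \<star> pj V Y) \<star> ide (X\<^sup>\<or>)) \<bullet> d X"
      by simp
    also have "\<dots> = ((g \<star> ((ide Y \<star> ide V) \<star> ide (Y\<^sup>\<or>))) \<star> ide (X\<^sup>\<or>)) \<bullet> zet V X Y"
      by (simp add: d(4))
    also have "\<dots> = ((ide X' \<star> (ide (Y \<otimes>\<^sub>o V) \<star> dm (ide Y))) \<star> dm g) \<bullet> zet V X' Y"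
      by (rule zet_dinat) auto
    also have "\<dots> = (ide (X' \<otimes>\<^sub>o ((Y \<otimes>\<^sub>o V) \<otimes>\<^sub>o Y\<^sup>\<or>)) \<star> dm g) \<bullet> ((ide X' \<star> pj V Y) \<star> ide (X'\<^sup>\<or>)) \<bullet> d X'"
      by (simp add: d(4))
    also have "\<dots> = ((ide X' \<star> pj V Y) \<star> ide (X\<^sup>\<or>)) \<bullet> (ide (X' \<otimes>\<^sub>o Z V) \<star> dm g) \<bullet> d X'"
      by simp
    finally show "((ide X' \<star> pj V Y) \<star> ide (X\<^sup>\<or>)) \<bullet> ((g \<star> ide (Z V)) \<star> ide (X\<^sup>\<or>)) \<bullet> d X =
      ((ide X' \<star> pj V Y) \<star> ide (X\<^sup>\<or>)) \<bullet> (ide (X' \<otimes>\<^sub>o Z V) \<star> dm g) \<bullet> d X'" .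
  qed (use g d(1-3) ok_obj[OF g(1)] in auto)
  obtain h where h: "ok h" "src h = Z V" "tgt h = Z (Z V)" "\<And>X. X \<in> Obj C \<Longrightarrow> pj (Z V) X \<bullet> h = d X"
    by (rule Z_lift[of "Z V" "Z V" d, OF _ _ _ _ _ din]) (use d(1-3) in auto)
  have hz: "((ide X \<star> pj V Y) \<star> ide (X\<^sup>\<or>)) \<bullet> pj (Z V) X \<bullet> h = zet V X Y" if "X \<in> Obj C" "Y \<in> Obj C" for X Y
    using d(4) h(4) that by simp
  have "Z4_comult C Z \<pi> V = raw h"
    unfolding Z4_comult_def
  proof (rule the_arrow_eq[OF h(1-3)])
    show "\<forall>X\<in>Obj C. \<forall>Y\<in>Obj C. ((\<i>\<d> X \<otimes>\<^sub>m \<pi> V Y) \<otimes>\<^sub>m \<i>\<d> (X\<^sup>\<or>)) \<cdot> \<pi> (Z V) X \<cdot> raw h =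
        Z4_coherence C V X Y \<cdot> (\<i>\<d> ((X \<otimes>\<^sub>o Y) \<otimes>\<^sub>o V) \<otimes>\<^sub>m inverse_arr C (dual_tensor C Y X)) \<cdot> \<pi> V (X \<otimes>\<^sub>o Y)"
    proof (intro ballI)
      fix X Y assume "X \<in> Obj C" "Y \<in> Obj C"
      from arg_cong[OF hz[OF this], of raw]
      show "((\<i>\<d> X \<otimes>\<^sub>m \<pi> V Y) \<otimes>\<^sub>m \<i>\<d> (X\<^sup>\<or>)) \<cdot> \<pi> (Z V) X \<cdot> raw h =
        Z4_coherence C V X Y \<cdot> (\<i>\<d> ((X \<otimes>\<^sub>o Y) \<otimes>\<^sub>o V) \<otimes>\<^sub>m inverse_arr C (dual_tensor C Y X)) \<cdot> \<pi> V (X \<otimes>\<^sub>o Y)"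
        by (simp add: raw_simps raw_io_pj zet_def raw_co raw_gam igam_def inv_of_def)
    qed
  next
    fix k assume k: "ok k" "src k = Z V" "tgt k = Z (Z V)"
      "\<forall>X\<in>Obj C. \<forall>Y\<in>Obj C. ((\<i>\<d> X \<otimes>\<^sub>m \<pi> V Y) \<otimes>\<^sub>m \<i>\<d> (X\<^sup>\<or>)) \<cdot> \<pi> (Z V) X \<cdot> raw k =
        Z4_coherence C V X Y \<cdot> (\<i>\<d> ((X \<otimes>\<^sub>o Y) \<otimes>\<^sub>o V) \<otimes>\<^sub>m inverse_arr C (dual_tensor C Y X)) \<cdot> \<pi> V (X \<otimes>\<^sub>o Y)"
    have kz: "((ide X \<star> pj V Y) \<star> ide (X\<^sup>\<or>)) \<bullet> pj (Z V) X \<bullet> k = zet V X Y" if X: "X \<in> Obj C" "Y \<in> Obj C" for X Y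
      by (rule arrow_eqI)
        (use k(1-3) k(4)[rule_format, OF X] in \<open>simp_all add: raw_simps raw_io_pj zet_def raw_co raw_gam igam_def inv_of_def\<close>)
    show "k = h"
    proof (rule Z_jointly_monic[of "Z V"])
      fix X assume X: "X \<in> Obj C"
      show "pj (Z V) X \<bullet> k = pj (Z V) X \<bullet> h"
        by (rule S_jointly_monic[of X X V]) (use X k(1-3) h(1-3) kz[OF X] hz[OF X] in auto)
    qed (use k h in auto)
  qed
  hence a: "delta V = h" unfolding delta_def using h by (intro arrow_eqI) auto
  show "ok (delta V)" "X \<in> Obj C \<Longrightarrow> Y \<in> Obj C \<Longrightarrow> ((ide X \<star> pj V Y) \<star> ide (X\<^sup>\<or>)) \<bullet> pj (Z V) X \<bullet> delta V = zet V X Y"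
    unfolding a using h hz by auto
qed

declare delta_props(1) [simp]

text \<open>The multiplication of the monad.\<close>

definition mu :: "'o \<Rightarrow> ('o, 'm) arrow" where
  "mu V = Arr (A (A V)) (A2_mult C A \<iota> V) (A V)"

lemma mu_src_tgt [simp]: "src (mu V) = A (A V)" "tgt (mu V) = A V"
  by (simp_all add: mu_def)

lemma AA_ext:
  assumes V: "V \<in> Obj C" and uv: "ok u" "ok v" "src u = A (A V)" "src v = A (A V)" "tgt u = tgt v"
    "\<And>X Y. X \<in> Obj C \<Longrightarrow> Y \<in> Obj C \<Longrightarrow>
      u \<bullet> io (A V) Y \<bullet> (ide (Y\<^sup>\<or>) \<star> (io V X \<star> ide Y)) = v \<bullet> io (A V) Y \<bullet> (ide (Y\<^sup>\<or>) \<star> (io V X \<star> ide Y))"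
  shows "u = v"
proof (rule A_ext[of "A V"])
  fix Y assume Y: "Y \<in> Obj C"
  show "u \<bullet> io (A V) Y = v \<bullet> io (A V) Y"
  proof (rule jointly_epicD[OF jointly_epic_ten_left[OF jointly_epic_ten_right[OF A_jointly_epic[OF V] Y]]])
    fix e assume "e \<in> (\<lambda>e. ide (Y\<^sup>\<or>) \<star> e) ` (\<lambda>e. e \<star> ide Y) ` io V ` Obj C"
    then obtain X where "X \<in> Obj C" "e = ide (Y\<^sup>\<or>) \<star> (io V X \<star> ide Y)" by auto
    thus "(u \<bullet> io (A V) Y) \<bullet> e = (v \<bullet> io (A V) Y) \<bullet> e" using uv Y V by simp
  qed (use uv V Y in auto)
qed (use V uv in auto)

text \<open>The multiplication is the transpose of the comultiplication. Existence is part of the proof: right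
  perfectness of \<open>Ep q\<close> gives a morphism \<open>m\<close> with the second property, and \<open>fam_kap\<close> shows that \<open>m\<close>
  satisfies the defining equations of the multiplication.\<close>

lemma mu_props:
  assumes d: "dual q c"
  shows "ok (mu (rob q))" "pb (Ep q) (ide (Z (lob q))) (mu (rob q)) = pb (Ep (Ep q)) (delta (lob q)) (ide (A (A (rob q))))"
proof -
  let ?P = "lob q" let ?Q = "rob q" let ?e = "Ep q"
  have q [simp]: "pr q" using d by (rule dual_simps)
  note re = Ep_rperf[OF d]
  obtain m where m: "ok m" "src m = A (A ?Q)" "tgt m = A ?Q" "pb ?e (ide (Z ?P)) m = pb (Ep ?e) (delta ?P) (ide (A (A ?Q)))"
    using rperf_pb_ex[OF re, of "pb (Ep ?e) (delta ?P) (ide (A (A ?Q)))"] by auto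
  have mk: "m \<bullet> io (A ?Q) Y \<bullet> (ide (Y\<^sup>\<or>) \<star> (io ?Q X \<star> ide Y)) = io ?Q (X \<otimes>\<^sub>o Y) \<bullet> kap ?Q X Y"
    if XY [simp]: "X \<in> Obj C" "Y \<in> Obj C" for X Y
  proof (rule rperf_pb_inj[OF re])
    let ?T = "ide (Y\<^sup>\<or>) \<star> (io ?Q X \<star> ide Y)" let ?i = "ide (Y\<^sup>\<or> \<otimes>\<^sub>o ((X\<^sup>\<or> \<otimes>\<^sub>o (?Q \<otimes>\<^sub>o X)) \<otimes>\<^sub>o Y))"
    have "pb ?e (ide (Z ?P)) (m \<bullet> io (A ?Q) Y \<bullet> ?T) = pb (pb ?e (ide (Z ?P)) m) (ide (Z ?P)) (io (A ?Q) Y \<bullet> ?T)"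
      using m(1-3) by simp
    also have "\<dots> = pb (pb (Ep ?e) (ide (Z (lob ?e))) (io (rob ?e) Y)) (delta ?P) ?T"
      unfolding m(4) by simp
    also have "\<dots> = pb (pb (npair Y ?e Y) (ide ((Y\<^sup>\<or> \<otimes>\<^sub>o Z ?P) \<otimes>\<^sub>o (Y\<^sup>\<or>)\<^sup>\<or>)) ?T) (pj (Z ?P) (Y\<^sup>\<or>) \<bullet> delta ?P) ?i"
      by (subst Ep_props(4)) (auto simp: fam_def)
    also have "pb (npair Y ?e Y) (ide ((Y\<^sup>\<or> \<otimes>\<^sub>o Z ?P) \<otimes>\<^sub>o (Y\<^sup>\<or>)\<^sup>\<or>)) ?T = npair Y (pb ?e (ide (Z ?P)) (io ?Q X)) Y"
      by (simp add: npair_pb)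
    also have "\<dots> = pb (npair Y (npair X q X) Y) ((ide (Y\<^sup>\<or>) \<star> pj ?P (X\<^sup>\<or>)) \<star> ide ((Y\<^sup>\<or>)\<^sup>\<or>)) ?i"
      by (simp add: Ep_props(4) fam_def npair_pb)
    also have "pb (pb (npair Y (npair X q X) Y) ((ide (Y\<^sup>\<or>) \<star> pj ?P (X\<^sup>\<or>)) \<star> ide ((Y\<^sup>\<or>)\<^sup>\<or>)) ?i) (pj (Z ?P) (Y\<^sup>\<or>) \<bullet> delta ?P) ?i =
      pb (npair Y (npair X q X) Y) (zet ?P (Y\<^sup>\<or>) (X\<^sup>\<or>)) ?i"
      by (simp add: delta_props(2))
    also have "\<dots> = pb (fam q (X \<otimes>\<^sub>o Y)) (ide (Z ?P)) (kap ?Q X Y)"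
      by (rule fam_kap[symmetric]) auto
    also have "\<dots> = pb ?e (ide (Z ?P)) (io ?Q (X \<otimes>\<^sub>o Y) \<bullet> kap ?Q X Y)"
      by (simp add: Ep_props(4)[symmetric])
    finally show "pb ?e (ide (lob ?e)) (m \<bullet> io (A ?Q) Y \<bullet> ?T) = pb ?e (ide (lob ?e)) (io ?Q (X \<otimes>\<^sub>o Y) \<bullet> kap ?Q X Y)" by simp
  qed (use m in auto)
  have "A2_mult C A \<iota> ?Q = raw m"
    unfolding A2_mult_def
  proof (rule the_arrow_eq[OF m(1-3)])
    show "\<forall>X\<in>Obj C. \<forall>Y\<in>Obj C. raw m \<cdot> \<iota> (A ?Q) Y \<cdot> (\<i>\<d> (Y\<^sup>\<or>) \<otimes>\<^sub>m (\<iota> ?Q X \<otimes>\<^sub>m \<i>\<d> Y)) =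
        \<iota> ?Q (X \<otimes>\<^sub>o Y) \<cdot> (dual_tensor C Y X \<otimes>\<^sub>m \<i>\<d> (?Q \<otimes>\<^sub>o (X \<otimes>\<^sub>o Y))) \<cdot> A2_coherence C ?Q X Y"
    proof (intro ballI)
      fix X Y assume "X \<in> Obj C" "Y \<in> Obj C"
      from arg_cong[OF mk[OF this], of raw]
      show "raw m \<cdot> \<iota> (A ?Q) Y \<cdot> (\<i>\<d> (Y\<^sup>\<or>) \<otimes>\<^sub>m (\<iota> ?Q X \<otimes>\<^sub>m \<i>\<d> Y)) =
        \<iota> ?Q (X \<otimes>\<^sub>o Y) \<cdot> (dual_tensor C Y X \<otimes>\<^sub>m \<i>\<d> (?Q \<otimes>\<^sub>o (X \<otimes>\<^sub>o Y))) \<cdot> A2_coherence C ?Q X Y"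
        by (simp add: raw_simps raw_io_pj kap_def raw_co raw_gam)
    qed
  next
    fix k assume k: "ok k" "src k = A (A ?Q)" "tgt k = A ?Q"
      "\<forall>X\<in>Obj C. \<forall>Y\<in>Obj C. raw k \<cdot> \<iota> (A ?Q) Y \<cdot> (\<i>\<d> (Y\<^sup>\<or>) \<otimes>\<^sub>m (\<iota> ?Q X \<otimes>\<^sub>m \<i>\<d> Y)) =
        \<iota> ?Q (X \<otimes>\<^sub>o Y) \<cdot> (dual_tensor C Y X \<otimes>\<^sub>m \<i>\<d> (?Q \<otimes>\<^sub>o (X \<otimes>\<^sub>o Y))) \<cdot> A2_coherence C ?Q X Y"
    have kk: "k \<bullet> io (A ?Q) Y \<bullet> (ide (Y\<^sup>\<or>) \<star> (io ?Q X \<star> ide Y)) = io ?Q (X \<otimes>\<^sub>o Y) \<bullet> kap ?Q X Y" if X: "X \<in> Obj C" "Y \<in> Obj C" for X Y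
      by (rule arrow_eqI)
        (use k(1-3) k(4)[rule_format, OF X] in \<open>simp_all add: raw_simps raw_io_pj kap_def raw_co raw_gam\<close>)
    show "k = m"
      by (rule AA_ext[of ?Q]) (use k(1-3) m(1-3) kk mk in auto)
  qed
  hence a: "mu ?Q = m" unfolding mu_def using m by (intro arrow_eqI) auto
  show "ok (mu ?Q)" "pb ?e (ide (Z ?P)) (mu ?Q) = pb (Ep ?e) (delta ?P) (ide (A (A ?Q)))"
    unfolding a using m by auto
qed

text \<open>The counit of the monad and the unit of the comonad.\<close>

definition eps :: "('o, 'm) arrow" where
  "eps = Arr (A \<one>\<^sub>o) (A2_counit C A \<iota>) \<one>\<^sub>o"

definition uni :: "('o, 'm) arrow" where
  "uni = Arr \<one>\<^sub>o (Z4_unit C Z \<pi>) (Z \<one>\<^sub>o)"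

lemma eps_uni_src_tgt [simp]: "src eps = A \<one>\<^sub>o" "tgt eps = \<one>\<^sub>o" "src uni = \<one>\<^sub>o" "tgt uni = Z \<one>\<^sub>o"
  by (simp_all add: eps_def uni_def)

lemma eps_props:
  "ok eps" "X \<in> Obj C \<Longrightarrow> eps \<bullet> io \<one>\<^sub>o X = form (evp X) \<bullet> (ide (X\<^sup>\<or>) \<star> lu X)"
proof -
  let ?j = "\<lambda>X. form (evp X) \<bullet> (ide (X\<^sup>\<or>) \<star> lu X)"
  have din: "?j X \<bullet> (dm f \<star> ide (\<one>\<^sub>o \<otimes>\<^sub>o X)) = ?j Y \<bullet> (ide (Y\<^sup>\<or>) \<star> (ide \<one>\<^sub>o \<star> f))"
    if f: "ok f" "src f = X" "tgt f = Y" for f X Y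
  proof -
    have [simp]: "X \<in> Obj C" "Y \<in> Obj C" using f by auto
    have "?j X \<bullet> (dm f \<star> ide (\<one>\<^sub>o \<otimes>\<^sub>o X)) = form (pb (evp X) (dm f) (ide X)) \<bullet> (ide (Y\<^sup>\<or>) \<star> lu X)"
      using f by simp
    also have "\<dots> = form (pb (evp Y) (ide (Y\<^sup>\<or>)) f) \<bullet> (ide (Y\<^sup>\<or>) \<star> lu X)"
      using dm_slide[OF f] by simp
    also have "\<dots> = form (evp Y) \<bullet> (ide (Y\<^sup>\<or>) \<star> (f \<bullet> lu X))" using f by simp
    also have "f \<bullet> lu X = lu Y \<bullet> (ide \<one>\<^sub>o \<star> f)" using lu_nat[of f Y] f by simp
    finally show ?thesis using f by simp
  qed
  obtain h where h: "ok h" "src h = A \<one>\<^sub>o" "tgt h = \<one>\<^sub>o" "\<And>X. X \<in> Obj C \<Longrightarrow> h \<bullet> io \<one>\<^sub>o X = ?j X"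
    by (rule A_desc[of "\<one>\<^sub>o" "\<one>\<^sub>o" ?j, OF _ _ _ _ _ din]) auto
  have re: "raw (form (evp X)) = Ev C X" for X by (simp add: evp_def)
  have "(THE r. r \<in> homset C (A \<one>\<^sub>o) \<one>\<^sub>o \<and> (\<forall>X\<in>Obj C. r \<cdot> \<iota> \<one>\<^sub>o X = Ev C X \<cdot> (\<i>\<d> (X\<^sup>\<or>) \<otimes>\<^sub>m LUnit C X))) = raw h"
  proof (rule the_arrow_eq[OF h(1-3)])
    show "\<forall>X\<in>Obj C. raw h \<cdot> \<iota> \<one>\<^sub>o X = Ev C X \<cdot> (\<i>\<d> (X\<^sup>\<or>) \<otimes>\<^sub>m LUnit C X)"
      using arg_cong[OF h(4), of _ raw] by (simp add: raw_simps raw_io_pj re)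
  next
    fix k assume k: "ok k" "src k = A \<one>\<^sub>o" "tgt k = \<one>\<^sub>o" "\<forall>X\<in>Obj C. raw k \<cdot> \<iota> \<one>\<^sub>o X = Ev C X \<cdot> (\<i>\<d> (X\<^sup>\<or>) \<otimes>\<^sub>m LUnit C X)"
    show "k = h"
    proof (rule A_ext[of "\<one>\<^sub>o"])
      fix X assume "X \<in> Obj C"
      thus "k \<bullet> io \<one>\<^sub>o X = h \<bullet> io \<one>\<^sub>o X"
        unfolding h(4) by (intro arrow_eqI) (use k h in \<open>auto simp: raw_simps raw_io_pj re\<close>)
    qed (use h k in auto)
  qed
  hence "A2_counit C A \<iota> = raw h" unfolding A2_counit_def .
  hence a: "eps = h" unfolding eps_def using h by (intro arrow_eqI) auto
  show "ok eps" "X \<in> Obj C \<Longrightarrow> eps \<bullet> io \<one>\<^sub>o X = ?j X"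
    unfolding a using h by auto
qed

lemma uni_props:
  "ok uni" "X \<in> Obj C \<Longrightarrow> pj \<one>\<^sub>o X \<bullet> uni = (ur X \<star> ide (X\<^sup>\<or>)) \<bullet> coev X"
proof -
  let ?j = "\<lambda>X. (ur X \<star> ide (X\<^sup>\<or>)) \<bullet> coev X"
  have din: "((f \<star> ide \<one>\<^sub>o) \<star> ide (X\<^sup>\<or>)) \<bullet> ?j X = (ide (Y \<otimes>\<^sub>o \<one>\<^sub>o) \<star> dm f) \<bullet> ?j Y"
    if f: "ok f" "src f = X" "tgt f = Y" for f X Y
  proof -
    have [simp]: "X \<in> Obj C" "Y \<in> Obj C" using f by auto
    have "((f \<star> ide \<one>\<^sub>o) \<star> ide (X\<^sup>\<or>)) \<bullet> ?j X = (((f \<star> ide \<one>\<^sub>o) \<bullet> ur X) \<star> ide (X\<^sup>\<or>)) \<bullet> coev X" using f by simp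
    also have "(f \<star> ide \<one>\<^sub>o) \<bullet> ur X = ur Y \<bullet> f" using ur_nat[of f Y] f by simp
    also have "((ur Y \<bullet> f) \<star> ide (X\<^sup>\<or>)) \<bullet> coev X = (ur Y \<star> ide (X\<^sup>\<or>)) \<bullet> (f \<star> ide (X\<^sup>\<or>)) \<bullet> coev X" using f by simp
    also have "(f \<star> ide (X\<^sup>\<or>)) \<bullet> coev X = (ide Y \<star> dm f) \<bullet> coev Y" by (rule coev_nat[OF f])
    finally show ?thesis using f by simp
  qed
  obtain h where h: "ok h" "src h = \<one>\<^sub>o" "tgt h = Z \<one>\<^sub>o" "\<And>X. X \<in> Obj C \<Longrightarrow> pj \<one>\<^sub>o X \<bullet> h = ?j X"
    by (rule Z_lift[of "\<one>\<^sub>o" "\<one>\<^sub>o" ?j, OF _ _ _ _ _ din]) auto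
  have re: "raw (coev X) = Coev C X" for X by (simp add: coev_def)
  have "(THE r. r \<in> homset C \<one>\<^sub>o (Z \<one>\<^sub>o) \<and> (\<forall>X\<in>Obj C. \<pi> \<one>\<^sub>o X \<cdot> r = (inverse_arr C (RUnit C X) \<otimes>\<^sub>m \<i>\<d> (X\<^sup>\<or>)) \<cdot> Coev C X)) = raw h"
  proof (rule the_arrow_eq[OF h(1-3)])
    show "\<forall>X\<in>Obj C. \<pi> \<one>\<^sub>o X \<cdot> raw h = (inverse_arr C (RUnit C X) \<otimes>\<^sub>m \<i>\<d> (X\<^sup>\<or>)) \<cdot> Coev C X"
      using arg_cong[OF h(4), of _ raw] by (simp add: raw_simps raw_io_pj re)
  next
    fix k assume k: "ok k" "src k = \<one>\<^sub>o" "tgt k = Z \<one>\<^sub>o" "\<forall>X\<in>Obj C. \<pi> \<one>\<^sub>o X \<cdot> raw k = (inverse_arr C (RUnit C X) \<otimes>\<^sub>m \<i>\<d> (X\<^sup>\<or>)) \<cdot> Coev C X"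
    show "k = h"
    proof (rule Z_jointly_monic[of "\<one>\<^sub>o"])
      fix X assume "X \<in> Obj C"
      thus "pj \<one>\<^sub>o X \<bullet> k = pj \<one>\<^sub>o X \<bullet> h"
        unfolding h(4) by (intro arrow_eqI) (use k h in \<open>auto simp: raw_simps raw_io_pj re\<close>)
    qed (use h k in auto)
  qed
  hence "Z4_unit C Z \<pi> = raw h" unfolding Z4_unit_def .
  hence a: "uni = h" unfolding uni_def using h by (intro arrow_eqI) auto
  show "ok uni" "X \<in> Obj C \<Longrightarrow> pj \<one>\<^sub>o X \<bullet> uni = ?j X"
    unfolding a using h by auto
qed

declare eps_props(1) [simp] uni_props(1) [simp]

text \<open>The unit of the comonad is the transpose of the counit of the monad.\<close>

lemma Ep_unit: "pb (Ep unit_pairing) uni (ide (A \<one>\<^sub>o)) = pb unit_pairing (ide \<one>\<^sub>o) eps"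
proof (rule A_pairing_ext[of "\<one>\<^sub>o" _ _ "\<one>\<^sub>o"])
  fix X assume X [simp]: "X \<in> Obj C"
  let ?u = "unit_pairing" let ?X' = "X\<^sup>\<or>"
  have n: "npair X ?u X = pb (evp X \<diamondop> evp ?X') (ru ?X' \<star> ide (?X'\<^sup>\<or>)) (ide ?X' \<star> lu X)"
    by (simp add: npair_def star_unit_pairing star_pb_left)
  have c: "src (lu X) = \<one>\<^sub>o \<otimes>\<^sub>o X" by simp
  have "pb (pb (Ep ?u) uni (ide (A \<one>\<^sub>o))) (ide \<one>\<^sub>o) (io \<one>\<^sub>o X) = pb (pb (Ep ?u) (ide (Z (lob ?u))) (io (rob ?u) X)) uni (ide (?X' \<otimes>\<^sub>o (\<one>\<^sub>o \<otimes>\<^sub>o X)))"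
    by simp
  also have "\<dots> = pb (npair X ?u X) (pj \<one>\<^sub>o ?X' \<bullet> uni) (ide (?X' \<otimes>\<^sub>o (\<one>\<^sub>o \<otimes>\<^sub>o X)))"
    by (subst Ep_props(4)) (auto simp: fam_def)
  also have "\<dots> = pb (evp X \<diamondop> evp ?X') (coev ?X') (ide ?X' \<star> lu X)"
    by (simp add: n uni_props(2))
  also have "\<dots> = pb ?u (ide \<one>\<^sub>o) (eps \<bullet> io \<one>\<^sub>o X)"
  proof (rule pairing_eqI)
    have "form (pb (evp X \<diamondop> evp ?X') (coev ?X') (ide ?X' \<star> lu X)) =
      (form (evp X \<diamondop> evp ?X') \<bullet> (coev ?X' \<star> ide (rob (evp ?X') \<otimes>\<^sub>o rob (evp X)))) \<bullet> (ide \<one>\<^sub>o \<star> (ide ?X' \<star> lu X))"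
      by simp
    also have "\<dots> = form (evp X) \<bullet> lu (?X' \<otimes>\<^sub>o X) \<bullet> (ide \<one>\<^sub>o \<star> (ide ?X' \<star> lu X))"
      by (subst star_coev[OF dual_evp]) auto
    also have "\<dots> = lu \<one>\<^sub>o \<bullet> (ide \<one>\<^sub>o \<star> (form (evp X) \<bullet> (ide ?X' \<star> lu X)))"
      by (simp add: lu_nat)
    finally show "form (pb (evp X \<diamondop> evp ?X') (coev ?X') (ide ?X' \<star> lu X)) = form (pb ?u (ide \<one>\<^sub>o) (eps \<bullet> io \<one>\<^sub>o X))"
      by (simp add: eps_props(2))
  qed auto
  finally show "pb (pb (Ep ?u) uni (ide (A \<one>\<^sub>o))) (ide \<one>\<^sub>o) (io \<one>\<^sub>o X) = pb (pb ?u (ide \<one>\<^sub>o) eps) (ide \<one>\<^sub>o) (io \<one>\<^sub>o X)"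
    by simp
qed auto

lemma amor_ide [simp]: "V \<in> Obj C \<Longrightarrow> amor (ide V) = ide (A V)"
  by (rule A_ext[of V]) (use amor_props(2)[of "ide V"] in auto)

lemma zmor_ide [simp]: "V \<in> Obj C \<Longrightarrow> zmor (ide V) = ide (Z V)"
  by (rule Z_jointly_monic[of V]) (use zmor_props(2)[of "ide V"] in auto)

text \<open>The morphism \<open>Z(D\<^sup>\<or>) \<rightarrow> \<one>\<close> obtained by pairing with \<open>f : \<one> \<rightarrow> A(D)\<close>.\<close>

definition Phi :: "'o \<Rightarrow> ('o, 'm) arrow \<Rightarrow> ('o, 'm) arrow" where
  "Phi D f = form (Ep (evp D)) \<bullet> (ide (Z (D\<^sup>\<or>)) \<star> f) \<bullet> ur (Z (D\<^sup>\<or>))"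

lemma Phi_src_tgt [simp]: "D \<in> Obj C \<Longrightarrow> tgt (Phi D f) = \<one>\<^sub>o" "src (Phi D f) = Z (D\<^sup>\<or>)"
  by (simp_all add: Phi_def)

lemma ok_Phi [simp]: "D \<in> Obj C \<Longrightarrow> ok f \<Longrightarrow> src f = \<one>\<^sub>o \<Longrightarrow> tgt f = A D \<Longrightarrow> ok (Phi D f)"
  by (simp add: Phi_def)

lemma Phi_pb:
  assumes "D \<in> Obj C" "ok f" "src f = \<one>\<^sub>o" "tgt f = A D"
  shows "pb (Ep (evp D)) (ide (Z (D\<^sup>\<or>))) f = pb unit_pairing (Phi D f) (ide \<one>\<^sub>o)"
proof (rule pairing_eqI)
  show "form (pb (Ep (evp D)) (ide (Z (D\<^sup>\<or>))) f) = form (pb unit_pairing (Phi D f) (ide \<one>\<^sub>o))"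
    using assms ru_nat[of "Phi D f" "\<one>\<^sub>o"] by (simp add: lu_one_eq_ru_one) (simp add: Phi_def)
qed (use assms in auto)

text \<open>Both equations are tested against perfect pairings: the first against \<open>Ep (evp D)\<close>, the second against
  \<open>Ep unit_pairing\<close>.\<close>

lemma Phi_cointegral:
  assumes D: "D \<in> Obj C" and f: "ok f" "src f = \<one>\<^sub>o" "tgt f = A D"
  shows "f \<bullet> eps = mu D \<bullet> amor f \<longleftrightarrow> uni \<bullet> Phi D f = zmor (Phi D f) \<bullet> delta (D\<^sup>\<or>)"
proof -
  let ?e = "Ep (evp D)" let ?Z = "Z (D\<^sup>\<or>)" let ?g = "Phi D f" let ?u = "unit_pairing"
  note [simp] = D f
  note d = dual_evp[OF D]
  note m = mu_props[OF d, simplified]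
  note [simp] = m(1)
  have 1: "pb ?e (ide ?Z) (f \<bullet> eps) = pb (Ep ?u) (uni \<bullet> ?g) (ide (A \<one>\<^sub>o))"
  proof -
    have "pb ?e (ide ?Z) (f \<bullet> eps) = pb (pb ?e (ide ?Z) f) (ide ?Z) eps" by simp
    also have "\<dots> = pb (pb ?u (ide \<one>\<^sub>o) eps) ?g (ide (A \<one>\<^sub>o))" by (simp add: Phi_pb)
    also have "\<dots> = pb (Ep ?u) (uni \<bullet> ?g) (ide (A \<one>\<^sub>o))" unfolding Ep_unit[symmetric] by simp
    finally show ?thesis .
  qed
  have 2: "pb ?e (ide ?Z) (mu D \<bullet> amor f) = pb (Ep ?u) (zmor ?g \<bullet> delta (D\<^sup>\<or>)) (ide (A \<one>\<^sub>o))"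
  proof -
    have "pb ?e (ide ?Z) (mu D \<bullet> amor f) = pb (pb ?e (ide ?Z) (mu D)) (ide ?Z) (amor f)" by simp
    also have "\<dots> = pb (pb (Ep ?e) (zmor (ide ?Z)) (amor f)) (delta (D\<^sup>\<or>)) (ide (A \<one>\<^sub>o))"
      unfolding m(2) by simp
    also have "pb (Ep ?e) (zmor (ide ?Z)) (amor f) = Ep (pb ?e (ide ?Z) f)"
      by (rule Ep_nat[symmetric]) auto
    also have "\<dots> = pb (Ep ?u) (zmor ?g) (amor (ide \<one>\<^sub>o))"
      unfolding Phi_pb[OF D f] by (rule Ep_nat) auto
    finally show ?thesis by simp
  qed
  have "f \<bullet> eps = mu D \<bullet> amor f \<longleftrightarrow> pb ?e (ide ?Z) (f \<bullet> eps) = pb ?e (ide ?Z) (mu D \<bullet> amor f)"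
  proof
    assume "pb ?e (ide ?Z) (f \<bullet> eps) = pb ?e (ide ?Z) (mu D \<bullet> amor f)"
    thus "f \<bullet> eps = mu D \<bullet> amor f" by (intro rperf_pb_inj[OF Ep_rperf[OF d]]) auto
  qed simp
  also have "\<dots> \<longleftrightarrow> pb (Ep ?u) (uni \<bullet> ?g) (ide (A \<one>\<^sub>o)) = pb (Ep ?u) (zmor ?g \<bullet> delta (D\<^sup>\<or>)) (ide (A \<one>\<^sub>o))"
    unfolding 1 2 ..
  also have "\<dots> \<longleftrightarrow> uni \<bullet> ?g = zmor ?g \<bullet> delta (D\<^sup>\<or>)"
  proof
    assume "pb (Ep ?u) (uni \<bullet> ?g) (ide (A \<one>\<^sub>o)) = pb (Ep ?u) (zmor ?g \<bullet> delta (D\<^sup>\<or>)) (ide (A \<one>\<^sub>o))"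
    thus "uni \<bullet> ?g = zmor ?g \<bullet> delta (D\<^sup>\<or>)" by (intro Ep_inj[OF dual_unit_pairing]) auto
  qed simp
  finally show ?thesis .
qed

end

section \<open>The isomorphism of cointegral spaces\<close>

lemma vectorspace_restrict:
  assumes "vectorspace K V" "S \<subseteq> carrier V" "\<zero>\<^bsub>V\<^esub> \<in> S"
    and "\<And>x y. x \<in> S \<Longrightarrow> y \<in> S \<Longrightarrow> x \<oplus>\<^bsub>V\<^esub> y \<in> S"
    and "\<And>a x. a \<in> carrier K \<Longrightarrow> x \<in> S \<Longrightarrow> a \<odot>\<^bsub>V\<^esub> x \<in> S"
  shows "vectorspace K (V\<lparr>carrier := S\<rparr>)"
proof -
  interpret vectorspace K V by fact
  have "subspace K S V"
    unfolding subspace_def submodule_def using assms module_axioms by auto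
  thus ?thesis by (rule subspace_is_vs)
qed

context coend_end_data
begin

lemma ok_Arr: "X \<in> Obj C \<Longrightarrow> Y \<in> Obj C \<Longrightarrow> r \<in> homset C X Y \<Longrightarrow> ok (Arr X r Y)"
  unfolding ok_def by simp

lemma arrow_eq_iff: "src f = src g \<Longrightarrow> tgt f = tgt g \<Longrightarrow> f = g \<longleftrightarrow> raw f = raw g"
  by (auto intro: arrow_eqI)

lemma monadic_iff:
  assumes "D \<in> Obj C"
  shows "r \<in> carrier (right_monadic_cointegrals C A \<iota> D) \<longleftrightarrow>
    r \<in> homset C \<one>\<^sub>o (A D) \<and> Arr \<one>\<^sub>o r (A D) \<bullet> eps = mu D \<bullet> amor (Arr \<one>\<^sub>o r (A D))"
  unfolding right_monadic_cointegrals_def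
  by (simp add: arrow_eq_iff raw_simps eps_def mu_def amor_def)

lemma categorical_iff:
  assumes "D \<in> Obj C"
  shows "r \<in> carrier (categorical_cointegrals C Z \<pi> D) \<longleftrightarrow>
    r \<in> homset C (Z (D\<^sup>\<or>)) \<one>\<^sub>o \<and> uni \<bullet> Arr (Z (D\<^sup>\<or>)) r \<one>\<^sub>o = zmor (Arr (Z (D\<^sup>\<or>)) r \<one>\<^sub>o) \<bullet> delta (D\<^sup>\<or>)"
  unfolding categorical_cointegrals_def
  by (simp add: arrow_eq_iff raw_simps uni_def delta_def zmor_def)

lemma cointegrals_iso:
  assumes D: "D \<in> Obj C"
  defines "M \<equiv> right_monadic_cointegrals C A \<iota> D" and "N \<equiv> categorical_cointegrals C Z \<pi> D"
  shows "\<exists>\<Phi>. linear_map K M N \<Phi> \<and> bij_betw \<Phi> (carrier M) (carrier N)"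
proof -
  note [simp] = D
  let ?e = "Ep (evp D)" let ?Z = "Z (D\<^sup>\<or>)"
  let ?H = "Hom C \<one>\<^sub>o (A D)" and ?G = "Hom C ?Z \<one>\<^sub>o"
  have d: "dual (evp D) (coev D)" by (rule dual_evp) simp
  have mu_ok: "ok (mu D)" using mu_props(1)[OF d] by simp
  interpret H: vectorspace K ?H by (rule hom_vectorspace) auto
  interpret G: vectorspace K ?G by (rule hom_vectorspace) auto
  have M: "M = ?H\<lparr>carrier := carrier M\<rparr>" and N: "N = ?G\<lparr>carrier := carrier N\<rparr>"
    unfolding M_def N_def right_monadic_cointegrals_def categorical_cointegrals_def by simp_all
  have MH: "carrier M \<subseteq> carrier ?H" and NG: "carrier N \<subseteq> carrier ?G"
    unfolding M_def N_def using monadic_iff[OF D] categorical_iff[OF D] by auto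

  \<comment> \<open>the defining condition, tested against the universal dinatural transformation, is linear\<close>
  define a where "a X = raw (eps \<bullet> io \<one>\<^sub>o X)" for X
  define b where "b X = raw (mu D \<bullet> io (A D) X)" for X
  let ?T = "\<lambda>X V. X\<^sup>\<or> \<otimes>\<^sub>o (V \<otimes>\<^sub>o X)"
  have ab: "a X \<in> homset C (?T X \<one>\<^sub>o) \<one>\<^sub>o" "b X \<in> homset C (?T X (A D)) (A D)" if "X \<in> Obj C" for X
    using ok_raw[of "eps \<bullet> io \<one>\<^sub>o X"] ok_raw[of "mu D \<bullet> io (A D) X"] mu_ok that by (simp_all add: a_def b_def)
  have T: "\<i>\<d> (X\<^sup>\<or>) \<otimes>\<^sub>m (r \<otimes>\<^sub>m \<i>\<d> X) \<in> homset C (?T X \<one>\<^sub>o) (?T X (A D))"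
    if "X \<in> Obj C" "r \<in> carrier ?H" for X r
    using that by (intro tensor_mor_closed ide_closed) auto
  have MI: "r \<in> carrier M \<longleftrightarrow> r \<in> carrier ?H \<and> (\<forall>X\<in>Obj C. r \<cdot> a X = b X \<cdot> (\<i>\<d> (X\<^sup>\<or>) \<otimes>\<^sub>m (r \<otimes>\<^sub>m \<i>\<d> X)))" for r
  proof -
    let ?f = "Arr \<one>\<^sub>o r (A D)"
    have "?f \<bullet> eps = mu D \<bullet> amor ?f \<longleftrightarrow> (\<forall>X\<in>Obj C. r \<cdot> a X = b X \<cdot> (\<i>\<d> (X\<^sup>\<or>) \<otimes>\<^sub>m (r \<otimes>\<^sub>m \<i>\<d> X)))"
      if r: "r \<in> carrier ?H"
    proof -
      have f [simp]: "ok ?f" using r by (intro ok_Arr) auto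
      have "?f \<bullet> eps = mu D \<bullet> amor ?f \<longleftrightarrow> (\<forall>X\<in>Obj C. (?f \<bullet> eps) \<bullet> io \<one>\<^sub>o X = (mu D \<bullet> amor ?f) \<bullet> io \<one>\<^sub>o X)"
      proof
        assume e: "?f \<bullet> eps = mu D \<bullet> amor ?f"
        show "\<forall>X\<in>Obj C. (?f \<bullet> eps) \<bullet> io \<one>\<^sub>o X = (mu D \<bullet> amor ?f) \<bullet> io \<one>\<^sub>o X" unfolding e by blast
      next
        assume e: "\<forall>X\<in>Obj C. (?f \<bullet> eps) \<bullet> io \<one>\<^sub>o X = (mu D \<bullet> amor ?f) \<bullet> io \<one>\<^sub>o X"
        show "?f \<bullet> eps = mu D \<bullet> amor ?f"
          by (rule A_ext[of "\<one>\<^sub>o", OF _ _ _ _ _ _ e[rule_format]]) (use mu_ok in auto)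
      qed
      also have "\<dots> \<longleftrightarrow> (\<forall>X\<in>Obj C. ?f \<bullet> (eps \<bullet> io \<one>\<^sub>o X) = (mu D \<bullet> io (A D) X) \<bullet> (ide (X\<^sup>\<or>) \<star> (?f \<star> ide X)))"
        using amor_props(2)[OF f] mu_ok by simp
      also have "\<dots> \<longleftrightarrow> (\<forall>X\<in>Obj C. r \<cdot> a X = b X \<cdot> (\<i>\<d> (X\<^sup>\<or>) \<otimes>\<^sub>m (r \<otimes>\<^sub>m \<i>\<d> X)))"
        unfolding a_def b_def by (intro ball_cong refl, subst arrow_eq_iff) (simp_all add: raw_simps del: cmp_assoc)
      finally show ?thesis .
    qed
    thus ?thesis unfolding M_def monadic_iff[OF D] by auto
  qed
  have Madd: "x \<oplus>\<^bsub>?H\<^esub> y \<in> carrier M" if "x \<in> carrier M" "y \<in> carrier M" for x y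
    unfolding MI
  proof (intro conjI ballI)
    have xy: "x \<in> carrier ?H" "y \<in> carrier ?H" using that MH by auto
    show "x \<oplus>\<^bsub>?H\<^esub> y \<in> carrier ?H" using xy by simp
    fix X assume X: "X \<in> Obj C"
    have "(x \<oplus>\<^bsub>?H\<^esub> y) \<cdot> a X = (x \<cdot> a X) \<oplus>\<^bsub>Hom C (?T X \<one>\<^sub>o) (A D)\<^esub> (y \<cdot> a X)"
      using xy ab X by (intro comp_add_left) auto
    also have "\<dots> = (b X \<cdot> (\<i>\<d> (X\<^sup>\<or>) \<otimes>\<^sub>m (x \<otimes>\<^sub>m \<i>\<d> X))) \<oplus>\<^bsub>Hom C (?T X \<one>\<^sub>o) (A D)\<^esub> (b X \<cdot> (\<i>\<d> (X\<^sup>\<or>) \<otimes>\<^sub>m (y \<otimes>\<^sub>m \<i>\<d> X)))"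
      using that X unfolding MI by simp
    also have "\<dots> = b X \<cdot> ((\<i>\<d> (X\<^sup>\<or>) \<otimes>\<^sub>m (x \<otimes>\<^sub>m \<i>\<d> X)) \<oplus>\<^bsub>Hom C (?T X \<one>\<^sub>o) (?T X (A D))\<^esub> (\<i>\<d> (X\<^sup>\<or>) \<otimes>\<^sub>m (y \<otimes>\<^sub>m \<i>\<d> X)))"
      using xy ab X T by (intro comp_add_right[symmetric]) auto
    also have "(\<i>\<d> (X\<^sup>\<or>) \<otimes>\<^sub>m (x \<otimes>\<^sub>m \<i>\<d> X)) \<oplus>\<^bsub>Hom C (?T X \<one>\<^sub>o) (?T X (A D))\<^esub> (\<i>\<d> (X\<^sup>\<or>) \<otimes>\<^sub>m (y \<otimes>\<^sub>m \<i>\<d> X)) =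
      \<i>\<d> (X\<^sup>\<or>) \<otimes>\<^sub>m ((x \<otimes>\<^sub>m \<i>\<d> X) \<oplus>\<^bsub>Hom C (\<one>\<^sub>o \<otimes>\<^sub>o X) (A D \<otimes>\<^sub>o X)\<^esub> (y \<otimes>\<^sub>m \<i>\<d> X))"
      using xy X by (intro tensor_add_right[symmetric] tensor_mor_closed ide_closed) auto
    also have "(x \<otimes>\<^sub>m \<i>\<d> X) \<oplus>\<^bsub>Hom C (\<one>\<^sub>o \<otimes>\<^sub>o X) (A D \<otimes>\<^sub>o X)\<^esub> (y \<otimes>\<^sub>m \<i>\<d> X) = (x \<oplus>\<^bsub>?H\<^esub> y) \<otimes>\<^sub>m \<i>\<d> X"
      using xy X by (intro tensor_add_left[symmetric] ide_closed) auto
    finally show "(x \<oplus>\<^bsub>?H\<^esub> y) \<cdot> a X = b X \<cdot> (\<i>\<d> (X\<^sup>\<or>) \<otimes>\<^sub>m ((x \<oplus>\<^bsub>?H\<^esub> y) \<otimes>\<^sub>m \<i>\<d> X))" .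
  qed
  have lin: "(k \<odot>\<^bsub>?H\<^esub> x) \<cdot> a X = k \<odot>\<^bsub>Hom C (?T X \<one>\<^sub>o) (A D)\<^esub> (x \<cdot> a X)"
      "b X \<cdot> (\<i>\<d> (X\<^sup>\<or>) \<otimes>\<^sub>m ((k \<odot>\<^bsub>?H\<^esub> x) \<otimes>\<^sub>m \<i>\<d> X)) = k \<odot>\<^bsub>Hom C (?T X \<one>\<^sub>o) (A D)\<^esub> (b X \<cdot> (\<i>\<d> (X\<^sup>\<or>) \<otimes>\<^sub>m (x \<otimes>\<^sub>m \<i>\<d> X)))"
    if x: "x \<in> carrier ?H" and k: "k \<in> carrier K" and X: "X \<in> Obj C" for x k X
  proof -
    show "(k \<odot>\<^bsub>?H\<^esub> x) \<cdot> a X = k \<odot>\<^bsub>Hom C (?T X \<one>\<^sub>o) (A D)\<^esub> (x \<cdot> a X)"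
      using x k ab X by (intro comp_smult_left) auto
    have "(k \<odot>\<^bsub>?H\<^esub> x) \<otimes>\<^sub>m \<i>\<d> X = k \<odot>\<^bsub>Hom C (\<one>\<^sub>o \<otimes>\<^sub>o X) (A D \<otimes>\<^sub>o X)\<^esub> (x \<otimes>\<^sub>m \<i>\<d> X)"
      using x k X by (intro tensor_smult_left ide_closed) auto
    moreover have "\<i>\<d> (X\<^sup>\<or>) \<otimes>\<^sub>m (k \<odot>\<^bsub>Hom C (\<one>\<^sub>o \<otimes>\<^sub>o X) (A D \<otimes>\<^sub>o X)\<^esub> (x \<otimes>\<^sub>m \<i>\<d> X)) =
        k \<odot>\<^bsub>Hom C (?T X \<one>\<^sub>o) (?T X (A D))\<^esub> (\<i>\<d> (X\<^sup>\<or>) \<otimes>\<^sub>m (x \<otimes>\<^sub>m \<i>\<d> X))"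
      using x k X by (intro tensor_smult_right tensor_mor_closed ide_closed) auto
    moreover have "b X \<cdot> (k \<odot>\<^bsub>Hom C (?T X \<one>\<^sub>o) (?T X (A D))\<^esub> (\<i>\<d> (X\<^sup>\<or>) \<otimes>\<^sub>m (x \<otimes>\<^sub>m \<i>\<d> X))) =
        k \<odot>\<^bsub>Hom C (?T X \<one>\<^sub>o) (A D)\<^esub> (b X \<cdot> (\<i>\<d> (X\<^sup>\<or>) \<otimes>\<^sub>m (x \<otimes>\<^sub>m \<i>\<d> X)))"
      using x k ab T X by (intro comp_smult_right) auto
    ultimately show "b X \<cdot> (\<i>\<d> (X\<^sup>\<or>) \<otimes>\<^sub>m ((k \<odot>\<^bsub>?H\<^esub> x) \<otimes>\<^sub>m \<i>\<d> X)) = k \<odot>\<^bsub>Hom C (?T X \<one>\<^sub>o) (A D)\<^esub> (b X \<cdot> (\<i>\<d> (X\<^sup>\<or>) \<otimes>\<^sub>m (x \<otimes>\<^sub>m \<i>\<d> X)))"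
      by simp
  qed
  have Msmult: "k \<odot>\<^bsub>?H\<^esub> x \<in> carrier M" if "k \<in> carrier K" "x \<in> carrier M" for k x
    using that lin unfolding MI by simp
  have Mzero: "\<zero>\<^bsub>?H\<^esub> \<in> carrier M"
    unfolding MI
  proof (intro conjI ballI)
    fix X assume X: "X \<in> Obj C"
    interpret T: vectorspace K "Hom C (?T X \<one>\<^sub>o) (A D)" by (rule hom_vectorspace) (use X in auto)
    have z: "\<zero>\<^bsub>K\<^esub> \<odot>\<^bsub>?H\<^esub> \<zero>\<^bsub>?H\<^esub> = \<zero>\<^bsub>?H\<^esub>" by simp
    have "\<zero>\<^bsub>?H\<^esub> \<cdot> a X \<in> carrier (Hom C (?T X \<one>\<^sub>o) (A D))"
      using X ab(1) by (intro comp_closed[of _ "\<one>\<^sub>o"]) auto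
    hence 1: "\<zero>\<^bsub>?H\<^esub> \<cdot> a X = \<zero>\<^bsub>Hom C (?T X \<one>\<^sub>o) (A D)\<^esub>"
      using lin(1)[of "\<zero>\<^bsub>?H\<^esub>" "\<zero>\<^bsub>K\<^esub>" X] X unfolding z by simp
    have "b X \<cdot> (\<i>\<d> (X\<^sup>\<or>) \<otimes>\<^sub>m (\<zero>\<^bsub>?H\<^esub> \<otimes>\<^sub>m \<i>\<d> X)) \<in> carrier (Hom C (?T X \<one>\<^sub>o) (A D))"
      using X ab(2) T[of X "\<zero>\<^bsub>?H\<^esub>"] by (intro comp_closed[of _ "?T X (A D)"]) auto
    hence "b X \<cdot> (\<i>\<d> (X\<^sup>\<or>) \<otimes>\<^sub>m (\<zero>\<^bsub>?H\<^esub> \<otimes>\<^sub>m \<i>\<d> X)) = \<zero>\<^bsub>Hom C (?T X \<one>\<^sub>o) (A D)\<^esub>"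
      using lin(2)[of "\<zero>\<^bsub>?H\<^esub>" "\<zero>\<^bsub>K\<^esub>" X] X unfolding z by simp
    with 1 show "\<zero>\<^bsub>?H\<^esub> \<cdot> a X = b X \<cdot> (\<i>\<d> (X\<^sup>\<or>) \<otimes>\<^sub>m (\<zero>\<^bsub>?H\<^esub> \<otimes>\<^sub>m \<i>\<d> X))" by simp
  qed simp
  have MV: "vectorspace K M"
    by (subst M, rule vectorspace_restrict[OF H.vectorspace_axioms MH Mzero]) (use Madd Msmult in auto)

  define \<Phi> where "\<Phi> r = raw (Phi D (Arr \<one>\<^sub>o r (A D)))" for r
  have PhiA: "Phi D (Arr \<one>\<^sub>o r (A D)) = Arr ?Z (\<Phi> r) \<one>\<^sub>o" for r
    by (rule arrow_eqI) (auto simp: \<Phi>_def)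
  have PG: "\<Phi> r \<in> carrier ?G" if "r \<in> carrier ?H" for r
    using ok_raw[OF ok_Phi[OF D, of "Arr \<one>\<^sub>o r (A D)"]] ok_Arr[OF _ _ that] by (simp add: \<Phi>_def)
  have PM: "\<Phi> r \<in> carrier N \<longleftrightarrow> r \<in> carrier M" if "r \<in> carrier ?H" for r
    using Phi_cointegral[OF D, of "Arr \<one>\<^sub>o r (A D)"] ok_Arr[OF _ _ that] PG[OF that] that
    unfolding M_def N_def monadic_iff[OF D] categorical_iff[OF D] PhiA by simp
  have inj: "inj_on \<Phi> (carrier ?H)"
  proof (rule inj_onI)
    fix x y assume xy: "x \<in> carrier ?H" "y \<in> carrier ?H" "\<Phi> x = \<Phi> y"
    have [simp]: "ok (Arr \<one>\<^sub>o x (A D))" "ok (Arr \<one>\<^sub>o y (A D))" using xy by (auto intro!: ok_Arr)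
    have "Arr \<one>\<^sub>o x (A D) = Arr \<one>\<^sub>o y (A D)"
      by (rule rperf_pb_inj[OF Ep_rperf[OF d]]) (use xy(3) in \<open>auto simp: Phi_pb PhiA\<close>)
    thus "x = y" by simp
  qed
  have surj: "\<exists>r\<in>carrier ?H. \<Phi> r = g" if g: "g \<in> carrier ?G" for g
  proof -
    let ?g = "Arr ?Z g \<one>\<^sub>o"
    have [simp]: "ok ?g" using g by (intro ok_Arr) auto
    obtain f where f: "ok f" "src f = \<one>\<^sub>o" "tgt f = A D" "pb ?e (ide ?Z) f = pb unit_pairing ?g (ide \<one>\<^sub>o)"
      using rperf_pb_ex[OF Ep_rperf[OF d], of "pb unit_pairing ?g (ide \<one>\<^sub>o)"] by auto
    have "Phi D f = ?g"
      by (rule lperf_pb_inj[OF dual_lperf[OF dual_unit_pairing]]) (use f in \<open>auto simp: Phi_pb\<close>)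
    moreover have "f = Arr \<one>\<^sub>o (raw f) (A D)" using f by (intro arrow_eqI) auto
    ultimately have "\<Phi> (raw f) = g" unfolding \<Phi>_def by (metis arrow.sel(2))
    thus ?thesis using ok_raw[OF f(1)] f by auto
  qed
  have bij: "bij_betw \<Phi> (carrier M) (carrier N)"
    unfolding bij_betw_def
  proof (intro conjI equalityI subsetI)
    show "inj_on \<Phi> (carrier M)" using inj MH by (rule inj_on_subset)
  next
    fix g assume "g \<in> \<Phi> ` carrier M"
    thus "g \<in> carrier N" using PM MH by auto
  next
    fix g assume g: "g \<in> carrier N"
    then obtain r where "r \<in> carrier ?H" "\<Phi> r = g" using surj NG by blast
    thus "g \<in> \<Phi> ` carrier M" using PM g by blast
  qed
  have \<Phi>_eq: "\<Phi> r = raw (form ?e) \<cdot> (\<i>\<d> ?Z \<otimes>\<^sub>m r) \<cdot> raw (ur ?Z)" for r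
    by (simp add: \<Phi>_def Phi_def raw_simps)
  have eh: "raw (form ?e) \<in> homset C (?Z \<otimes>\<^sub>o A D) \<one>\<^sub>o" "raw (ur ?Z) \<in> homset C ?Z (?Z \<otimes>\<^sub>o \<one>\<^sub>o)"
    using ok_raw[of "form ?e"] ok_raw[of "ur ?Z"] by simp_all
  have th: "\<i>\<d> ?Z \<otimes>\<^sub>m r \<in> homset C (?Z \<otimes>\<^sub>o \<one>\<^sub>o) (?Z \<otimes>\<^sub>o A D)" if "r \<in> carrier ?H" for r
    using that by (intro tensor_mor_closed ide_closed) auto
  have th': "(\<i>\<d> ?Z \<otimes>\<^sub>m r) \<cdot> raw (ur ?Z) \<in> homset C ?Z (?Z \<otimes>\<^sub>o A D)" if "r \<in> carrier ?H" for r
    using eh th[OF that] by (intro comp_closed[of _ "?Z \<otimes>\<^sub>o \<one>\<^sub>o"]) auto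
  have add: "\<Phi> (x \<oplus>\<^bsub>?H\<^esub> y) = \<Phi> x \<oplus>\<^bsub>?G\<^esub> \<Phi> y" if xy: "x \<in> carrier ?H" "y \<in> carrier ?H" for x y
  proof -
    have "\<i>\<d> ?Z \<otimes>\<^sub>m (x \<oplus>\<^bsub>?H\<^esub> y) = (\<i>\<d> ?Z \<otimes>\<^sub>m x) \<oplus>\<^bsub>Hom C (?Z \<otimes>\<^sub>o \<one>\<^sub>o) (?Z \<otimes>\<^sub>o A D)\<^esub> (\<i>\<d> ?Z \<otimes>\<^sub>m y)"
      using xy by (intro tensor_add_right ide_closed) auto
    moreover have "((\<i>\<d> ?Z \<otimes>\<^sub>m x) \<oplus>\<^bsub>Hom C (?Z \<otimes>\<^sub>o \<one>\<^sub>o) (?Z \<otimes>\<^sub>o A D)\<^esub> (\<i>\<d> ?Z \<otimes>\<^sub>m y)) \<cdot> raw (ur ?Z) =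
      ((\<i>\<d> ?Z \<otimes>\<^sub>m x) \<cdot> raw (ur ?Z)) \<oplus>\<^bsub>Hom C ?Z (?Z \<otimes>\<^sub>o A D)\<^esub> ((\<i>\<d> ?Z \<otimes>\<^sub>m y) \<cdot> raw (ur ?Z))"
      using xy eh th by (intro comp_add_left) auto
    moreover have "raw (form ?e) \<cdot> (((\<i>\<d> ?Z \<otimes>\<^sub>m x) \<cdot> raw (ur ?Z)) \<oplus>\<^bsub>Hom C ?Z (?Z \<otimes>\<^sub>o A D)\<^esub> ((\<i>\<d> ?Z \<otimes>\<^sub>m y) \<cdot> raw (ur ?Z))) = \<Phi> x \<oplus>\<^bsub>?G\<^esub> \<Phi> y"
      unfolding \<Phi>_eq using xy eh th' by (intro comp_add_right) auto
    ultimately show ?thesis by (simp add: \<Phi>_eq)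
  qed
  have smult: "\<Phi> (k \<odot>\<^bsub>?H\<^esub> x) = k \<odot>\<^bsub>?G\<^esub> \<Phi> x" if x: "x \<in> carrier ?H" and k: "k \<in> carrier K" for x k
  proof -
    have "\<i>\<d> ?Z \<otimes>\<^sub>m (k \<odot>\<^bsub>?H\<^esub> x) = k \<odot>\<^bsub>Hom C (?Z \<otimes>\<^sub>o \<one>\<^sub>o) (?Z \<otimes>\<^sub>o A D)\<^esub> (\<i>\<d> ?Z \<otimes>\<^sub>m x)"
      using x k by (intro tensor_smult_right ide_closed) auto
    moreover have "(k \<odot>\<^bsub>Hom C (?Z \<otimes>\<^sub>o \<one>\<^sub>o) (?Z \<otimes>\<^sub>o A D)\<^esub> (\<i>\<d> ?Z \<otimes>\<^sub>m x)) \<cdot> raw (ur ?Z) =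
      k \<odot>\<^bsub>Hom C ?Z (?Z \<otimes>\<^sub>o A D)\<^esub> ((\<i>\<d> ?Z \<otimes>\<^sub>m x) \<cdot> raw (ur ?Z))"
      using x k eh th by (intro comp_smult_left) auto
    moreover have "raw (form ?e) \<cdot> (k \<odot>\<^bsub>Hom C ?Z (?Z \<otimes>\<^sub>o A D)\<^esub> ((\<i>\<d> ?Z \<otimes>\<^sub>m x) \<cdot> raw (ur ?Z))) = k \<odot>\<^bsub>?G\<^esub> \<Phi> x"
      unfolding \<Phi>_eq using x k eh th' by (intro comp_smult_right) auto
    ultimately show ?thesis by (simp add: \<Phi>_eq)
  qed
  \<comment> \<open>closure under the operations is transported along \<open>\<Phi>\<close>\<close>
  have N_im: "carrier N = \<Phi> ` carrier M" using bij by (simp add: bij_betw_def)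
  have NV: "vectorspace K N"
  proof (subst N, rule vectorspace_restrict[OF G.vectorspace_axioms NG])
    have "\<Phi> \<zero>\<^bsub>?H\<^esub> = \<zero>\<^bsub>K\<^esub> \<odot>\<^bsub>?G\<^esub> \<Phi> \<zero>\<^bsub>?H\<^esub>" using smult[of "\<zero>\<^bsub>?H\<^esub>" "\<zero>\<^bsub>K\<^esub>"] by simp
    also have "\<dots> = \<zero>\<^bsub>?G\<^esub>" using PG[of "\<zero>\<^bsub>?H\<^esub>"] by simp
    finally show "\<zero>\<^bsub>?G\<^esub> \<in> carrier N" unfolding N_im using Mzero by (metis image_eqI)
  next
    fix x y assume "x \<in> carrier N" "y \<in> carrier N"
    then obtain u v where "x = \<Phi> u" "y = \<Phi> v" "u \<in> carrier M" "v \<in> carrier M" unfolding N_im by auto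
    moreover from this have "u \<in> carrier ?H" "v \<in> carrier ?H" using MH by blast+
    ultimately show "x \<oplus>\<^bsub>?G\<^esub> y \<in> carrier N"
      unfolding N_im using imageI[OF Madd[of u v], of \<Phi>] add[of u v] by simp
  next
    fix k x assume "k \<in> carrier K" "x \<in> carrier N"
    then obtain u where "x = \<Phi> u" "u \<in> carrier M" "k \<in> carrier K" unfolding N_im by auto
    moreover from this have "u \<in> carrier ?H" using MH by blast
    ultimately show "k \<odot>\<^bsub>?G\<^esub> x \<in> carrier N"
      unfolding N_im using imageI[OF Msmult[of k u], of \<Phi>] smult[of u k] by simp
  qed
  have ops: "(\<oplus>\<^bsub>M\<^esub>) = (\<oplus>\<^bsub>?H\<^esub>)" "(\<odot>\<^bsub>M\<^esub>) = (\<odot>\<^bsub>?H\<^esub>)" "(\<oplus>\<^bsub>N\<^esub>) = (\<oplus>\<^bsub>?G\<^esub>)" "(\<odot>\<^bsub>N\<^esub>) = (\<odot>\<^bsub>?G\<^esub>)"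
    unfolding M_def N_def right_monadic_cointegrals_def categorical_cointegrals_def by simp_all
  have hom: "\<Phi> \<in> module_hom K M N"
    unfolding module_hom_def ops mem_Collect_eq
  proof (intro conjI allI impI; (elim conjE)?)
    show "\<Phi> \<in> carrier M \<rightarrow> carrier N" using bij by (rule bij_betw_imp_funcset)
  next
    fix x y assume "x \<in> carrier M" "y \<in> carrier M"
    thus "\<Phi> (x \<oplus>\<^bsub>?H\<^esub> y) = \<Phi> x \<oplus>\<^bsub>?G\<^esub> \<Phi> y" using MH by (intro add) blast+
  next
    fix k x assume "k \<in> carrier K" "x \<in> carrier M"
    thus "\<Phi> (k \<odot>\<^bsub>?H\<^esub> x) = k \<odot>\<^bsub>?G\<^esub> \<Phi> x" using MH by (intro smult) blast+
  qed
  interpret MV: vectorspace K M by (rule MV)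
  interpret NV: vectorspace K N by (rule NV)
  have "linear_map K M N \<Phi>"
    unfolding linear_map_def mod_hom_def mod_hom_axioms_def
    by (intro conjI MV NV hom MV.module_axioms NV.module_axioms)
  with bij show ?thesis by blast
qed

end

theorem corollary2p13:
  fixes K :: "('k, 'r) ring_scheme"
    and C :: "('k, 'o, 'm, 'c) tensor_cat_scheme"
    and D :: 'o
    and A2 Z4 :: "'o \<Rightarrow> 'o"
    and \<iota>\<^sub>2 \<pi>\<^sub>4 :: "'o \<Rightarrow> 'o \<Rightarrow> 'm"
  assumes "finite_tensor_category K C"
    and "distinguished_invertible_object C D"
    and "is_A2 C A2 \<iota>\<^sub>2"
    and "is_Z4 C Z4 \<pi>\<^sub>4"
  shows "\<exists>\<Phi>. linear_map K (right_monadic_cointegrals C A2 \<iota>\<^sub>2 D) (categorical_cointegrals C Z4 \<pi>\<^sub>4 D) \<Phi> \<and>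
    bij_betw \<Phi> (carrier (right_monadic_cointegrals C A2 \<iota>\<^sub>2 D))
      (carrier (categorical_cointegrals C Z4 \<pi>\<^sub>4 D))"
proof -
  interpret coend_end_data K C A2 Z4 \<iota>\<^sub>2 \<pi>\<^sub>4
    using assms by (simp add: coend_end_data_def coend_end_data_axioms_def)
  have "semisimple C D"
    using assms(2) by (auto simp: distinguished_invertible_object_def is_socle_def)
  hence "D \<in> Obj C"
    by cases (auto simp: zero_object_def is_biproduct_def)
  thus ?thesis by (rule cointegrals_iso)
qed

end
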